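(* A graph $G$ satisfies $\mathrm{sn}(G)\leq 2$ if and only if none of the four graphs $K_4$, $P_{3;3}$, $C_{3;2,2,1}$, $LL_6$ is a topological minor of $G$.
   Context: Graphs are finite, with multiple edges allowed but no loops. Smoothing a vertex $u$ of degree $2$ whose two incident edges go to distinct vertices $v,w$ means deleting $u$ and its two edges and adding an edge $vw$. $H$ is a topological minor of $G$ if $H$ can be obtained from $G$ by deleting vertices, deleting edges, and smoothing vertices. An egg is a nonempty subset $E\subseteq V(G)$ inducing a connected subgraph; a scramble $\mathcal{S}$ is a collection of eggs. A hitting set is a set of vertices meeting every egg; $h(\mathcal{S})$ is the minimum size of a hitting set. An egg-cut is a set of edges whose deletion disconnects $G$ into two components each containing an egg of $\mathcal{S}$; $e(\mathcal{S})$ is the minimum size of an egg-cut ($\infty$ if none exists). The order is $\|\mathcal{S}\|=\min\{h(\mathcal{S}),e(\mathcal{S})\}$, and the scramble number $\mathrm{sn}(G)$ is the maximum order of a scramble on $G$. $K_4$ is the complete graph on 4 vertices. $P_{3;3}$ is the path on three vertices $a-b-c$ in which each of the two edges $ab,bc$ is replaced by $3$ parallel edges. $C_{3;2,2,1}$ is the triangle in which two of the three edges are replaced by $2$ parallel edges and the third is a single edge. $LL_6$ (loop-of-loops) is the $6$-cycle $u_1u_2u_3u_4u_5u_6$ in which the edges $u_1u_2$, $u_3u_4$, $u_5u_6$ are each replaced by $2$ parallel edges and $u_2u_3$, $u_4u_5$, $u_6u_1$ are single edges. *)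

theory Defs
  imports Main "HOL-Library.Multiset" "HOL-Library.Extended_Nat"
begin

text \<open>
  Undirected multigraphs: an edge is the set of its two ends, and parallel edges are
  repeated elements of the edge multiset. Consequently a ``set of edges'' of a graph is a
  sub-multiset of its edge multiset, and its cardinality is \<open>size\<close>.
\<close>

record 'v mgraph =
  verts :: "'v set"
  edges :: "'v set multiset"

definition multigraph :: "'v mgraph \<Rightarrow> bool" where
  "multigraph G \<longleftrightarrow> finite (verts G) \<and> (\<forall>e\<in>#edges G. e \<subseteq> verts G \<and> card e = 2)"

definition graph_iso :: "'v mgraph \<Rightarrow> 'w mgraph \<Rightarrow> bool" where
  "graph_iso G H \<longleftrightarrow>
    (\<exists>f. bij_betw f (verts G) (verts H) \<and> image_mset (image f) (edges G) = edges H)"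

definition reachable :: "'v mgraph \<Rightarrow> 'v \<Rightarrow> 'v \<Rightarrow> bool" where
  "reachable G = (\<lambda>u v. {u, v} \<in># edges G)\<^sup>*\<^sup>*"

definition connected_graph :: "'v mgraph \<Rightarrow> bool" where
  "connected_graph G \<longleftrightarrow> verts G \<noteq> {} \<and> (\<forall>u\<in>verts G. \<forall>v\<in>verts G. reachable G u v)"

definition components :: "'v mgraph \<Rightarrow> 'v set set" where
  "components G = (\<lambda>u. {v \<in> verts G. reachable G u v}) ` verts G"

definition induced_subgraph :: "'v mgraph \<Rightarrow> 'v set \<Rightarrow> 'v mgraph" where
  "induced_subgraph G U = \<lparr>verts = U, edges = {#e \<in># edges G. e \<subseteq> U#}\<rparr>"

definition delete_edges :: "'v mgraph \<Rightarrow> 'v set multiset \<Rightarrow> 'v mgraph" where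
  "delete_edges G A = \<lparr>verts = verts G, edges = edges G - A\<rparr>"

definition incident_edges :: "'v mgraph \<Rightarrow> 'v \<Rightarrow> 'v set multiset" where
  "incident_edges G u = {#e \<in># edges G. u \<in> e#}"

definition delete_vertex :: "'v mgraph \<Rightarrow> 'v \<Rightarrow> 'v mgraph" where
  "delete_vertex G u = \<lparr>verts = verts G - {u}, edges = edges G - incident_edges G u\<rparr>"

definition add_edge :: "'v mgraph \<Rightarrow> 'v set \<Rightarrow> 'v mgraph" where
  "add_edge G e = \<lparr>verts = verts G, edges = add_mset e (edges G)\<rparr>"

inductive tm_step :: "'v mgraph \<Rightarrow> 'v mgraph \<Rightarrow> bool" where
  vertex_deletion: "u \<in> verts G \<Longrightarrow> tm_step G (delete_vertex G u)"
| edge_deletion: "e \<in># edges G \<Longrightarrow> tm_step G (delete_edges G {#e#})"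
| smoothing: "\<lbrakk>u \<in> verts G; incident_edges G u = {#{u, v}, {u, w}#}; v \<noteq> w\<rbrakk>
    \<Longrightarrow> tm_step G (add_edge (delete_vertex G u) {v, w})"

definition topological_minor :: "'w mgraph \<Rightarrow> 'v mgraph \<Rightarrow> bool" where
  "topological_minor H G \<longleftrightarrow> (\<exists>H'. tm_step\<^sup>*\<^sup>* G H' \<and> graph_iso H' H)"

definition egg :: "'v mgraph \<Rightarrow> 'v set \<Rightarrow> bool" where
  "egg G E \<longleftrightarrow> E \<noteq> {} \<and> E \<subseteq> verts G \<and> connected_graph (induced_subgraph G E)"

definition scramble :: "'v mgraph \<Rightarrow> 'v set set \<Rightarrow> bool" where
  "scramble G S \<longleftrightarrow> (\<forall>E\<in>S. egg G E)"

definition hitting_set :: "'v mgraph \<Rightarrow> 'v set set \<Rightarrow> 'v set \<Rightarrow> bool" where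
  "hitting_set G S H \<longleftrightarrow> H \<subseteq> verts G \<and> (\<forall>E\<in>S. H \<inter> E \<noteq> {})"

text \<open>
  The graph left after deleting an egg-cut may have further components besides the two that
  contain eggs. For connected graphs this does not affect the minimum size of an egg-cut; for
  disconnected graphs it makes the empty set an egg-cut as soon as two components of the
  graph contain eggs.
\<close>

definition egg_cut :: "'v mgraph \<Rightarrow> 'v set set \<Rightarrow> 'v set multiset \<Rightarrow> bool" where
  "egg_cut G S A \<longleftrightarrow> A \<subseteq># edges G \<and>
    (\<exists>C\<in>components (delete_edges G A). \<exists>D\<in>components (delete_edges G A).
      C \<noteq> D \<and> (\<exists>E\<in>S. E \<subseteq> C) \<and> (\<exists>E\<in>S. E \<subseteq> D))"

text \<open>
  Infima in \<^typ>\<open>enat\<close> are attained on nonempty sets, and the infimum of the empty set is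
  \<open>\<infinity>\<close>.
\<close>

definition hitting_number :: "'v mgraph \<Rightarrow> 'v set set \<Rightarrow> enat" where
  "hitting_number G S = (INF H\<in>{H. hitting_set G S H}. enat (card H))"

definition egg_cut_number :: "'v mgraph \<Rightarrow> 'v set set \<Rightarrow> enat" where
  "egg_cut_number G S = (INF A\<in>{A. egg_cut G S A}. enat (size A))"

definition scramble_order :: "'v mgraph \<Rightarrow> 'v set set \<Rightarrow> enat" where
  "scramble_order G S = min (hitting_number G S) (egg_cut_number G S)"

definition scramble_number :: "'v mgraph \<Rightarrow> enat" where
  "scramble_number G = Max (scramble_order G ` {S. scramble G S})"

definition K4 :: "nat mgraph" where
  "K4 = \<lparr>verts = {1, 2, 3, 4},
         edges = {#{1, 2}, {1, 3}, {1, 4}, {2, 3}, {2, 4}, {3, 4}#}\<rparr>"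

definition P33 :: "nat mgraph" where
  "P33 = \<lparr>verts = {1, 2, 3},
          edges = replicate_mset 3 {1, 2} + replicate_mset 3 {2, 3}\<rparr>"

definition C3221 :: "nat mgraph" where
  "C3221 = \<lparr>verts = {1, 2, 3},
            edges = replicate_mset 2 {1, 2} + replicate_mset 2 {2, 3} + {#{1, 3}#}\<rparr>"

definition LL6 :: "nat mgraph" where
  "LL6 = \<lparr>verts = {1, 2, 3, 4, 5, 6},
          edges = replicate_mset 2 {1, 2} + replicate_mset 2 {3, 4} + replicate_mset 2 {5, 6}
                + {#{2, 3}, {4, 5}, {6, 1}#}\<rparr>"

lemma multigraph_K4: "multigraph K4"
  and multigraph_P33: "multigraph P33"
  and multigraph_C3221: "multigraph C3221"
  and multigraph_LL6: "multigraph LL6"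
  by (auto simp: multigraph_def K4_def P33_def C3221_def LL6_def)

lemma tm_step_multigraph:
  assumes "tm_step G H" "multigraph G"
  shows "multigraph H"
  using assms
proof cases
  case (vertex_deletion u)
  have "edges G - incident_edges G u = {#e \<in># edges G. u \<notin> e#}"
    unfolding incident_edges_def by (metis add_diff_cancel_left' multiset_partition)
  with vertex_deletion assms(2) show ?thesis
    by (auto simp: multigraph_def delete_vertex_def)
next
  case (edge_deletion e)
  with assms(2) show ?thesis
    by (auto simp: multigraph_def delete_edges_def dest: in_diffD)
next
  case (smoothing u v w)
  have eq: "edges G - incident_edges G u = {#e \<in># edges G. u \<notin> e#}"
    unfolding incident_edges_def by (metis add_diff_cancel_left' multiset_partition)
  have "{u, v} \<in># incident_edges G u" "{u, w} \<in># incident_edges G u"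
    using smoothing by auto
  then have "{u, v} \<in># edges G" "{u, w} \<in># edges G"
    by (auto simp: incident_edges_def)
  with assms(2) have "v \<in> verts G" "w \<in> verts G" "u \<noteq> v" "u \<noteq> w"
    by (auto simp: multigraph_def)
  with eq smoothing assms(2) show ?thesis
    by (auto simp: multigraph_def delete_vertex_def add_edge_def)
qed

lemma finite_scrambles:
  assumes "multigraph G"
  shows "finite {S. scramble G S}" "{S. scramble G S} \<noteq> {}"
proof -
  have "{S. scramble G S} \<subseteq> Pow (Pow (verts G))"
    by (auto simp: scramble_def egg_def)
  then show "finite {S. scramble G S}"
    using assms by (auto simp: multigraph_def intro: finite_subset)
  show "{S. scramble G S} \<noteq> {}"
    by (auto simp: scramble_def intro: exI[of _ "{}"])
qed

end

theory Submission
  imports Defs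
begin

text \<open>
  Having a scramble of order at least 3 is inherited from topological minors (an egg that contains
  one end of a smoothed edge is enlarged by the smoothed vertex), and each of the four graphs has
  such a scramble: the singletons, except for LL6, where the three single edges serve.

  Conversely, let \<open>G\<close> have a scramble of order at least 3 and argue by induction on the number of
  vertices. If a nonempty set \<open>X\<close> contains no egg and has at most one outside neighbour, delete \<open>X\<close>
  from the graph and from the eggs. If \<open>X\<close> contains no egg and is joined to the rest by two edges
  ending in distinct \<open>y\<^sub>1\<close>, \<open>y\<^sub>2\<close>, replace \<open>X\<close> by an edge \<open>y\<^sub>1y\<^sub>2\<close>. The eggs without \<open>X\<close> remain a
  scramble of order at least 3 unless \<open>G\<close> is a ring of three egg-free parts with single edges between
  them. In a ring every part splits into two connected halves joined by at least two edges, since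
  otherwise two vertices hit all eggs; contracting the six halves gives LL6. If no cut has fewer
  than three edges, the graph is 3-edge-connected. A minimal 3-edge-connected graph with at least three
  vertices has no nontrivial 3-cut (one side can be contracted, because connected sets with at most
  three boundary edges contract within topological minors), which forces it to be \<open>K\<^sub>4\<close> or to
  have three vertices.
\<close>

section \<open>Connectedness by cuts\<close>

text \<open>Topological minors restrict contraction: a connected set with at most three boundary
  edges shrinks to one of its vertices, whereas a larger boundary may not fit on any single vertex
  of the set. LEMMAs of that kind therefore suit LL6, which is cubic; P33 and C3221, with a vertex
  of degree 6 and of degree 4, are read off directly once only three vertices are left. The ring is
  the only place where bypassing an egg-free set \<open>X\<close> fails. Two eggs that reach into
  \<open>X\<close> from opposite sides may meet inside \<open>X\<close>, so no cut of
  \<open>G\<close> separates them. Without \<open>X\<close> they become disjoint, and the new edge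
  together with at most one further edge may then form an egg-cut. That further edge and the two
  boundary edges of \<open>X\<close> are the three links of the ring. The scramble shrinks along
  with the graph during the induction and is forgotten as soon as the graph is 3-edge-connected;
  from then on only edge cuts and the presence of three vertices count.\<close>

definition conn :: "'v set multiset \<Rightarrow> 'v set \<Rightarrow> bool" where
  "conn E X \<longleftrightarrow> X \<noteq> {} \<and> (\<forall>A. A \<subset> X \<longrightarrow> A \<noteq> {} \<longrightarrow> (\<exists>a\<in>A. \<exists>b\<in>X - A. {a, b} \<in># E))"

text \<open>\<open>A\<close> and \<open>B\<close> are arbitrary sets, and \<open>cut\<close>
  complements inside the whole type: edges of a multigraph stay inside its vertex set anyway.
  Parallel edges keep their multiplicity.\<close>

definition between :: "'v set multiset \<Rightarrow> 'v set \<Rightarrow> 'v set \<Rightarrow> 'v set multiset" where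
  "between E A B = {#e \<in># E. e \<inter> A \<noteq> {} \<and> e \<inter> B \<noteq> {}#}"

abbreviation cut :: "'v set multiset \<Rightarrow> 'v set \<Rightarrow> 'v set multiset" where
  "cut E A \<equiv> between E A (- A)"

lemma multigraph_edgeE:
  assumes "multigraph G" "e \<in># edges G"
  obtains u v where "e = {u, v}" "u \<noteq> v" "u \<in> verts G" "v \<in> verts G"
proof -
  have "card e = 2" "e \<subseteq> verts G" using assms by (auto simp: multigraph_def)
  then show ?thesis using that by (auto simp: card_2_iff)
qed

lemma connD:
  assumes "conn E X" "A \<subset> X" "A \<noteq> {}"
  obtains a b where "a \<in> A" "b \<in> X" "b \<notin> A" "{a, b} \<in># E"
  using assms unfolding conn_def by blast

lemma connI:
  assumes "X \<noteq> {}" "\<And>A. A \<subset> X \<Longrightarrow> A \<noteq> {} \<Longrightarrow> \<exists>a\<in>A. \<exists>b\<in>X - A. {a, b} \<in># E"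
  shows "conn E X"
  using assms unfolding conn_def by blast

lemma conn_mono: "conn E X \<Longrightarrow> (\<And>e. e \<in># E \<Longrightarrow> e \<subseteq> X \<Longrightarrow> e \<in># F) \<Longrightarrow> conn F X"
proof (rule connI)
  assume E: "conn E X" and sub: "\<And>e. e \<in># E \<Longrightarrow> e \<subseteq> X \<Longrightarrow> e \<in># F"
  show "X \<noteq> {}" using E by (simp add: conn_def)
  fix A assume A: "A \<subset> X" "A \<noteq> {}"
  then obtain a b where "a \<in> A" "b \<in> X" "b \<notin> A" "{a, b} \<in># E" using connD[OF E] by metis
  then show "\<exists>a\<in>A. \<exists>b\<in>X - A. {a, b} \<in># F" using A sub by blast
qed

lemma conn_singleton [simp]: "conn E {v}"
  unfolding conn_def by blast

lemma conn_insert: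
  assumes "conn E A" "a \<in> A" "{a, y} \<in># E"
  shows "conn E (insert y A)"
proof (rule connI)
  fix B assume B: "B \<subset> insert y A" "B \<noteq> {}"
  show "\<exists>u\<in>B. \<exists>v\<in>insert y A - B. {u, v} \<in># E"
  proof (cases "B \<inter> A = {} \<or> A \<subseteq> B")
    case True
    then show ?thesis
    proof
      assume "B \<inter> A = {}"
      with B have "B = {y}" by blast
      then show ?thesis using assms \<open>B \<inter> A = {}\<close>
        by (intro bexI[of _ y] bexI[of _ a]) (auto simp: insert_commute)
    next
      assume "A \<subseteq> B"
      with B have "y \<notin> B" by blast
      then show ?thesis using assms \<open>A \<subseteq> B\<close> by blast
    qed
  next
    case False
    then obtain u v where "u \<in> B \<inter> A" "v \<in> A" "v \<notin> B \<inter> A" "{u, v} \<in># E"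
      using connD[OF assms(1), of "B \<inter> A"] by blast
    then show ?thesis by blast
  qed
qed simp

lemma conn_pair: "{a, b} \<in># E \<Longrightarrow> conn E {a, b}"
  using conn_insert[of E "{a}" a b] by (simp add: insert_commute)

text \<open>A walk from \<open>A\<close> to a vertex of \<open>X\<close> outside \<open>A\<close>
  crosses over at some step; conversely, the set reachable from \<open>u\<close> inside
  \<open>X\<close> has no edge leaving it and is therefore all of \<open>X\<close>.\<close>

lemma connected_graph_iff_conn:
  "connected_graph (induced_subgraph G X) \<longleftrightarrow> conn (edges G) X"
proof
  assume L: "connected_graph (induced_subgraph G X)"
  show "conn (edges G) X"
  proof (rule connI)
    show "X \<noteq> {}" using L by (simp add: connected_graph_def induced_subgraph_def)
  next
    fix A assume A: "A \<subset> X" "A \<noteq> {}"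
    then obtain a c where ac: "a \<in> A" "c \<in> X" "c \<notin> A" by blast
    then have "reachable (induced_subgraph G X) a c"
      using L A by (auto simp: connected_graph_def induced_subgraph_def)
    then have "(\<lambda>u v. {u, v} \<in># edges (induced_subgraph G X))\<^sup>*\<^sup>* a c"
      unfolding reachable_def .
    then have "c \<in> A \<or> (\<exists>a\<in>A. \<exists>b\<in>X - A. {a, b} \<in># edges G)"
    proof (induction rule: rtranclp_induct)
      case base
      then show ?case using ac by simp
    next
      case (step y z)
      then show ?case by (auto simp: induced_subgraph_def)
    qed
    then show "\<exists>a\<in>A. \<exists>b\<in>X - A. {a, b} \<in># edges G" using ac by blast
  qed
next
  assume R: "conn (edges G) X"
  have "reachable (induced_subgraph G X) u v" if uv: "u \<in> X" "v \<in> X" for u v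
  proof (rule ccontr)
    assume n: "\<not> reachable (induced_subgraph G X) u v"
    define A where "A = {w \<in> X. reachable (induced_subgraph G X) u w}"
    have "u \<in> A" using uv by (simp add: A_def reachable_def)
    moreover have "v \<notin> A" using n by (simp add: A_def)
    moreover have "A \<subseteq> X" by (auto simp: A_def)
    ultimately have "A \<subset> X" "A \<noteq> {}" using uv by auto
    from connD[OF R this] obtain a b
      where ab: "a \<in> A" "b \<in> X" "b \<notin> A" "{a, b} \<in># edges G" by blast
    then have "{a, b} \<in># edges (induced_subgraph G X)"
      by (auto simp: induced_subgraph_def A_def)
    then have "reachable (induced_subgraph G X) u b"
      using ab(1) unfolding A_def reachable_def by (auto intro: rtranclp.rtrancl_into_rtrancl)
    then show False using ab by (simp add: A_def)
  qed
  moreover have "X \<noteq> {}" using R by (simp add: conn_def)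
  ultimately show "connected_graph (induced_subgraph G X)"
    by (simp add: connected_graph_def induced_subgraph_def)
qed

lemma egg_iff_conn: "egg G E \<longleftrightarrow> E \<subseteq> verts G \<and> conn (edges G) E"
  unfolding egg_def connected_graph_iff_conn by (auto simp: conn_def)

section \<open>Splitting connected sets and removing vertices from them\<close>

lemma conn_partition:
  assumes "finite X" "conn E X" "conn E A" "conn E B" "A \<subseteq> X" "B \<subseteq> X" "A \<inter> B = {}"
  shows "\<exists>A' B'. A \<subseteq> A' \<and> B \<subseteq> B' \<and> A' \<union> B' = X \<and> A' \<inter> B' = {} \<and> conn E A' \<and> conn E B'"
  using assms(3-)
proof (induction "card (X - (A \<union> B))" arbitrary: A B rule: less_induct)
  case less
  show ?case
  proof (cases "A \<union> B = X")
    case True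
    then show ?thesis using less.prems by blast
  next
    case False
    then have "A \<union> B \<subset> X" using less.prems by blast
    moreover have "A \<union> B \<noteq> {}" using less.prems by (simp add: conn_def)
    \<comment> \<open>Greedy growth: a vertex next to \<open>A \<union> B\<close> joins the side it
      is adjacent to, which keeps both sides connected and disjoint.\<close>
    ultimately obtain u y where y: "u \<in> A \<union> B" "y \<in> X" "y \<notin> A \<union> B" "{u, y} \<in># E"
      using connD[OF assms(2)] by metis
    have less_card: "card (X - insert y (A \<union> B)) < card (X - (A \<union> B))"
      by (rule psubset_card_mono) (use y assms(1) in auto)
    from y(1) show ?thesis
    proof
      assume "u \<in> A"
      then have "conn E (insert y A)" using conn_insert less.prems y by metis
      then obtain A' B' where "insert y A \<subseteq> A'" "B \<subseteq> B'" "A' \<union> B' = X" "A' \<inter> B' = {}"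
        "conn E A'" "conn E B'"
        using less.hyps[of "insert y A" B] less_card less.prems y by auto
      then show ?thesis by blast
    next
      assume "u \<in> B"
      then have "conn E (insert y B)" using conn_insert less.prems y by metis
      then obtain A' B' where "A \<subseteq> A'" "insert y B \<subseteq> B'" "A' \<union> B' = X" "A' \<inter> B' = {}"
        "conn E A'" "conn E B'"
        using less.hyps[of A "insert y B"] less_card less.prems y by auto
      then show ?thesis by blast
    qed
  qed
qed

text \<open>A maximal connected proper subset containing \<open>t\<close> misses just one vertex: an
  edge leaving it leads to a vertex that can be added, and by maximality the result is
  \<open>X\<close>.\<close>

lemma conn_remove_vertex:
  assumes "finite X" "conn E X" "t \<in> X" "X \<noteq> {t}"
  obtains x where "x \<in> X" "x \<noteq> t" "conn E (X - {x})"
proof -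
  define \<A> where "\<A> = {A. A \<subset> X \<and> t \<in> A \<and> conn E A}"
  have "finite \<A>" unfolding \<A>_def using assms(1) by (auto intro: rev_finite_subset[of "Pow X"])
  moreover have "{t} \<in> \<A>" using assms by (auto simp: \<A>_def)
  ultimately obtain A where A: "A \<in> \<A>" and max: "\<forall>B\<in>\<A>. A \<subseteq> B \<longrightarrow> A = B"
    using finite_has_maximal2[of \<A> "{t}"] by blast
  obtain a y where y: "a \<in> A" "y \<in> X" "y \<notin> A" "{a, y} \<in># E"
    using connD[OF assms(2), of A] A unfolding \<A>_def by blast
  moreover have "conn E A" using A by (simp add: \<A>_def)
  ultimately have "conn E (insert y A)" by (blast intro: conn_insert)
  then have "insert y A = X" using A y max unfolding \<A>_def by blast
  then have "X - {y} = A" using y by auto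
  then show ?thesis using that[of y] A y by (auto simp: \<A>_def)
qed

text \<open>The second removal protects the vertex found by the first, which makes the two
  different.\<close>

lemma conn_two_removable:
  assumes "finite X" "conn E X" "u \<in> X" "v \<in> X" "u \<noteq> v"
  obtains x y where "x \<in> X" "y \<in> X" "x \<noteq> y" "conn E (X - {x})" "conn E (X - {y})"
proof -
  obtain x where x: "x \<in> X" "x \<noteq> u" "conn E (X - {x})"
    using conn_remove_vertex[OF assms(1-3)] assms by blast
  obtain y where "y \<in> X" "y \<noteq> x" "conn E (X - {y})"
    using conn_remove_vertex[OF assms(1,2) x(1)] assms x by blast
  then show ?thesis using x that by blast
qed

section \<open>Topological minors\<close>

lemma tm_step_delete_vertex:
  assumes "multigraph G" "u \<in> verts G"
  shows "tm_step G \<lparr>verts = verts G - {u}, edges = {#e \<in># edges G. u \<notin> e#}\<rparr>"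
proof -
  have "edges G - incident_edges G u = {#e \<in># edges G. u \<notin> e#}"
    unfolding incident_edges_def by (metis add_diff_cancel_left' multiset_partition)
  then show ?thesis using tm_step.vertex_deletion[OF assms(2)] by (simp add: delete_vertex_def)
qed

lemma tm_steps_multigraph: "tm_step\<^sup>*\<^sup>* G H \<Longrightarrow> multigraph G \<Longrightarrow> multigraph H"
  by (induction rule: rtranclp_induct) (auto intro: tm_step_multigraph)

lemma tm_steps_induced:
  assumes "multigraph G" "X \<subseteq> verts G"
  shows "tm_step\<^sup>*\<^sup>* G (induced_subgraph G (verts G - X))"
proof -
  have "finite X" using assms by (auto simp: multigraph_def intro: finite_subset)
  then show ?thesis using assms
  proof (induction arbitrary: G rule: finite_induct)
    case empty
    then have "induced_subgraph G (verts G) = G"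
      by (cases G) (auto simp: induced_subgraph_def multigraph_def filter_mset_eq_conv)
    then show ?case by simp
  next
    case (insert x X)
    let ?H = "\<lparr>verts = verts G - {x}, edges = {#e \<in># edges G. x \<notin> e#}\<rparr>"
    have s: "tm_step G ?H" by (rule tm_step_delete_vertex) (use insert.prems in auto)
    have "multigraph ?H" using tm_step_multigraph[OF s insert.prems(1)] .
    then have "tm_step\<^sup>*\<^sup>* ?H (induced_subgraph ?H (verts ?H - X))"
      by (rule insert.IH) (use insert in auto)
    moreover have "induced_subgraph ?H (verts ?H - X) = induced_subgraph G (verts G - insert x X)"
      by (auto simp: induced_subgraph_def filter_filter_mset intro!: filter_mset_cong)
    ultimately show ?case using s by (metis converse_rtranclp_into_rtranclp)
  qed
qed

lemma tm_steps_sub_edges: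
  assumes "M \<subseteq># edges G"
  shows "tm_step\<^sup>*\<^sup>* G \<lparr>verts = verts G, edges = M\<rparr>"
proof -
  obtain A where "edges G = M + A" using assms by (metis subset_mset.le_iff_add)
  then show ?thesis
  proof (induction A arbitrary: G)
    case empty
    then have "G = \<lparr>verts = verts G, edges = M\<rparr>" by (cases G) auto
    then show ?case by (metis rtranclp.rtrancl_refl)
  next
    case (add x A)
    then have "tm_step G (delete_edges G {#x#})" by (auto intro: tm_step.edge_deletion)
    moreover have "tm_step\<^sup>*\<^sup>* (delete_edges G {#x#}) \<lparr>verts = verts G, edges = M\<rparr>"
      using add.IH[of "delete_edges G {#x#}"] add.prems by (simp add: delete_edges_def)
    ultimately show ?case by (metis converse_rtranclp_into_rtranclp)
  qed
qed

definition split_off :: "'v mgraph \<Rightarrow> 'v \<Rightarrow> 'v \<Rightarrow> 'v \<Rightarrow> 'v mgraph" where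
  "split_off G u a b = \<lparr>verts = verts G - {u}, edges = add_mset {a, b} {#e \<in># edges G. u \<notin> e#}\<rparr>"

text \<open>Smoothing demands degree exactly 2. All edges at \<open>u\<close> except one copy of
  each chosen edge are deleted first, so \<open>u\<close> may have any degree in
  \<open>G\<close>.\<close>

lemma tm_steps_split_off:
  assumes "multigraph G" "{#{u, a}, {u, b}#} \<subseteq># edges G" "a \<noteq> b"
  shows "tm_step\<^sup>*\<^sup>* G (split_off G u a b)"
proof -
  define M where "M = {#e \<in># edges G. u \<notin> e#} + {#{u, a}, {u, b}#}"
  have "{#{u, a}, {u, b}#} = {#e \<in># {#{u, a}, {u, b}#}. u \<in> e#}" by simp
  also have "\<dots> \<subseteq># {#e \<in># edges G. u \<in> e#}" using assms(2) by (rule multiset_filter_mono)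
  finally have "M \<subseteq># edges G"
    unfolding M_def using multiset_partition[of "edges G" "\<lambda>e. u \<in> e"]
    by (metis add.commute subset_mset.add_left_mono)
  then have 1: "tm_step\<^sup>*\<^sup>* G \<lparr>verts = verts G, edges = M\<rparr>" by (rule tm_steps_sub_edges)
  let ?H = "\<lparr>verts = verts G, edges = M\<rparr>"
  have inc: "incident_edges ?H u = {#{u, a}, {u, b}#}"
    by (simp add: incident_edges_def M_def filter_filter_mset)
  have "{u, a} \<in># edges G" using assms(2) by (meson mset_subset_eqD union_single_eq_member)
  then have "u \<in> verts ?H" using assms(1) by (auto simp: multigraph_def)
  from tm_step.smoothing[OF this inc assms(3)]
  have "tm_step ?H (split_off G u a b)"
    using inc by (simp add: add_edge_def delete_vertex_def split_off_def M_def)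
  with 1 show ?thesis by (rule rtranclp.rtrancl_into_rtrancl)
qed

section \<open>Contracting connected fibres within topological minors\<close>

lemma filter_mset_disj:
  assumes "\<And>x. x \<in># M \<Longrightarrow> \<not> (P x \<and> Q x)"
  shows "{#x \<in># M. P x \<or> Q x#} = {#x \<in># M. P x#} + {#x \<in># M. Q x#}"
  using assms by (induction M) auto

lemma size_filter_mset_disj:
  assumes "\<And>x. x \<in># M \<Longrightarrow> \<not> (P x \<and> Q x)"
  shows "size {#x \<in># M. P x \<or> Q x#} = size {#x \<in># M. P x#} + size {#x \<in># M. Q x#}"
  using filter_mset_disj[of M P Q] assms by simp

lemma size_filter_mset_mono:
  assumes "\<And>x. x \<in># M \<Longrightarrow> P x \<Longrightarrow> Q x"
  shows "size {#x \<in># M. P x#} \<le> size {#x \<in># M. Q x#}"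
  using assms by (induction M) auto

lemma pair_subseteq_mset: "x \<in># M \<Longrightarrow> y \<in># M \<Longrightarrow> x \<noteq> y \<Longrightarrow> {#x, y#} \<subseteq># M"
  by (metis insert_noteq_member multi_member_split mset_subset_eq_add_mset_cancel mset_subset_eq_single)

text \<open>
  A fibre with several vertices has two vertices whose removal leaves it connected. One of them lies
  on at most one boundary edge, so it can be deleted or smoothed without changing the quotient.
\<close>

lemma cubic_quotient:
  fixes \<phi> :: "'v \<Rightarrow> 'w"
  assumes "multigraph G" "\<phi> ` verts G = W"
    and "image_mset (image \<phi>) {#e \<in># edges G. card (\<phi> ` e) = 2#} = N"
    and "\<And>w. w \<in> W \<Longrightarrow> conn (edges G) {v \<in> verts G. \<phi> v = w}"
    and "\<And>w. w \<in> W \<Longrightarrow> card {v \<in> verts G. \<phi> v = w} \<ge> 2 \<Longrightarrow> size {#e \<in># N. w \<in> e#} \<le> 3"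
  shows "\<exists>\<sigma>. (\<forall>w\<in>W. \<sigma> w \<in> verts G \<and> \<phi> (\<sigma> w) = w) \<and>
    tm_step\<^sup>*\<^sup>* G \<lparr>verts = \<sigma> ` W, edges = image_mset (image \<sigma>) N\<rparr>"
  using assms
proof (induction "card (verts G)" arbitrary: G rule: less_induct)
  case less
  note mg = less.prems(1) and W = less.prems(2) and N = less.prems(3)
  have fin: "finite (verts G)" using mg by (simp add: multigraph_def)
  show ?case
  proof (cases "inj_on \<phi> (verts G)")
    case True
    define \<sigma> where "\<sigma> = inv_into (verts G) \<phi>"
    have e: "card (\<phi> ` e) = 2 \<and> \<sigma> ` \<phi> ` e = e" if "e \<in># edges G" for e
    proof -
      have "e \<subseteq> verts G" "card e = 2" using mg that by (auto simp: multigraph_def)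
      then show ?thesis
        using True by (metis \<sigma>_def card_image inj_on_subset inv_into_image_cancel)
    qed
    then have "{#e \<in># edges G. card (\<phi> ` e) = 2#} = edges G" by (simp add: filter_mset_eq_conv)
    then have "image_mset (image \<sigma>) N = image_mset (\<lambda>e. \<sigma> ` \<phi> ` e) (edges G)"
      unfolding N[symmetric] by (simp add: image_mset.compositionality o_def)
    also have "\<dots> = image_mset (\<lambda>e. e) (edges G)"
      using e by (intro image_mset_cong) auto
    finally have "image_mset (image \<sigma>) N = image_mset (\<lambda>e. e) (edges G)" .
    moreover have "\<sigma> ` W = verts G"
      unfolding W[symmetric] \<sigma>_def using True by (rule inv_into_image_cancel) simp
    moreover have "\<forall>w\<in>W. \<sigma> w \<in> verts G \<and> \<phi> (\<sigma> w) = w"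
      unfolding W[symmetric] \<sigma>_def by (auto simp: f_inv_into_f inv_into_into)
    moreover have "G = \<lparr>verts = verts G, edges = edges G\<rparr>" by simp
    ultimately show ?thesis by (metis image_mset.identity id_apply multiset.map_ident rtranclp.rtrancl_refl)
  next
    case False
    then obtain u v where uv: "u \<in> verts G" "v \<in> verts G" "u \<noteq> v" "\<phi> u = \<phi> v"
      by (auto simp: inj_on_def)
    define w where "w = \<phi> u"
    define X where "X = {v \<in> verts G. \<phi> v = w}"
    have w: "w \<in> W" using uv W by (auto simp: w_def)
    have X: "finite X" "conn (edges G) X" "u \<in> X" "v \<in> X"
      using fin less.prems(4)[OF w] uv by (auto simp: X_def w_def)
    obtain x y where xy: "x \<in> X" "y \<in> X" "x \<noteq> y" "conn (edges G) (X - {x})" "conn (edges G) (X - {y})"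
      using conn_two_removable[OF X uv(3)] .
    \<comment> \<open>\<open>L z\<close> collects the boundary edges at \<open>z\<close>: an image
      of size 2 means that the edge joins different fibres.\<close>
    define L where "L z = {#e \<in># edges G. card (\<phi> ` e) = 2 \<and> z \<in> e#}" for z
    have "{u, v} \<subseteq> X" using X by auto
    then have "2 \<le> card X" using uv X(1) by (metis card_2_iff card_mono)
    then have "size {#e \<in># N. w \<in> e#} \<le> 3" using less.prems(5)[OF w] by (simp add: X_def)
    \<comment> \<open>An edge containing both \<open>x\<close> and \<open>y\<close> lies inside the
      fibre and belongs to neither \<open>L x\<close> nor \<open>L y\<close>. So the two share at
      most three boundary edges, and one of them has at most one.\<close>
    moreover have "size (L x) + size (L y) = size {#e \<in># edges G. card (\<phi> ` e) = 2 \<and> x \<in> e \<or> card (\<phi> ` e) = 2 \<and> y \<in> e#}"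
      unfolding L_def
    proof (rule size_filter_mset_disj[symmetric])
      fix e assume "e \<in># edges G"
      then obtain a b where "e = {a, b}" by (meson mg multigraph_edgeE)
      then show "\<not> ((card (\<phi> ` e) = 2 \<and> x \<in> e) \<and> card (\<phi> ` e) = 2 \<and> y \<in> e)"
        using xy by (auto simp: X_def)
    qed
    moreover have "\<dots> \<le> size {#e \<in># edges G. card (\<phi> ` e) = 2 \<and> w \<in> \<phi> ` e#}"
      by (rule size_filter_mset_mono) (use xy in \<open>auto simp: X_def intro: rev_image_eqI\<close>)
    moreover have "\<dots> = size {#e \<in># N. w \<in> e#}"
      unfolding N[symmetric] by (simp add: filter_mset_image_mset filter_filter_mset)
    ultimately have "size (L x) \<le> 1 \<or> size (L y) \<le> 1" by linarith
    then obtain x y where xy: "x \<in> X" "y \<in> X" "x \<noteq> y" "conn (edges G) (X - {x})" and Lx: "size (L x) \<le> 1"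
      using xy by blast
    have xV: "x \<in> verts G" "y \<in> verts G" "\<phi> x = w" "\<phi> y = w" using xy by (auto simp: X_def)
    \<comment> \<open>Both reductions below remove \<open>x\<close>, keep every edge avoiding
      \<open>x\<close> and preserve the quotient multiset \<open>N\<close>. The fibre stays nonempty
      thanks to \<open>y\<close>, so the induction hypothesis applies.\<close>
    have step: ?thesis if steps: "tm_step\<^sup>*\<^sup>* G H" and vH: "verts H = verts G - {x}"
      and sub: "\<And>e. e \<in># edges G \<Longrightarrow> x \<notin> e \<Longrightarrow> e \<in># edges H"
      and NH: "image_mset (image \<phi>) {#e \<in># edges H. card (\<phi> ` e) = 2#} = N" for H
    proof -
      have "card (verts H) < card (verts G)"
        unfolding vH using fin xV(1) by (rule card_Diff1_less)
      moreover have "multigraph H" using steps mg by (rule tm_steps_multigraph)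
      moreover have "\<phi> ` verts H = W"
      proof -
        have "\<phi> x \<in> \<phi> ` (verts G - {x})" using xV xy by (intro image_eqI[of _ _ y]) auto
        then show ?thesis unfolding vH W[symmetric] by blast
      qed
      moreover note NH
      moreover have "conn (edges H) {v \<in> verts H. \<phi> v = z}" if z: "z \<in> W" for z
      proof (cases "z = w")
        case True
        then have "{v \<in> verts H. \<phi> v = z} = X - {x}" by (auto simp: vH X_def)
        then show ?thesis using conn_mono[OF xy(4), of "edges H"] sub by auto
      next
        case False
        then have "{v \<in> verts H. \<phi> v = z} = {v \<in> verts G. \<phi> v = z}" using xV by (auto simp: vH)
        then show ?thesis using conn_mono[OF less.prems(4)[OF z], of "edges H"] sub False xV by auto
      qed
      moreover have "size {#e \<in># N. z \<in> e#} \<le> 3" if "z \<in> W" "2 \<le> card {v \<in> verts H. \<phi> v = z}" for z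
      proof -
        have "card {v \<in> verts H. \<phi> v = z} \<le> card {v \<in> verts G. \<phi> v = z}"
          using fin by (intro card_mono) (auto simp: vH)
        then show ?thesis using less.prems(5) that by auto
      qed
      ultimately obtain \<sigma> where "\<forall>w\<in>W. \<sigma> w \<in> verts H \<and> \<phi> (\<sigma> w) = w"
        "tm_step\<^sup>*\<^sup>* H \<lparr>verts = \<sigma> ` W, edges = image_mset (image \<sigma>) N\<rparr>"
        using less.hyps[of H] by blast
      then show ?thesis using steps by (auto simp: vH intro!: exI[of _ \<sigma>])
    qed
    show ?thesis
    proof (cases "L x = {#}")
      case True
      let ?H = "\<lparr>verts = verts G - {x}, edges = {#e \<in># edges G. x \<notin> e#}\<rparr>"
      have "{#e \<in># edges G. x \<notin> e \<and> card (\<phi> ` e) = 2#} = {#e \<in># edges G. card (\<phi> ` e) = 2#}"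
        using True by (intro filter_mset_cong) (auto simp: L_def)
      then show ?thesis
        using tm_step_delete_vertex[OF mg xV(1)] N
        by (intro step[of ?H]) (auto simp: filter_filter_mset)
    next
      case False
      then obtain e where e: "L x = {#e#}"
        using Lx by (metis One_nat_def le_Suc_eq le_zero_eq size_1_singleton_mset size_eq_0_iff_empty)
      then have "e \<in># L x" by simp
      then have eG: "e \<in># edges G" "card (\<phi> ` e) = 2" "x \<in> e" by (auto simp: L_def)
      obtain a b where ab: "e = {a, b}" by (meson eG(1) mg multigraph_edgeE)
      obtain z where z: "e = {x, z}" using eG ab by auto
      have "\<phi> z \<noteq> w" using eG(2) z xV by auto
      \<comment> \<open>The single boundary edge \<open>xz\<close> is rerouted through a neighbour
        \<open>x'\<close> of \<open>x\<close> in the same fibre: \<open>x'z\<close> has the same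
        image as \<open>xz\<close>.\<close>
      obtain x' where x': "x' \<in> X" "x' \<noteq> x" "{x, x'} \<in># edges G"
        using connD[OF X(2), of "{x}"] xy by auto
      have \<phi>x': "\<phi> x' = w" using x' by (simp add: X_def)
      then have neq: "x' \<noteq> z" using \<open>\<phi> z \<noteq> w\<close> by auto
      then have "{#{x, x'}, {x, z}#} \<subseteq># edges G"
        using x' eG z by (intro pair_subseteq_mset) (auto simp: doubleton_eq_iff)
      note steps = tm_steps_split_off[OF mg this neq]
      have "{#e \<in># edges G. card (\<phi> ` e) = 2#} = {#e \<in># {#e \<in># edges G. card (\<phi> ` e) = 2#}. x \<in> e#} + {#e \<in># {#e \<in># edges G. card (\<phi> ` e) = 2#}. x \<notin> e#}"
        by (rule multiset_partition)
      also have "{#e \<in># {#e \<in># edges G. card (\<phi> ` e) = 2#}. x \<in> e#} = {#{x, z}#}"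
        using e z by (simp add: L_def filter_filter_mset)
      finally have "N = add_mset (\<phi> ` {x, z}) (image_mset (image \<phi>) {#e \<in># edges G. card (\<phi> ` e) = 2 \<and> x \<notin> e#})"
        using N by (simp add: filter_filter_mset)
      moreover have "card {\<phi> x', \<phi> z} = 2" using \<phi>x' \<open>\<phi> z \<noteq> w\<close> by auto
      ultimately have "image_mset (image \<phi>) {#e \<in># edges (split_off G x x' z). card (\<phi> ` e) = 2#} = N"
        using \<phi>x' xV by (simp add: split_off_def filter_filter_mset conj_commute)
      then show ?thesis by (intro step[OF steps]) (auto simp: split_off_def)
    qed
  qed
qed

lemma subseteq_image_msetE:
  assumes "N \<subseteq># image_mset f M"
  obtains M' where "M' \<subseteq># M" "image_mset f M' = N"
proof -
  obtain K where "image_mset f M = N + K" using assms by (metis subset_mset.le_iff_add)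
  then obtain M1 M2 where "M = M1 + M2" "image_mset f M1 = N" by (metis image_mset_eq_plusD)
  then show ?thesis using that[of M1] by simp
qed

text \<open>Edges between fibres that were not chosen to represent an edge of \<open>Q\<close> are
  deleted; edges inside fibres stay to hold them together. The degree bound concerns only fibres
  with at least two vertices, since a singleton is not contracted. This leaves room for the vertices
  of degree above 3 in P33 and C3221.\<close>

lemma topological_minorI:
  fixes \<phi> :: "'v \<Rightarrow> 'w"
  assumes mg: "multigraph G" and V: "\<phi> ` verts G = verts Q"
    and sub: "edges Q \<subseteq># image_mset (image \<phi>) (edges G)"
    and card2: "\<And>e. e \<in># edges Q \<Longrightarrow> card e = 2"
    and conn: "\<And>w. w \<in> verts Q \<Longrightarrow> conn (edges G) {v \<in> verts G. \<phi> v = w}"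
    and deg: "\<And>w. w \<in> verts Q \<Longrightarrow> card {v \<in> verts G. \<phi> v = w} \<ge> 2 \<Longrightarrow> size {#e \<in># edges Q. w \<in> e#} \<le> 3"
  shows "topological_minor Q G"
proof -
  obtain M where M: "M \<subseteq># edges G" "image_mset (image \<phi>) M = edges Q"
    using subseteq_image_msetE[OF sub] .
  have M2: "card (\<phi> ` e) = 2" if "e \<in># M" for e
    using card2[of "\<phi> ` e"] M(2)[symmetric] that by simp
  obtain K where K: "edges G = M + K" using M(1) by (metis subset_mset.le_iff_add)
  define F where "F = M + {#e \<in># K. card (\<phi> ` e) \<noteq> 2#}"
  have "F \<subseteq># edges G" unfolding F_def K
    by (intro subset_mset.add_left_mono multiset_filter_subset)
  note steps = tm_steps_sub_edges[OF this]
  let ?H = "\<lparr>verts = verts G, edges = F\<rparr>"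
  have mH: "multigraph ?H" using steps mg by (rule tm_steps_multigraph)
  have "{#e \<in># F. card (\<phi> ` e) = 2#} = M"
    using M2 by (auto simp: F_def filter_filter_mset filter_mset_eq_conv)
  then have N: "image_mset (image \<phi>) {#e \<in># F. card (\<phi> ` e) = 2#} = edges Q"
    using M(2) by simp
  have inF: "e \<in># F" if "e \<in># edges G" "card (\<phi> ` e) \<noteq> 2" for e
    using that by (auto simp: F_def K)
  have "conn F {v \<in> verts G. \<phi> v = w}" if "w \<in> verts Q" for w
  proof (rule conn_mono[OF conn[OF that]])
    fix e assume e: "e \<in># edges G" "e \<subseteq> {v \<in> verts G. \<phi> v = w}"
    then have "\<phi> ` e \<subseteq> {w}" by auto
    then have "card (\<phi> ` e) \<le> card {w}" by (intro card_mono) auto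
    then show "e \<in># F" using inF[OF e(1)] by simp
  qed
  then obtain \<sigma> where \<sigma>: "\<forall>w\<in>verts Q. \<sigma> w \<in> verts G \<and> \<phi> (\<sigma> w) = w"
    "tm_step\<^sup>*\<^sup>* ?H \<lparr>verts = \<sigma> ` verts Q, edges = image_mset (image \<sigma>) (edges Q)\<rparr>"
    using cubic_quotient[OF mH _ , of \<phi> "verts Q" "edges Q"] V N deg by auto
  let ?K = "\<lparr>verts = \<sigma> ` verts Q, edges = image_mset (image \<sigma>) (edges Q)\<rparr>"
  have "graph_iso ?K Q"
    unfolding graph_iso_def
  proof (intro exI conjI)
    show "bij_betw \<phi> (verts ?K) (verts Q)"
      by (rule bij_betw_byWitness[where f' = \<sigma>]) (use \<sigma>(1) in auto)
    have "\<phi> ` \<sigma> ` e = e" if e: "e \<in># edges Q" for e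
    proof -
      obtain e' where "e' \<in># M" "e = \<phi> ` e'" using M(2)[symmetric] e by auto
      moreover have "e' \<subseteq> verts G" using \<open>e' \<in># M\<close> M(1) mg by (auto simp: multigraph_def dest: mset_subset_eqD)
      ultimately have "e \<subseteq> verts Q" using V by blast
      then show ?thesis using \<sigma>(1) by (force simp: image_iff)
    qed
    then have "image_mset (\<lambda>e. \<phi> ` \<sigma> ` e) (edges Q) = image_mset (\<lambda>e. e) (edges Q)"
      by (intro image_mset_cong) auto
    then show "image_mset (image \<phi>) (edges ?K) = edges Q"
      by (simp add: image_mset.compositionality o_def)
  qed
  moreover have "tm_step\<^sup>*\<^sup>* G ?K" using steps \<sigma>(2) by simp
  ultimately show ?thesis unfolding topological_minor_def by blast
qed

section \<open>Scrambles of order three\<close>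

text \<open>Order at least 3 expressed without minima and components. The vertices \<open>a\<close>
  and \<open>b\<close> may coincide or lie outside the graph, which covers hitting sets of every
  size up to two; an egg-cut becomes the boundary of a set \<open>P\<close> with one egg inside and
  one outside.\<close>

definition scramble3 :: "'v mgraph \<Rightarrow> 'v set set \<Rightarrow> bool" where
  "scramble3 G S \<longleftrightarrow>
    (\<forall>E\<in>S. E \<subseteq> verts G \<and> conn (edges G) E) \<and>
    (\<forall>a b. \<exists>E\<in>S. a \<notin> E \<and> b \<notin> E) \<and>
    (\<forall>P. (\<exists>E\<in>S. E \<subseteq> P) \<longrightarrow> (\<exists>F\<in>S. F \<inter> P = {}) \<longrightarrow> 3 \<le> size (cut (edges G) P))"

lemma scramble3_cut:
  assumes "scramble3 G S" "E \<in> S" "F \<in> S" "E \<subseteq> P" "F \<inter> P = {}"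
  shows "3 \<le> size (cut (edges G) P)"
  using assms unfolding scramble3_def by meson

lemma scramble3_subgraph:
  assumes "scramble3 H S" "verts H \<subseteq> verts G" "edges H \<subseteq># edges G"
  shows "scramble3 G S"
  unfolding scramble3_def
proof (intro conjI ballI allI impI)
  show "E \<subseteq> verts G" "conn (edges G) E" if "E \<in> S" for E
    using assms that by (auto simp: scramble3_def intro: conn_mono dest: mset_subset_eqD)
next
  fix a b show "\<exists>E\<in>S. a \<notin> E \<and> b \<notin> E" using assms(1) by (simp add: scramble3_def)
next
  fix P assume "\<exists>E\<in>S. E \<subseteq> P" "\<exists>F\<in>S. F \<inter> P = {}"
  then have "3 \<le> size (cut (edges H) P)" using assms(1) by (simp add: scramble3_def)
  also have "\<dots> \<le> size (cut (edges G) P)"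
    unfolding between_def by (intro size_mset_mono multiset_filter_mono assms)
  finally show "3 \<le> size (cut (edges G) P)" .
qed

text \<open>If \<open>v\<close> is not in \<open>E\<close>, the edge \<open>vw\<close> does not lie
  inside \<open>E\<close> and its loss does no harm. Otherwise \<open>u\<close> hangs on
  \<open>v\<close>, and if \<open>w\<close> is present as well, the path \<open>v\<close>,
  \<open>u\<close>, \<open>w\<close> replaces the edge. Letting \<open>v\<close> rather than
  \<open>w\<close> decide is an arbitrary choice.\<close>

lemma conn_subdivide:
  assumes E: "conn (add_mset {v, w} M) E" and F: "\<And>e. e \<in># M \<Longrightarrow> e \<in># F"
    and uv: "{u, v} \<in># F" and uw: "{u, w} \<in># F" and u: "u \<notin> E"
  shows "conn F (if v \<in> E then insert u E else E)"
proof (cases "v \<in> E")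
  case False
  have "conn F E"
  proof (rule conn_mono[OF E])
    show "e \<in># F" if "e \<in># add_mset {v, w} M" "e \<subseteq> E" for e using that False F by auto
  qed
  then show ?thesis using False by simp
next
  case True
  have "conn F (insert u E)"
  proof (rule connI)
    fix A assume A: "A \<subset> insert u E" "A \<noteq> {}"
    show "\<exists>a\<in>A. \<exists>b\<in>insert u E - A. {a, b} \<in># F"
    proof (cases "u \<in> A \<longleftrightarrow> v \<in> A")
      case False
      then have "u \<in> A \<and> v \<in> insert u E - A \<or> v \<in> A \<and> u \<in> insert u E - A" using True by blast
      then show ?thesis using uv by (metis insert_commute)
    next
      case same: True
      have "A \<inter> E \<subset> E" "A \<inter> E \<noteq> {}" using A same True by auto
      from connD[OF E this] obtain a b
        where "a \<in> A \<inter> E" "b \<in> E" "b \<notin> A \<inter> E" "{a, b} \<in># add_mset {v, w} M" .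
      then have ab: "a \<in> A" "a \<in> E" "b \<in> E" "b \<notin> A" "{a, b} \<in># add_mset {v, w} M" by auto
      show ?thesis
      proof (cases "{a, b} \<in># M")
        case True
        then show ?thesis using ab F by blast
      next
        case False
        then have "{a, b} = {v, w}" using ab by auto
        then have "a = v \<and> b = w \<or> a = w \<and> b = v" by (auto simp: doubleton_eq_iff)
        then show ?thesis
        proof
          assume "a = v \<and> b = w"
          then show ?thesis using ab same uw by (intro bexI[of _ u] bexI[of _ w]) auto
        next
          assume "a = w \<and> b = v"
          then show ?thesis using ab same uw
            by (intro bexI[of _ w] bexI[of _ u]) (auto simp: insert_commute)
        qed
      qed
    qed
  qed simp
  then show ?thesis using True by simp
qed

lemma scramble3_tm_step:
  assumes "tm_step G H" "multigraph G" "scramble3 H S"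
  shows "\<exists>S. scramble3 G S"
  using assms(1)
proof cases
  case (vertex_deletion u)
  then show ?thesis using scramble3_subgraph[OF assms(3), of G] by (auto simp: delete_vertex_def)
next
  case (edge_deletion e)
  then show ?thesis using scramble3_subgraph[OF assms(3), of G] by (auto simp: delete_edges_def)
next
  case (smoothing u v w)
  define M where "M = {#e \<in># edges G. u \<notin> e#}"
  have G: "edges G = M + {#{u, v}, {u, w}#}"
    unfolding M_def smoothing(3)[symmetric] incident_edges_def
    by (subst add.commute) (rule multiset_partition)
  have H: "verts H = verts G - {u}" "edges H = add_mset {v, w} M"
    unfolding smoothing(1) using smoothing(3) G by (simp_all add: add_edge_def delete_vertex_def)
  have "{u, v} \<in># edges G" "{u, w} \<in># edges G" using G by auto
  then have ne: "u \<noteq> v" "u \<noteq> w" using assms(2) by (auto simp: multigraph_def)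
  define lift where "lift E = (if v \<in> E then insert u E else E)" for E
  have S: "E \<subseteq> verts G - {u}" "conn (add_mset {v, w} M) E" if "E \<in> S" for E
    using assms(3) that by (auto simp: scramble3_def H)
  have "scramble3 G (lift ` S)"
    unfolding scramble3_def
  proof (intro conjI ballI allI impI)
    fix E assume "E \<in> lift ` S"
    then obtain E' where E': "E' \<in> S" "E = lift E'" by blast
    then show "E \<subseteq> verts G" using S(1)[OF E'(1)] smoothing(2) by (auto simp: lift_def)
    show "conn (edges G) E" unfolding E'(2) lift_def
      by (rule conn_subdivide[OF S(2)[OF E'(1)]]) (use G S(1)[OF E'(1)] in auto)
  next
    fix a b
    \<comment> \<open>A vertex equal to \<open>u\<close> is traded for \<open>v\<close>: an egg
      avoiding \<open>v\<close> is not enlarged and therefore avoids \<open>u\<close> as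
      well.\<close>
    obtain E where E: "E \<in> S" "(if a = u then v else a) \<notin> E" "(if b = u then v else b) \<notin> E"
      using assms(3) unfolding scramble3_def by metis
    then show "\<exists>E\<in>lift ` S. a \<notin> E \<and> b \<notin> E" using S(1)[OF E(1)]
      by (intro bexI[of _ "lift E"]) (auto simp: lift_def split: if_splits)
  next
    fix P assume "\<exists>E\<in>lift ` S. E \<subseteq> P" "\<exists>F\<in>lift ` S. F \<inter> P = {}"
    then obtain E F where "E \<in> S" "lift E \<subseteq> P" "F \<in> S" "lift F \<inter> P = {}" by blast
    then have "E \<subseteq> P" "F \<inter> P = {}" by (auto simp: lift_def split: if_splits)
    then have "3 \<le> size (cut (edges H) P)" by (rule scramble3_cut[OF assms(3) \<open>E \<in> S\<close> \<open>F \<in> S\<close>])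
    \<comment> \<open>If \<open>P\<close> separates \<open>v\<close> from \<open>w\<close>, it
      separates \<open>u\<close> from one of them, so the edge \<open>vw\<close> is paid for by
      \<open>uv\<close> or \<open>uw\<close>.\<close>
    also have "\<dots> \<le> size (cut (edges G) P)" by (auto simp: H G between_def)
    finally show "3 \<le> size (cut (edges G) P)" .
  qed
  then show ?thesis by blast
qed

lemma scramble3_tm_steps:
  assumes "tm_step\<^sup>*\<^sup>* G H" "multigraph G" "scramble3 H S"
  shows "\<exists>S. scramble3 G S"
  using assms
proof (induction arbitrary: S rule: rtranclp_induct)
  case base
  then show ?case by blast
next
  case (step y z)
  then show ?case using scramble3_tm_step tm_steps_multigraph by metis
qed

lemma scramble3_iso:
  assumes "graph_iso H Q" "multigraph H" "scramble3 Q S"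
  shows "\<exists>S. scramble3 H S"
proof -
  obtain f where f: "bij_betw f (verts H) (verts Q)" "image_mset (image f) (edges H) = edges Q"
    using assms(1) by (auto simp: graph_iso_def)
  define pull where "pull E = {v \<in> verts H. f v \<in> E}" for E
  have inj: "inj_on f (verts H)" and im: "f ` verts H = verts Q" using f(1) by (auto simp: bij_betw_def)
  have S: "E \<subseteq> verts Q" "conn (edges Q) E" if "E \<in> S" for E
    using assms(3) that by (auto simp: scramble3_def)
  have "scramble3 H (pull ` S)"
    unfolding scramble3_def
  proof (intro conjI ballI allI impI)
    fix E assume "E \<in> pull ` S"
    then obtain E' where E': "E' \<in> S" "E = pull E'" by blast
    show "E \<subseteq> verts H" by (auto simp: E' pull_def)
    have fE: "f ` E = E'" using S(1)[OF E'(1)] im by (force simp: E' pull_def)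
    show "conn (edges H) E"
    proof (rule connI)
      show "E \<noteq> {}" using fE S(2)[OF E'(1)] by (auto simp: conn_def)
      fix A assume A: "A \<subset> E" "A \<noteq> {}"
      have "f ` A \<subset> E'"
        using A fE image_strict_mono[of f E A] inj_on_subset[OF inj \<open>E \<subseteq> verts H\<close>] by auto
      then obtain c d where cd: "c \<in> f ` A" "d \<in> E'" "d \<notin> f ` A" "{c, d} \<in># edges Q"
        using connD[OF S(2)[OF E'(1)]] A by (metis image_is_empty)
      then obtain e where e: "e \<in># edges H" "f ` e = {c, d}" using f(2) by (metis imageE set_image_mset)
      obtain p q where pq: "e = {p, q}" "p \<in> verts H" "q \<in> verts H"
        using multigraph_edgeE[OF assms(2) e(1)] by metis
      have "\<exists>a b. e = {a, b} \<and> f a = c \<and> f b = d \<and> a \<in> verts H \<and> b \<in> verts H"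
        using e(2) pq by (auto simp: doubleton_eq_iff insert_commute)
      then obtain a b where ab: "e = {a, b}" "f a = c" "f b = d" "a \<in> verts H" "b \<in> verts H" by blast
      have "a \<in> A" using cd(1) ab A(1) \<open>E \<subseteq> verts H\<close> inj by (auto simp: inj_on_def subset_iff psubset_eq)
      moreover have "b \<in> E - A" using cd ab by (auto simp: E' pull_def)
      ultimately show "\<exists>a\<in>A. \<exists>b\<in>E - A. {a, b} \<in># edges H" using e ab by blast
    qed
  next
    fix a b
    obtain E where E: "E \<in> S" "f a \<notin> E" "f b \<notin> E"
      using assms(3) unfolding scramble3_def by metis
    then show "\<exists>E\<in>pull ` S. a \<notin> E \<and> b \<notin> E" by (auto simp: pull_def)
  next
    fix P assume "\<exists>E\<in>pull ` S. E \<subseteq> P" "\<exists>F\<in>pull ` S. F \<inter> P = {}"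
    then obtain E F where EF: "E \<in> S" "pull E \<subseteq> P" "F \<in> S" "pull F \<inter> P = {}" by blast
    \<comment> \<open>Outside \<open>verts H\<close> the map \<open>f\<close> need not be injective,
      so only the part of \<open>P\<close> inside the graph is transported.\<close>
    define P' where "P' = f ` (P \<inter> verts H)"
    have "E \<subseteq> P'" using S(1)[OF EF(1)] im EF(2) by (fastforce simp: P'_def pull_def)
    moreover have "F \<inter> P' = {}" using EF(4) by (auto simp: P'_def pull_def)
    ultimately have "3 \<le> size (cut (edges Q) P')" by (rule scramble3_cut[OF assms(3) EF(1,3)])
    also have "\<dots> = size {#e \<in># edges H. f ` e \<inter> P' \<noteq> {} \<and> f ` e \<inter> - P' \<noteq> {}#}"
      unfolding f(2)[symmetric] between_def by (simp add: filter_mset_image_mset)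
    also have "\<dots> \<le> size (cut (edges H) P)" unfolding between_def
    proof (rule size_filter_mset_mono)
      fix e assume e: "e \<in># edges H" "f ` e \<inter> P' \<noteq> {} \<and> f ` e \<inter> - P' \<noteq> {}"
      have "e \<subseteq> verts H" using e(1) assms(2) by (auto simp: multigraph_def)
      moreover have "f v \<in> P' \<longleftrightarrow> v \<in> P" if "v \<in> verts H" for v
        using that inj by (auto simp: P'_def inj_on_def)
      ultimately show "e \<inter> P \<noteq> {} \<and> e \<inter> - P \<noteq> {}" using e(2) by fastforce
    qed
    finally show "3 \<le> size (cut (edges H) P)" .
  qed
  then show ?thesis by blast
qed

lemma scramble3_topological_minor:
  assumes "topological_minor Q G" "multigraph G" "scramble3 Q S"
  shows "\<exists>S. scramble3 G S"
  using assms scramble3_iso scramble3_tm_steps tm_steps_multigraph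
  unfolding topological_minor_def by metis

section \<open>Scrambles on the four excluded graphs\<close>

lemma scramble3_singletons:
  assumes "3 \<le> card (verts G)"
    and "\<And>P u v. u \<in> verts G \<Longrightarrow> v \<in> verts G \<Longrightarrow> u \<in> P \<Longrightarrow> v \<notin> P \<Longrightarrow> 3 \<le> size (cut (edges G) P)"
  shows "scramble3 G ((\<lambda>v. {v}) ` verts G)"
  unfolding scramble3_def
proof (intro conjI ballI allI impI)
  fix a b
  have "\<not> verts G \<subseteq> {a, b}"
  proof
    assume "verts G \<subseteq> {a, b}"
    then have "card (verts G) \<le> card {a, b}" by (intro card_mono) auto
    also have "\<dots> \<le> 2" by (simp add: card_insert_if)
    finally show False using assms(1) by simp
  qed
  then show "\<exists>E\<in>(\<lambda>v. {v}) ` verts G. a \<notin> E \<and> b \<notin> E" by auto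
qed (use assms(2) in auto)

lemma scramble3_K4: "\<exists>S. scramble3 K4 S"
proof (rule exI, rule scramble3_singletons)
  fix P :: "nat set" and u v assume "u \<in> verts K4" "v \<in> verts K4" "u \<in> P" "v \<notin> P"
  then show "3 \<le> size (cut (edges K4) P)"
    by (cases "1 \<in> P"; cases "2 \<in> P"; cases "3 \<in> P"; cases "4 \<in> P")
       (auto simp: K4_def between_def)
qed (simp add: K4_def)

lemma scramble3_P33: "\<exists>S. scramble3 P33 S"
proof (rule exI, rule scramble3_singletons)
  fix P :: "nat set" and u v assume "u \<in> verts P33" "v \<in> verts P33" "u \<in> P" "v \<notin> P"
  then show "3 \<le> size (cut (edges P33) P)"
    by (cases "1 \<in> P"; cases "2 \<in> P"; cases "3 \<in> P")
       (auto simp: P33_def between_def numeral_eq_Suc)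
qed (simp add: P33_def)

lemma scramble3_C3221: "\<exists>S. scramble3 C3221 S"
proof (rule exI, rule scramble3_singletons)
  fix P :: "nat set" and u v assume "u \<in> verts C3221" "v \<in> verts C3221" "u \<in> P" "v \<notin> P"
  then show "3 \<le> size (cut (edges C3221) P)"
    by (cases "1 \<in> P"; cases "2 \<in> P"; cases "3 \<in> P")
       (auto simp: C3221_def between_def numeral_eq_Suc)
qed (simp add: C3221_def)

text \<open>The singletons fail here, because \<open>{1, 2}\<close> has only two boundary edges.
  Separating two of the chosen eggs breaks both arcs of the cycle between them; one arc is a doubled
  edge, costing 2, and the other costs at least 1.\<close>

lemma scramble3_LL6: "scramble3 LL6 {{2, 3}, {4, 5}, {6, 1}}"
  unfolding scramble3_def
proof (intro conjI ballI allI impI)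
  fix E assume "E \<in> {{2, 3}, {4, 5}, {6, 1 :: nat}}"
  then show "E \<subseteq> verts LL6" "conn (edges LL6) E" by (auto simp: LL6_def intro!: conn_pair)
next
  fix a b :: nat
  show "\<exists>E\<in>{{2, 3}, {4, 5}, {6, 1}}. a \<notin> E \<and> b \<notin> E" by auto
next
  fix P assume "\<exists>E\<in>{{2, 3}, {4, 5}, {6, 1 :: nat}}. E \<subseteq> P" "\<exists>F\<in>{{2, 3}, {4, 5}, {6, 1}}. F \<inter> P = {}"
  then show "3 \<le> size (cut (edges LL6) P)"
    by (cases "1 \<in> P"; cases "2 \<in> P"; cases "3 \<in> P"; cases "4 \<in> P"; cases "5 \<in> P"; cases "6 \<in> P")
       (simp_all add: LL6_def between_def numeral_eq_Suc)
qed

section \<open>Egg-cuts and hitting sets in terms of vertex sets\<close>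

lemma edge_leaves_component:
  assumes "C \<in> components G" "multigraph G" "e \<in># edges G" "e \<inter> C \<noteq> {}"
  shows "e \<subseteq> C"
proof -
  obtain u where C: "C = {v \<in> verts G. reachable G u v}" using assms(1) by (auto simp: components_def)
  obtain a b where e: "e = {a, b}" "a \<in> verts G" "b \<in> verts G"
    using multigraph_edgeE[OF assms(2,3)] by metis
  have "reachable G u b" if "reachable G u a"
    using that assms(3) unfolding reachable_def e by (rule rtranclp.rtrancl_into_rtrancl)
  moreover have "reachable G u a" if "reachable G u b"
    using that assms(3) unfolding reachable_def e
    by (auto simp: insert_commute intro: rtranclp.rtrancl_into_rtrancl)
  ultimately show ?thesis using assms(4) e C by auto
qed

lemma conn_reachable:
  assumes "conn (edges G) E" "u \<in> E" "v \<in> E"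
  shows "reachable G u v"
proof (rule ccontr)
  assume n: "\<not> reachable G u v"
  define A where "A = {w \<in> E. reachable G u w}"
  have "A \<subset> E" "A \<noteq> {}" using n assms by (auto simp: A_def reachable_def)
  from connD[OF assms(1) this] obtain a b
    where ab: "a \<in> A" "b \<in> E" "b \<notin> A" "{a, b} \<in># edges G" by blast
  then have "reachable G u b"
    unfolding A_def reachable_def by (auto intro: rtranclp.rtrancl_into_rtrancl)
  then show False using ab by (simp add: A_def)
qed

lemma reachable_sym: "reachable G u v \<Longrightarrow> reachable G v u"
  unfolding reachable_def by (rule sympD[OF symp_rtranclp]) (auto simp: symp_def insert_commute)

lemma component_eq:
  assumes "C \<in> components G" "x \<in> C"
  shows "C = {v \<in> verts G. reachable G x v}"
proof -
  obtain u where u: "C = {v \<in> verts G. reachable G u v}" using assms(1) unfolding components_def by blast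
  then have ux: "reachable G u x" using assms(2) by simp
  have "reachable G u v \<longleftrightarrow> reachable G x v" for v
    using ux reachable_sym[OF ux] unfolding reachable_def by (meson rtranclp_trans)
  then show ?thesis unfolding u by simp
qed

lemma component_of_conn:
  assumes "conn (edges G) E" "E \<subseteq> verts G"
  obtains C where "C \<in> components G" "E \<subseteq> C"
proof -
  obtain u where u: "u \<in> E" using assms(1) by (auto simp: conn_def)
  show ?thesis
    by (rule that[of "{v \<in> verts G. reachable G u v}"])
      (use u assms conn_reachable[OF assms(1) u] in \<open>auto simp: components_def\<close>)
qed

lemma diff_filter_mset: "M - filter_mset P M = {#x \<in># M. \<not> P x#}"
  by (metis add_diff_cancel_left' multiset_partition)

text \<open>The boundary of \<open>P\<close> is an egg-cut, because both eggs stay connected and no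
  remaining edge leaves \<open>P\<close>. Conversely, for an egg-cut \<open>A\<close>, a component
  \<open>C\<close> of the remaining graph serves as \<open>P\<close>.\<close>

lemma three_le_egg_cut_number_iff:
  assumes mg: "multigraph G" and S: "scramble G S"
  shows "3 \<le> egg_cut_number G S \<longleftrightarrow>
    (\<forall>P. (\<exists>E\<in>S. E \<subseteq> P) \<longrightarrow> (\<exists>F\<in>S. F \<inter> P = {}) \<longrightarrow> 3 \<le> size (cut (edges G) P))"
    (is "_ \<longleftrightarrow> ?R")
proof -
  have "3 \<le> egg_cut_number G S \<longleftrightarrow> (\<forall>A. egg_cut G S A \<longrightarrow> 3 \<le> size A)"
    unfolding egg_cut_number_def le_INF_iff by (auto simp: numeral_eq_enat)
  also have "\<dots> \<longleftrightarrow> ?R"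
  proof (intro iffI allI impI)
    fix P assume L: "\<forall>A. egg_cut G S A \<longrightarrow> 3 \<le> size A"
      and "\<exists>E\<in>S. E \<subseteq> P" "\<exists>F\<in>S. F \<inter> P = {}"
    then obtain E F where EF: "E \<in> S" "E \<subseteq> P" "F \<in> S" "F \<inter> P = {}" by blast
    let ?A = "cut (edges G) P"
    let ?H = "delete_edges G ?A"
    have EH: "edges ?H = {#e \<in># edges G. \<not> (e \<inter> P \<noteq> {} \<and> e \<inter> - P \<noteq> {})#}"
      unfolding delete_edges_def between_def by (simp only: mgraph.simps diff_filter_mset)
    have VH: "verts ?H = verts G" by (simp add: delete_edges_def)
    have eggs: "X \<subseteq> verts G" "conn (edges G) X" if "X \<in> S" for X
      using S that by (auto simp: scramble_def egg_iff_conn)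
    have "conn (edges ?H) E" by (rule conn_mono[OF eggs(2)[OF EF(1)]]) (use EF in \<open>auto simp: EH\<close>)
    then obtain C where C: "C \<in> components ?H" "E \<subseteq> C"
      using component_of_conn eggs(1)[OF EF(1)] VH by metis
    have "conn (edges ?H) F" by (rule conn_mono[OF eggs(2)[OF EF(3)]]) (use EF in \<open>auto simp: EH\<close>)
    then obtain D where D: "D \<in> components ?H" "F \<subseteq> D"
      using component_of_conn eggs(1)[OF EF(3)] VH by metis
    have "C \<noteq> D"
    proof
      assume "C = D"
      obtain u where u: "C = {v \<in> verts ?H. reachable ?H u v}" using C by (auto simp: components_def)
      obtain x y where xy: "x \<in> E" "y \<in> F" using eggs(2) EF by (metis conn_def ex_in_conv)
      have "reachable ?H u x" "reachable ?H u y" using xy u C D \<open>C = D\<close> by auto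
      then have "reachable ?H x y" using reachable_sym[of ?H u x] unfolding reachable_def by simp
      then have "y \<in> P" unfolding reachable_def
      proof (induction rule: rtranclp_induct)
        case base
        then show ?case using xy EF by auto
      next
        case (step y z)
        then show ?case by (auto simp: EH)
      qed
      then show False using xy EF by auto
    qed
    moreover have "?A \<subseteq># edges G" by (simp add: between_def)
    ultimately have "egg_cut G S ?A" unfolding egg_cut_def using C D EF by blast
    then show "3 \<le> size ?A" using L by blast
  next
    fix A assume R: ?R and "egg_cut G S A"
    then obtain C D E F where A: "A \<subseteq># edges G" and CD: "C \<in> components (delete_edges G A)"
      "D \<in> components (delete_edges G A)" "C \<noteq> D" and EF: "E \<in> S" "F \<in> S" "E \<subseteq> C" "F \<subseteq> D"
      unfolding egg_cut_def by blast
    let ?H = "delete_edges G A"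
    have mH: "multigraph ?H" using mg by (auto simp: multigraph_def delete_edges_def dest: in_diffD)
    have "C \<inter> D = {}"
      using component_eq[OF CD(1)] component_eq[OF CD(2)] CD(3) by blast
    then have "F \<inter> C = {}" using EF by blast
    then have "3 \<le> size (cut (edges G) C)" using R EF by blast
    \<comment> \<open>Edges that survive the deletion never leave the component \<open>C\<close>, so
      the whole boundary of \<open>C\<close> was deleted.\<close>
    also have "cut (edges G) C \<subseteq># A"
    proof -
      have "edges G = edges ?H + A" using A by (simp add: delete_edges_def)
      then have "cut (edges G) C = cut (edges ?H) C + cut A C" by (simp add: between_def)
      also have "cut (edges ?H) C = {#}"
        unfolding between_def filter_mset_eq_mempty_iff using edge_leaves_component[OF CD(1) mH] by blast
      finally show ?thesis by (simp add: between_def)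
    qed
    then have "size (cut (edges G) C) \<le> size A" by (rule size_mset_mono)
    finally show "3 \<le> size A" .
  qed
  finally show ?thesis .
qed

lemma subset_pair_if_card_le_2:
  assumes "finite A" "card A \<le> 2"
  shows "\<exists>a b. A \<subseteq> {a, b}"
proof -
  have "card A = 2 \<or> (\<forall>x\<in>A. \<forall>y\<in>A. x = y)"
    using assms card_le_Suc0_iff_eq[of A] by linarith
  then show ?thesis
  proof
    assume "card A = 2"
    then show ?thesis by (auto simp: card_2_iff)
  next
    assume eq: "\<forall>x\<in>A. \<forall>y\<in>A. x = y"
    show ?thesis
    proof (cases "A = {}")
      case False
      then obtain x where "x \<in> A" by blast
      then have "A \<subseteq> {x, x}" using eq by blast
      then show ?thesis by blast
    qed simp
  qed
qed

lemma three_le_hitting_number_iff: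
  assumes mg: "multigraph G" and S: "scramble G S"
  shows "3 \<le> hitting_number G S \<longleftrightarrow> (\<forall>a b. \<exists>E\<in>S. a \<notin> E \<and> b \<notin> E)" (is "_ \<longleftrightarrow> ?R")
proof -
  have fin: "finite (verts G)" using mg by (simp add: multigraph_def)
  have "3 \<le> hitting_number G S \<longleftrightarrow> (\<forall>H. hitting_set G S H \<longrightarrow> 3 \<le> card H)"
    unfolding hitting_number_def le_INF_iff by (auto simp: numeral_eq_enat)
  also have "\<dots> \<longleftrightarrow> ?R"
  proof (intro iffI allI impI)
    fix a b assume L: "\<forall>H. hitting_set G S H \<longrightarrow> 3 \<le> card H"
    \<comment> \<open>Hitting sets consist of vertices of \<open>G\<close>, whereas \<open>a\<close>
      and \<open>b\<close> are arbitrary; the intersection loses nothing since eggs lie in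
      \<open>G\<close>.\<close>
    have "card ({a, b} \<inter> verts G) \<le> card {a, b}" by (intro card_mono) auto
    also have "\<dots> \<le> 2" by (simp add: card_insert_if)
    finally have "\<not> hitting_set G S ({a, b} \<inter> verts G)" using L by fastforce
    then obtain E where "E \<in> S" "{a, b} \<inter> verts G \<inter> E = {}" by (auto simp: hitting_set_def)
    moreover have "E \<subseteq> verts G" using S \<open>E \<in> S\<close> by (auto simp: scramble_def egg_iff_conn)
    ultimately show "\<exists>E\<in>S. a \<notin> E \<and> b \<notin> E" by blast
  next
    fix H assume R: ?R and H: "hitting_set G S H"
    show "3 \<le> card H"
    proof (rule ccontr)
      assume "\<not> 3 \<le> card H"
      moreover have "finite H" using H fin by (auto simp: hitting_set_def intro: finite_subset)
      ultimately have "\<exists>a b. H \<subseteq> {a, b}" by (intro subset_pair_if_card_le_2) auto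
      then obtain a b where ab: "H \<subseteq> {a, b}" by blast
      obtain E where "E \<in> S" "a \<notin> E" "b \<notin> E" using R by metis
      then have "H \<inter> E = {}" using ab by auto
      then show False using H \<open>E \<in> S\<close> by (simp add: hitting_set_def)
    qed
  qed
  finally show ?thesis .
qed

lemma scramble_number_le_2_iff:
  assumes "multigraph G"
  shows "scramble_number G \<le> 2 \<longleftrightarrow> \<not> (\<exists>S. scramble3 G S)"
proof -
  have enat: "\<not> x \<le> 2 \<longleftrightarrow> 3 \<le> x" for x :: enat
    by (cases x) (auto simp: numeral_eq_enat)
  have "scramble_number G \<le> 2 \<longleftrightarrow> (\<forall>S. scramble G S \<longrightarrow> scramble_order G S \<le> 2)"
    unfolding scramble_number_def using finite_scrambles[OF assms] by (subst Max_le_iff) auto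
  also have "\<dots> \<longleftrightarrow> \<not> (\<exists>S. scramble G S \<and> 3 \<le> scramble_order G S)" using enat by blast
  also have "\<dots> \<longleftrightarrow> \<not> (\<exists>S. scramble3 G S)"
  proof -
    have "scramble G S \<and> 3 \<le> scramble_order G S \<longleftrightarrow> scramble3 G S" for S
    proof (cases "scramble G S")
      case True
      then show ?thesis
        using three_le_egg_cut_number_iff[OF assms True] three_le_hitting_number_iff[OF assms True]
        by (auto simp: scramble_order_def scramble3_def scramble_def egg_iff_conn)
    next
      case False
      then show ?thesis by (auto simp: scramble3_def scramble_def egg_iff_conn)
    qed
    then show ?thesis by simp
  qed
  finally show ?thesis .
qed

section \<open>Three-edge-connected graphs\<close>

lemma topological_minor_steps:
  "tm_step\<^sup>*\<^sup>* G H \<Longrightarrow> topological_minor Q H \<Longrightarrow> topological_minor Q G"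
  unfolding topological_minor_def by (meson rtranclp_trans)

lemma topological_minor_injI:
  assumes "multigraph G" "inj_on \<phi> (verts G)" "\<phi> ` verts G = verts Q"
    and "edges Q \<subseteq># image_mset (image \<phi>) (edges G)" "\<And>e. e \<in># edges Q \<Longrightarrow> card e = 2"
  shows "topological_minor Q G"
proof (rule topological_minorI[OF assms(1,3-5)])
  fix w assume "w \<in> verts Q"
  then obtain v where "v \<in> verts G" "w = \<phi> v" using assms(3) by blast
  then have "{v \<in> verts G. \<phi> v = w} = {v}" using assms(2) by (auto simp: inj_on_def)
  then show "conn (edges G) {v \<in> verts G. \<phi> v = w}"
    "2 \<le> card {v \<in> verts G. \<phi> v = w} \<Longrightarrow> size {#e \<in># edges Q. w \<in> e#} \<le> 3" by simp_all
qed

definition three_edge_connected :: "'v mgraph \<Rightarrow> bool" where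
  "three_edge_connected G \<longleftrightarrow>
    (\<forall>P. P \<subset> verts G \<longrightarrow> P \<noteq> {} \<longrightarrow> 3 \<le> size (cut (edges G) P))"

definition degree :: "'v mgraph \<Rightarrow> 'v \<Rightarrow> nat" where
  "degree G v = size {#e \<in># edges G. v \<in> e#}"

lemma degree_eq_cut:
  assumes "multigraph G"
  shows "degree G v = size (cut (edges G) {v})"
  unfolding degree_def between_def
proof (rule arg_cong[of _ _ size], rule filter_mset_cong)
  fix e assume "e \<in># edges G"
  then obtain a b where "e = {a, b}" "a \<noteq> b" using assms by (meson multigraph_edgeE)
  then show "v \<in> e \<longleftrightarrow> e \<inter> {v} \<noteq> {} \<and> e \<inter> - {v} \<noteq> {}" by auto
qed simp

lemma cut_complement:
  assumes "multigraph G" "P \<subseteq> verts G"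
  shows "cut (edges G) (verts G - P) = cut (edges G) P"
  unfolding between_def
proof (rule filter_mset_cong)
  fix e assume "e \<in># edges G"
  then have "e \<subseteq> verts G" using assms by (simp add: multigraph_def)
  then show "e \<inter> (verts G - P) \<noteq> {} \<and> e \<inter> - (verts G - P) \<noteq> {} \<longleftrightarrow> e \<inter> P \<noteq> {} \<and> e \<inter> - P \<noteq> {}"
    by blast
qed simp

lemma cut_insert_avoiding:
  assumes "\<And>e. e \<in># M \<Longrightarrow> u \<notin> e"
  shows "cut M (insert u P) = cut M P"
  unfolding between_def by (rule filter_mset_cong) (use assms in auto)

text \<open>Without an edge between \<open>A\<close> and \<open>X - A\<close>, the boundaries of
  these parts are disjoint and both contained in the boundary of \<open>X\<close>, so their sizes
  add up to at most its size. Applied below with 3 + 3 > 3 and with 2 + 2 > 2.\<close>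

lemma conn_if_cuts:
  assumes "multigraph G" "X \<noteq> {}"
    and "\<And>A. A \<subset> X \<Longrightarrow> A \<noteq> {} \<Longrightarrow>
      size (cut (edges G) X) < size (cut (edges G) A) + size (cut (edges G) (X - A))"
  shows "conn (edges G) X"
proof (rule connI[OF assms(2)], rule ccontr)
  fix A assume A: "A \<subset> X" "A \<noteq> {}" and n: "\<not> (\<exists>a\<in>A. \<exists>b\<in>X - A. {a, b} \<in># edges G)"
  have e: "(\<exists>a b. e = {a, b}) \<and> \<not> (e \<inter> A \<noteq> {} \<and> e \<inter> (X - A) \<noteq> {})" if eG: "e \<in># edges G" for e
  proof -
    obtain a b where e: "e = {a, b}" using multigraph_edgeE[OF assms(1) eG] by metis
    then show ?thesis using n eG by (auto simp: insert_commute)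
  qed
  have "size (cut (edges G) A) + size (cut (edges G) (X - A)) =
    size {#e \<in># edges G. (e \<inter> A \<noteq> {} \<and> e \<inter> - A \<noteq> {}) \<or> (e \<inter> (X - A) \<noteq> {} \<and> e \<inter> - (X - A) \<noteq> {})#}"
    unfolding between_def by (rule size_filter_mset_disj[symmetric]) (use e in blast)
  also have "\<dots> \<le> size (cut (edges G) X)"
    unfolding between_def
  proof (rule size_filter_mset_mono)
    fix f assume f: "f \<in># edges G"
      "(f \<inter> A \<noteq> {} \<and> f \<inter> - A \<noteq> {}) \<or> (f \<inter> (X - A) \<noteq> {} \<and> f \<inter> - (X - A) \<noteq> {})"
    from e[OF f(1)] f(2) A(1) show "f \<inter> X \<noteq> {} \<and> f \<inter> - X \<noteq> {}" by blast
  qed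
  finally show False using assms(3)[OF A] by simp
qed

lemma size_3E:
  assumes "size M = 3"
  obtains x y z where "M = {#x, y, z#}"
proof -
  obtain x M1 where 1: "M = add_mset x M1"
    using assms size_eq_Suc_imp_eq_union[of M 2] by auto
  then obtain y M2 where 2: "M1 = add_mset y M2"
    using assms size_eq_Suc_imp_eq_union[of M1 1] by auto
  then have "size M2 = 1" using 1 assms by simp
  then obtain z where "M2 = {#z#}" using size_1_singleton_mset by metis
  then show ?thesis using that 1 2 by simp
qed

lemma mset_distinct_subseteq:
  assumes "distinct xs" "set xs \<subseteq> set_mset M"
  shows "mset xs \<subseteq># M"
  unfolding subseteq_mset_def
proof
  fix a show "count (mset xs) a \<le> count M a"
  proof (cases "a \<in> set xs")
    case True
    then have "count (mset xs) a = 1" using assms(1) by (simp add: distinct_count_atmost_1)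
    also have "\<dots> \<le> count M a" using True assms(2) by (auto simp: Suc_le_eq)
    finally show ?thesis .
  next
    case False
    then show ?thesis by (metis in_multiset_in_set le0 not_in_iff)
  qed
qed

section \<open>Graphs on three or four vertices\<close>

lemma P33_minorI:
  assumes "multigraph G" "verts G = {a, b, c}" "a \<noteq> b" "a \<noteq> c" "b \<noteq> c"
    and "3 \<le> count (edges G) {a, b}" "3 \<le> count (edges G) {b, c}"
  shows "topological_minor P33 G"
proof -
  let ?\<phi> = "\<lambda>v. if v = a then 1 else if v = b then 2 else 3 :: nat"
  have "replicate_mset 3 {a, b} + replicate_mset 3 {b, c} \<subseteq># edges G"
    using assms by (auto simp: subseteq_mset_def doubleton_eq_iff)
  then have "image_mset (image ?\<phi>) (replicate_mset 3 {a, b} + replicate_mset 3 {b, c})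
    \<subseteq># image_mset (image ?\<phi>) (edges G)" by (rule image_mset_subseteq_mono)
  then have "edges P33 \<subseteq># image_mset (image ?\<phi>) (edges G)" using assms(3-5) by (simp add: P33_def insert_commute)
  then show ?thesis
    by (rule topological_minor_injI[OF assms(1), rotated 2])
      (use assms in \<open>auto simp: inj_on_def P33_def\<close>)
qed

lemma C3221_minorI:
  assumes "multigraph G" "verts G = {a, b, c}" "a \<noteq> b" "a \<noteq> c" "b \<noteq> c"
    and "2 \<le> count (edges G) {a, b}" "2 \<le> count (edges G) {b, c}" "1 \<le> count (edges G) {a, c}"
  shows "topological_minor C3221 G"
proof -
  let ?\<phi> = "\<lambda>v. if v = a then 1 else if v = b then 2 else 3 :: nat"
  have "replicate_mset 2 {a, b} + replicate_mset 2 {b, c} + {#{a, c}#} \<subseteq># edges G"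
    using assms by (auto simp: subseteq_mset_def doubleton_eq_iff)
  then have "image_mset (image ?\<phi>) (replicate_mset 2 {a, b} + replicate_mset 2 {b, c} + {#{a, c}#})
    \<subseteq># image_mset (image ?\<phi>) (edges G)" by (rule image_mset_subseteq_mono)
  then have "edges C3221 \<subseteq># image_mset (image ?\<phi>) (edges G)" using assms(3-5) by (simp add: C3221_def insert_commute)
  then show ?thesis
    by (rule topological_minor_injI[OF assms(1), rotated 2])
      (use assms in \<open>auto simp: inj_on_def C3221_def\<close>)
qed

lemma K4_minorI:
  assumes "multigraph G" "verts G = {a, b, c, d}" "distinct [a, b, c, d]"
    and "set_mset (edges G) \<supseteq> {{a, b}, {a, c}, {a, d}, {b, c}, {b, d}, {c, d}}"
  shows "topological_minor K4 G"
proof -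
  let ?\<phi> = "\<lambda>v. if v = a then 1 else if v = b then 2 else if v = c then 3 else 4 :: nat"
  have "mset [{a, b}, {a, c}, {a, d}, {b, c}, {b, d}, {c, d}] \<subseteq># edges G"
    using assms by (intro mset_distinct_subseteq) (auto simp: doubleton_eq_iff)
  then have "image_mset (image ?\<phi>) (mset [{a, b}, {a, c}, {a, d}, {b, c}, {b, d}, {c, d}])
    \<subseteq># image_mset (image ?\<phi>) (edges G)" by (rule image_mset_subseteq_mono)
  moreover have "a \<noteq> b" "a \<noteq> c" "a \<noteq> d" "b \<noteq> c" "b \<noteq> d" "c \<noteq> d" using assms(3) by auto
  ultimately have "edges K4 \<subseteq># image_mset (image ?\<phi>) (edges G)" by (simp add: K4_def insert_commute)
  then show ?thesis
    by (rule topological_minor_injI[OF assms(1), rotated 2])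
      (use assms in \<open>auto simp: inj_on_def K4_def\<close>)
qed

text \<open>Each vertex has at least three edges to the other two. A pair without edges forces
  multiplicity at least 3 on the other pairs, giving P33; a pair with a single edge forces at least
  2 on the others, giving C3221; and if all pairs have multiplicity at least 2, C3221 is there at
  once.\<close>

lemma three_vertices:
  assumes mg: "multigraph G" and V: "verts G = {a, b, c}" and ne: "a \<noteq> b" "a \<noteq> c" "b \<noteq> c"
    and c3: "three_edge_connected G"
  shows "topological_minor P33 G \<or> topological_minor C3221 G"
proof -
  have two: "3 \<le> count (edges G) {x, y} + count (edges G) {x, z}"
    if xyz: "{x, y, z} = {a, b, c}" "x \<noteq> y" "x \<noteq> z" "y \<noteq> z" for x y z
  proof -
    have "x \<in> verts G" "y \<in> verts G" using V xyz(1) by blast+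
    then have "{x} \<subset> verts G" using xyz(2) by auto
    then have "3 \<le> degree G x"
      unfolding degree_eq_cut[OF mg] using c3 by (simp add: three_edge_connected_def)
    also have "\<dots> \<le> size {#e \<in># edges G. e = {x, y} \<or> e = {x, z}#}"
      unfolding degree_def
    proof (rule size_filter_mset_mono)
      fix e assume e: "e \<in># edges G" "x \<in> e"
      then obtain p q where "e = {p, q}" "p \<noteq> q" "p \<in> {x, y, z}" "q \<in> {x, y, z}"
        using mg V xyz(1) by (metis multigraph_edgeE)
      then show "e = {x, y} \<or> e = {x, z}" using e(2) by auto
    qed
    also have "\<dots> = size {#e \<in># edges G. e = {x, y}#} + size {#e \<in># edges G. e = {x, z}#}"
      by (rule size_filter_mset_disj) (use xyz in \<open>auto simp: doubleton_eq_iff\<close>)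
    also have "\<dots> = count (edges G) {x, y} + count (edges G) {x, z}"
      by (simp add: filter_eq_replicate_mset)
    finally show ?thesis .
  qed
  have P: "topological_minor P33 G" if "{x, y, z} = {a, b, c}" "x \<noteq> y" "x \<noteq> z" "y \<noteq> z"
    "count (edges G) {x, z} = 0" for x y z
    using P33_minorI[OF mg, of x y z] two[of x y z] two[of z y x] that V
    by (simp add: insert_commute)
  have C: "topological_minor C3221 G" if "{x, y, z} = {a, b, c}" "x \<noteq> y" "x \<noteq> z" "y \<noteq> z"
    "count (edges G) {x, z} = 1" "1 \<le> count (edges G) {x, z}" for x y z
    using C3221_minorI[OF mg, of x y z] two[of x y z] two[of z y x] that V
    by (simp add: insert_commute)
  have sets: "{a, b, c} = {a, b, c}" "{b, c, a} = {a, b, c}" "{b, a, c} = {a, b, c}" by auto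
  show ?thesis
  proof (cases "count (edges G) {a, b} \<le> 1 \<or> count (edges G) {b, c} \<le> 1 \<or> count (edges G) {a, c} \<le> 1")
    case True
    then show ?thesis
      using P[of b c a] P[of a b c] P[of b a c] C[of b c a] C[of a b c] C[of b a c] sets ne
      by (auto simp: insert_commute le_Suc_eq)
  next
    case False
    then show ?thesis using C3221_minorI[OF mg V ne] by linarith
  qed
qed

section \<open>Reductions that preserve 3-edge-connectedness\<close>

lemma three_edge_connected_delete:
  assumes mg: "multigraph G" and c3: "three_edge_connected G"
    and u: "u \<in> verts G" and nbr: "\<And>e. e \<in># edges G \<Longrightarrow> u \<in> e \<Longrightarrow> e = {u, a}"
  shows "three_edge_connected \<lparr>verts = verts G - {u}, edges = {#e \<in># edges G. u \<notin> e#}\<rparr>"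
  unfolding three_edge_connected_def
proof (intro allI impI)
  let ?E0 = "{#e \<in># edges G. u \<notin> e#}"
  fix P assume "P \<subset> verts \<lparr>verts = verts G - {u}, edges = ?E0\<rparr>" "P \<noteq> {}"
  then have P: "P \<subset> verts G - {u}" "P \<noteq> {}" by simp_all
  \<comment> \<open>On the side of its sole neighbour \<open>a\<close>, the vertex \<open>u\<close>
    has no crossed edges.\<close>
  define P' where "P' = (if a \<in> P then insert u P else P)"
  have "P' \<subset> verts G" "P' \<noteq> {}" using P u by (auto simp: P'_def)
  then have "3 \<le> size (cut (edges G) P')" using c3 by (auto simp: three_edge_connected_def)
  also have "cut (edges G) P' = cut ?E0 P'"
    unfolding between_def filter_filter_mset
  proof (rule filter_mset_cong)
    fix e assume "e \<in># edges G"
    moreover have "u \<notin> P" using P by auto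
    ultimately show "e \<inter> P' \<noteq> {} \<and> e \<inter> - P' \<noteq> {} \<longleftrightarrow> u \<notin> e \<and> e \<inter> P' \<noteq> {} \<and> e \<inter> - P' \<noteq> {}"
      using nbr[of e] by (auto simp: P'_def)
  qed simp
  also have "\<dots> = cut ?E0 P" by (auto simp: P'_def intro: cut_insert_avoiding)
  finally show "3 \<le> size (cut (edges \<lparr>verts = verts G - {u}, edges = ?E0\<rparr>) P)" by simp
qed

lemma degree_ge_3:
  assumes "multigraph G" "three_edge_connected G" "3 \<le> card (verts G)" "v \<in> verts G"
  shows "3 \<le> degree G v"
proof -
  have "verts G \<noteq> {v}" using assms(3) by auto
  then have "{v} \<subset> verts G" using assms(4) by auto
  then show ?thesis
    using assms(2) unfolding degree_eq_cut[OF assms(1)] three_edge_connected_def by blast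
qed

text \<open>Every cut of the quotient comes from the cut of its preimage in \<open>G\<close>, so no
  small cut arises. If \<open>X\<close> were disconnected, two parts with boundary at least 3 each
  would share a boundary of 3. Two vertices inside \<open>X\<close> make the graph shrink; two
  outside leave at least three vertices.\<close>

lemma three_edge_connected_contract:
  assumes mg: "multigraph G" and c3: "three_edge_connected G"
    and X: "X \<subseteq> verts G" "2 \<le> card X" "2 \<le> card (verts G - X)" "size (cut (edges G) X) = 3"
  shows "\<exists>H. tm_step\<^sup>*\<^sup>* G H \<and> three_edge_connected H \<and> 3 \<le> card (verts H) \<and>
    card (verts H) < card (verts G) \<and> size (edges H) \<le> size (edges G)"
proof -
  have fin: "finite (verts G)" "finite X" using mg X(1) by (auto simp: multigraph_def intro: finite_subset)
  obtain x where x: "x \<in> X" using X(2) by fastforce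
  define \<phi> where "\<phi> v = (if v \<in> X then x else v)" for v
  define W where "W = \<phi> ` verts G"
  define N where "N = image_mset (image \<phi>) {#e \<in># edges G. card (\<phi> ` e) = 2#}"
  have W: "W = insert x (verts G - X)" using x X(1) by (auto simp: W_def \<phi>_def)
  have fib: "{v \<in> verts G. \<phi> v = w} = (if w = x then X else {w})" if "w \<in> W" for w
    using that x X(1) by (auto simp: \<phi>_def W)
  have connX: "conn (edges G) X"
  proof (rule conn_if_cuts[OF mg])
    show "X \<noteq> {}" using x by auto
    fix A assume A: "A \<subset> X" "A \<noteq> {}"
    have "A \<subset> verts G" "X - A \<subset> verts G" "X - A \<noteq> {}" using A X(1) by auto
    then have "3 \<le> size (cut (edges G) A)" "3 \<le> size (cut (edges G) (X - A))"
      using c3 A(2) unfolding three_edge_connected_def by blast+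
    then show "size (cut (edges G) X) < size (cut (edges G) A) + size (cut (edges G) (X - A))"
      using X(4) by linarith
  qed
  have "\<exists>\<sigma>. (\<forall>w\<in>W. \<sigma> w \<in> verts G \<and> \<phi> (\<sigma> w) = w) \<and>
    tm_step\<^sup>*\<^sup>* G \<lparr>verts = \<sigma> ` W, edges = image_mset (image \<sigma>) N\<rparr>"
  proof (rule cubic_quotient[OF mg W_def[symmetric] N_def[symmetric]])
    fix w assume w: "w \<in> W"
    show "conn (edges G) {v \<in> verts G. \<phi> v = w}" using fib[OF w] connX by simp
    assume "2 \<le> card {v \<in> verts G. \<phi> v = w}"
    then have "w = x" using fib[OF w] by (auto split: if_splits)
    have "size {#e \<in># N. w \<in> e#} = size {#e \<in># edges G. card (\<phi> ` e) = 2 \<and> w \<in> \<phi> ` e#}"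
      by (simp add: N_def filter_mset_image_mset filter_filter_mset)
    also have "\<dots> \<le> size (cut (edges G) X)"
      unfolding between_def
    proof (rule size_filter_mset_mono)
      fix e assume e: "e \<in># edges G" "card (\<phi> ` e) = 2 \<and> w \<in> \<phi> ` e"
      obtain p q where pq: "e = {p, q}" using multigraph_edgeE[OF mg e(1)] by metis
      show "e \<inter> X \<noteq> {} \<and> e \<inter> - X \<noteq> {}"
        using e(2) \<open>w = x\<close> x unfolding pq by (auto simp: \<phi>_def split: if_splits)
    qed
    finally show "size {#e \<in># N. w \<in> e#} \<le> 3" using X(4) by simp
  qed
  then obtain \<sigma> where \<sigma>: "\<And>w. w \<in> W \<Longrightarrow> \<sigma> w \<in> verts G \<and> \<phi> (\<sigma> w) = w"
    and steps: "tm_step\<^sup>*\<^sup>* G \<lparr>verts = \<sigma> ` W, edges = image_mset (image \<sigma>) N\<rparr>" by blast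
  let ?H = "\<lparr>verts = \<sigma> ` W, edges = image_mset (image \<sigma>) N\<rparr>"
  have "inj_on \<sigma> W" using \<sigma> by (metis inj_onI)
  then have cardH: "card (verts ?H) = Suc (card (verts G - X))"
    using x fin by (simp add: card_image W)
  have cardG: "card (verts G) = card X + card (verts G - X)"
    using fin X(1) by (metis card_Diff_subset card_mono le_add_diff_inverse)
  have "three_edge_connected ?H"
    unfolding three_edge_connected_def
  proof (intro allI impI)
    fix P assume P: "P \<subset> verts ?H" "P \<noteq> {}"
    define P' where "P' = {v \<in> verts G. \<sigma> (\<phi> v) \<in> P}"
    have pre: "\<exists>v\<in>verts G. \<sigma> (\<phi> v) = p" if p: "p \<in> \<sigma> ` W" for p
    proof -
      obtain v where "v \<in> verts G" "p = \<sigma> (\<phi> v)" using p by (auto simp: W_def)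
      then show ?thesis by blast
    qed
    have "P \<subset> \<sigma> ` W" using P by simp
    then obtain p q where pq: "p \<in> P" "p \<in> \<sigma> ` W" "q \<notin> P" "q \<in> \<sigma> ` W" using P(2) by blast
    obtain v where "v \<in> verts G" "\<sigma> (\<phi> v) = p" using pre[OF pq(2)] by blast
    then have "P' \<noteq> {}" using pq(1) by (auto simp: P'_def)
    obtain w where "w \<in> verts G" "\<sigma> (\<phi> w) = q" using pre[OF pq(4)] by blast
    then have "w \<in> verts G - P'" using pq(3) by (simp add: P'_def)
    then have "P' \<subset> verts G" by (auto simp: P'_def)
    with \<open>P' \<noteq> {}\<close> have "3 \<le> size (cut (edges G) P')" using c3 unfolding three_edge_connected_def by blast
    also have "\<dots> \<le> size {#e \<in># edges G. card (\<phi> ` e) = 2 \<and> \<sigma> ` \<phi> ` e \<inter> P \<noteq> {} \<and> \<sigma> ` \<phi> ` e \<inter> - P \<noteq> {}#}"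
      unfolding between_def
    proof (rule size_filter_mset_mono)
      fix e assume e: "e \<in># edges G" "e \<inter> P' \<noteq> {} \<and> e \<inter> - P' \<noteq> {}"
      obtain p q where pq: "e = {p, q}" "p \<in> verts G" "q \<in> verts G"
        using multigraph_edgeE[OF mg e(1)] by metis
      have "\<phi> p \<noteq> \<phi> q" using e(2) pq by (auto simp: P'_def)
      then show "card (\<phi> ` e) = 2 \<and> \<sigma> ` \<phi> ` e \<inter> P \<noteq> {} \<and> \<sigma> ` \<phi> ` e \<inter> - P \<noteq> {}"
        using e(2) pq by (auto simp: P'_def)
    qed
    also have "\<dots> = size (cut (edges ?H) P)"
      by (simp add: between_def N_def filter_mset_image_mset filter_filter_mset)
    finally show "3 \<le> size (cut (edges ?H) P)" .
  qed
  moreover have "size (edges ?H) \<le> size (edges G)"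
    by (simp add: N_def size_filter_mset_lesseq)
  ultimately show ?thesis using steps cardH cardG X(2,3) by (intro exI[of _ ?H]) auto
qed

text \<open>By \<open>nontriv\<close>, cuts with fewer than 4 edges occur only around single
  vertices of degree below 4. A set \<open>P\<close> is lifted to \<open>G\<close> by placing
  \<open>u\<close> with the majority of its three neighbours, so at most one edge at
  \<open>u\<close> is crossed. The new edge fails to make up for it only if \<open>a\<close> and
  \<open>b\<close> are together and \<open>c\<close> is opposite. That cut could be trivial only
  around \<open>c\<close>, hence it has at least 4 edges in \<open>G\<close> and can afford the
  loss.\<close>

lemma three_edge_connected_split_off:
  assumes mg: "multigraph G" and c3: "three_edge_connected G"
    and nontriv: "\<And>P. P \<subset> verts G \<Longrightarrow> P \<noteq> {} \<Longrightarrow>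
      (\<And>v. v \<in> verts G \<Longrightarrow> P = {v} \<or> P = verts G - {v} \<Longrightarrow> 4 \<le> degree G v) \<Longrightarrow>
      4 \<le> size (cut (edges G) P)"
    and u: "u \<in> verts G" and inc: "{#e \<in># edges G. u \<in> e#} = {#{u, a}, {u, b}, {u, c}#}"
    and ab: "a \<noteq> b" and c: "c \<in> {a, b} \<or> 4 \<le> degree G c"
  shows "three_edge_connected (split_off G u a b)"
  unfolding three_edge_connected_def
proof (intro allI impI)
  let ?E0 = "{#e \<in># edges G. u \<notin> e#}"
  have E: "edges G = {#{u, a}, {u, b}, {u, c}#} + ?E0"
    unfolding inc[symmetric] by (rule multiset_partition)
  have "{{u, a}, {u, b}, {u, c}} \<subseteq> set_mset {#e \<in># edges G. u \<in> e#}" unfolding inc by simp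
  then have "{u, a} \<in># edges G" "{u, b} \<in># edges G" "{u, c} \<in># edges G" by auto
  then have abc: "a \<in> verts G" "b \<in> verts G" "c \<in> verts G" "u \<noteq> a" "u \<noteq> b" "u \<noteq> c"
    using mg by (auto simp: multigraph_def)
  fix P assume "P \<subset> verts (split_off G u a b)" "P \<noteq> {}"
  then have P: "P \<subset> verts G - {u}" "P \<noteq> {}" "u \<notin> P" by (auto simp: split_off_def)
  define P' where "P' = (if a \<in> P \<and> b \<in> P \<or> a \<in> P \<and> c \<in> P \<or> b \<in> P \<and> c \<in> P then insert u P else P)"
  have P': "P' \<subset> verts G" "P' \<noteq> {}" using P u by (auto simp: P'_def)
  then have "3 \<le> size (cut (edges G) P')" using c3 by (simp add: three_edge_connected_def)
  have "cut ?E0 P' = cut ?E0 P" by (auto simp: P'_def intro: cut_insert_avoiding)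
  then have size': "size (cut (edges G) P') = size (cut {#{u, a}, {u, b}, {u, c}#} P') + size (cut ?E0 P)"
    by (subst E) (simp add: between_def)
  have size: "size (cut (edges (split_off G u a b)) P) = size (cut {#{a, b}#} P) + size (cut ?E0 P)"
    by (simp add: split_off_def between_def)
  show "3 \<le> size (cut (edges (split_off G u a b)) P)"
  proof (cases "(a \<in> P \<longleftrightarrow> b \<in> P) \<and> (a \<in> P \<longleftrightarrow> c \<notin> P)")
    case False
    then have "size (cut {#{u, a}, {u, b}, {u, c}#} P') \<le> size (cut {#{a, b}#} P)"
      using abc P(3) by (cases "a \<in> P"; cases "b \<in> P"; cases "c \<in> P") (simp_all add: between_def P'_def)
    then show ?thesis using \<open>3 \<le> _\<close> size size' by linarith
  next
    case True
    then have "size (cut {#{u, a}, {u, b}, {u, c}#} P') = 1"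
      using abc P(3) by (cases "a \<in> P"; cases "b \<in> P"; cases "c \<in> P") (simp_all add: between_def P'_def)
    moreover have "4 \<le> size (cut (edges G) P')"
    proof (rule nontriv[OF P'])
      fix v assume v: "v \<in> verts G" "P' = {v} \<or> P' = verts G - {v}"
      \<comment> \<open>The side of \<open>u\<close> also contains \<open>a\<close>, so the
        one-vertex side is that of \<open>c\<close>.\<close>
      have "v = c"
      proof (cases "a \<in> P")
        case a: True
        then have "a \<in> P'" "u \<in> P'" "c \<notin> P'" using True abc by (auto simp: P'_def)
        then show ?thesis using v abc by auto
      next
        case a: False
        then have "a \<notin> P'" "u \<notin> P'" "c \<in> P'" using True abc P(3) by (auto simp: P'_def)
        then show ?thesis using v abc u by auto
      qed
      then show "4 \<le> degree G v" using c True by auto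
    qed
    ultimately show ?thesis using size size' by linarith
  qed
qed

text \<open>The edge \<open>uv\<close> is deleted and both ends are smoothed. To lift a set,
  \<open>u\<close> follows \<open>a\<close> and \<open>b\<close> if they agree and otherwise follows
  \<open>c\<close> and \<open>d\<close>, symmetrically for \<open>v\<close>; if both pairs are
  split, \<open>u\<close> and \<open>v\<close> stay outside together. A loss occurs only if
  \<open>a\<close>, \<open>b\<close> face \<open>c\<close>, \<open>d\<close> across the cut: then
  \<open>uv\<close> is crossed and neither new edge is. As each side contains two distinct vertices,
  such a cut is nontrivial and has at least 4 edges.\<close>

lemma three_edge_connected_split_off_twice:
  assumes mg: "multigraph G" and c3: "three_edge_connected G"
    and nontriv: "\<And>P. P \<subset> verts G \<Longrightarrow> P \<noteq> {} \<Longrightarrow>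
      (\<And>v. v \<in> verts G \<Longrightarrow> P = {v} \<or> P = verts G - {v} \<Longrightarrow> 4 \<le> degree G v) \<Longrightarrow>
      4 \<le> size (cut (edges G) P)"
    and uv: "u \<in> verts G" "v \<in> verts G"
    and E: "edges G = {#{u, v}, {u, a}, {u, b}, {v, c}, {v, d}#} + M" "\<And>e. e \<in># M \<Longrightarrow> u \<notin> e \<and> v \<notin> e"
    and ab: "distinct [u, v, a, b]" and cd: "distinct [u, v, c, d]"
  shows "three_edge_connected (split_off (split_off G u a b) v c d)"
  unfolding three_edge_connected_def
proof (intro allI impI)
  let ?H = "split_off (split_off G u a b) v c d"
  have "{u, a} \<in># edges G" "{u, b} \<in># edges G" "{v, c} \<in># edges G" "{v, d} \<in># edges G"
    unfolding E(1) by simp_all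
  then have abc: "a \<in> verts G" "b \<in> verts G" "c \<in> verts G" "d \<in> verts G"
    using mg by (auto simp: multigraph_def)
  have ne: "u \<noteq> a" "u \<noteq> b" "u \<noteq> c" "u \<noteq> d" "v \<noteq> a" "v \<noteq> b" "v \<noteq> c" "v \<noteq> d" "u \<noteq> v" "a \<noteq> b" "c \<noteq> d"
    using ab cd by auto
  fix P assume "P \<subset> verts ?H" "P \<noteq> {}"
  then have P: "P \<subset> verts G - {u, v}" "P \<noteq> {}" "u \<notin> P" "v \<notin> P" by (auto simp: split_off_def)
  define P1 where "P1 = (if a \<in> P \<and> b \<in> P \<or> (a \<in> P \<or> b \<in> P) \<and> c \<in> P \<and> d \<in> P then insert u P else P)"
  define P' where "P' = (if c \<in> P \<and> d \<in> P \<or> (c \<in> P \<or> d \<in> P) \<and> a \<in> P \<and> b \<in> P then insert v P1 else P1)"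
  have P': "P' \<subset> verts G" "P' \<noteq> {}" using P uv by (auto simp: P'_def P1_def)
  then have "3 \<le> size (cut (edges G) P')" using c3 by (simp add: three_edge_connected_def)
  have "cut M P' = cut M P1" using E(2) by (auto simp: P'_def intro: cut_insert_avoiding)
  also have "\<dots> = cut M P" using E(2) by (auto simp: P1_def intro: cut_insert_avoiding)
  finally have size': "size (cut (edges G) P') =
    size (cut {#{u, v}, {u, a}, {u, b}, {v, c}, {v, d}#} P') + size (cut M P)"
    by (subst E) (simp add: between_def)
  have "{#e \<in># M. u \<notin> e#} = M" "{#e \<in># M. v \<notin> e#} = M" using E(2) by (auto simp: filter_mset_eq_conv)
  then have "edges ?H = {#{a, b}, {c, d}#} + M"
    using ne by (simp add: split_off_def E(1) add_mset_commute)
  then have size: "size (cut (edges ?H) P) = size (cut {#{a, b}, {c, d}#} P) + size (cut M P)"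
    by (simp add: between_def)
  show "3 \<le> size (cut (edges ?H) P)"
  proof (cases "(a \<in> P \<longleftrightarrow> b \<in> P) \<and> (c \<in> P \<longleftrightarrow> d \<in> P) \<and> (a \<in> P \<longleftrightarrow> c \<notin> P)")
    case False
    then have "size (cut {#{u, v}, {u, a}, {u, b}, {v, c}, {v, d}#} P') \<le> size (cut {#{a, b}, {c, d}#} P)"
      using ne P(3,4)
      by (cases "a \<in> P"; cases "b \<in> P"; cases "c \<in> P"; cases "d \<in> P")
        (simp_all add: between_def P'_def P1_def)
    then show ?thesis using \<open>3 \<le> _\<close> size size' by linarith
  next
    case True
    then have "size (cut {#{u, v}, {u, a}, {u, b}, {v, c}, {v, d}#} P') = 1"
      using ne P(3,4)
      by (cases "a \<in> P"; cases "b \<in> P"; cases "c \<in> P"; cases "d \<in> P")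
        (simp_all add: between_def P'_def P1_def)
    moreover have "4 \<le> size (cut (edges G) P')"
    proof (rule nontriv[OF P'])
      fix z assume z: "z \<in> verts G" "P' = {z} \<or> P' = verts G - {z}"
      have "{a, b} \<subseteq> P' \<and> {c, d} \<inter> P' = {} \<or> {c, d} \<subseteq> P' \<and> {a, b} \<inter> P' = {}"
        using True ne by (auto simp: P'_def P1_def)
      then have False using z(2) abc ne by auto
      then show "4 \<le> degree G z" ..
    qed
    ultimately show ?thesis using size size' by linarith
  qed
qed

text \<open>The measure counts edges as well, because deleting an edge keeps all vertices. Beyond
  three vertices, a counterexample of least measure has no nontrivial 3-cut, no edge with both ends
  of degree at least 4, and no vertex of degree 3 whose neighbours coincide or have larger degree.
  So it is cubic and simple; deleting an edge and smoothing its ends then reduces it unless it has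
  only four vertices.\<close>

theorem three_edge_connected_minor:
  assumes "multigraph G" "three_edge_connected G" "3 \<le> card (verts G)"
  shows "topological_minor K4 G \<or> topological_minor P33 G \<or> topological_minor C3221 G"
  using assms
proof (induction "card (verts G) + size (edges G)" arbitrary: G rule: less_induct)
  case less
  note mg = less.prems(1) and c3 = less.prems(2)
  have fin: "finite (verts G)" using mg by (simp add: multigraph_def)
  have reduce: ?case if "tm_step\<^sup>*\<^sup>* G H" "three_edge_connected H" "3 \<le> card (verts H)"
    "card (verts H) + size (edges H) < card (verts G) + size (edges G)" for H
    using less.hyps[of H] that tm_steps_multigraph[OF that(1) mg] topological_minor_steps[OF that(1)]
    by blast
  show ?case
  proof (cases "card (verts G) = 3")
    case True
    then obtain a b c where "verts G = {a, b, c}" "a \<noteq> b" "a \<noteq> c" "b \<noteq> c"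
      by (auto simp: card_3_iff)
    then show ?thesis using three_vertices[OF mg] c3 by blast
  next
    case False
    then have card4: "4 \<le> card (verts G)" using less.prems(3) by simp
    show ?thesis
    proof (rule ccontr)
      assume contr: "\<not> ?thesis"
      have nontriv: "4 \<le> size (cut (edges G) P)"
        if P: "P \<subset> verts G" "P \<noteq> {}"
          and tr: "\<And>v. v \<in> verts G \<Longrightarrow> P = {v} \<or> P = verts G - {v} \<Longrightarrow> 4 \<le> degree G v" for P
      proof (rule ccontr)
        assume n: "\<not> 4 \<le> size (cut (edges G) P)"
        moreover have "3 \<le> size (cut (edges G) P)" using c3 P by (simp add: three_edge_connected_def)
        ultimately have s: "size (cut (edges G) P) = 3" by linarith
        have finP: "finite P" "finite (verts G - P)" using P fin by (auto intro: finite_subset)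
        have "card P \<noteq> 1"
        proof
          assume "card P = 1"
          then obtain v where "P = {v}" by (auto simp: card_1_singleton_iff)
          then show False using tr[of v] P n degree_eq_cut[OF mg, of v] by auto
        qed
        moreover have "card (verts G - P) \<noteq> 1"
        proof
          assume "card (verts G - P) = 1"
          then obtain v where v: "verts G - P = {v}" by (auto simp: card_1_singleton_iff)
          then have "P = verts G - {v}" "v \<in> verts G" using P by auto
          moreover have "cut (edges G) {v} = cut (edges G) P"
            unfolding v[symmetric] by (rule cut_complement[OF mg]) (use P in auto)
          ultimately show False using tr[of v] n degree_eq_cut[OF mg, of v] by auto
        qed
        moreover have "card P \<noteq> 0" "card (verts G - P) \<noteq> 0" using P finP by auto
        ultimately have "2 \<le> card P" "2 \<le> card (verts G - P)" by linarith+
        then obtain H where "tm_step\<^sup>*\<^sup>* G H" "three_edge_connected H" "3 \<le> card (verts H)"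
          "card (verts H) < card (verts G)" "size (edges H) \<le> size (edges G)"
          using three_edge_connected_contract[OF mg c3] P s by (metis psubset_imp_subset)
        then show False using reduce[of H] contr by linarith
      qed
      have deg3: "3 \<le> degree G v" if "v \<in> verts G" for v
        using degree_ge_3[OF mg c3 less.prems(3) that] .
      \<comment> \<open>Otherwise a cut crossed by this edge is not trivial around a vertex of
        degree 3, so it has at least 4 edges and survives the loss of one.\<close>
      have heavy_edge: "degree G u = 3 \<or> degree G v = 3" if uv: "{u, v} \<in># edges G" for u v
      proof (rule ccontr)
        assume n: "\<not> ?thesis"
        have "u \<in> verts G" "v \<in> verts G" using uv mg by (auto simp: multigraph_def)
        then have d: "4 \<le> degree G u" "4 \<le> degree G v" using n deg3 by force+
        obtain M where M: "edges G = add_mset {u, v} M" using uv by (metis multi_member_split)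
        let ?H = "\<lparr>verts = verts G, edges = M\<rparr>"
        have "three_edge_connected ?H"
          unfolding three_edge_connected_def
        proof (intro allI impI)
          fix P assume P: "P \<subset> verts ?H" "P \<noteq> {}"
          show "3 \<le> size (cut (edges ?H) P)"
          proof (cases "u \<in> P \<longleftrightarrow> v \<in> P")
            case True
            then have "cut (edges G) P = cut M P" by (auto simp: M between_def)
            moreover have "3 \<le> size (cut (edges G) P)" using c3 P by (simp add: three_edge_connected_def)
            ultimately show ?thesis by simp
          next
            case False
            have "4 \<le> size (cut (edges G) P)"
            proof (rule nontriv)
              show "P \<subset> verts G" "P \<noteq> {}" using P by simp_all
              fix w assume "w \<in> verts G" "P = {w} \<or> P = verts G - {w}"
              then have "w = u \<or> w = v" using False \<open>u \<in> verts G\<close> \<open>v \<in> verts G\<close> by auto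
              then show "4 \<le> degree G w" using d by auto
            qed
            moreover have "size (cut (edges G) P) \<le> Suc (size (cut M P))" by (simp add: M between_def)
            ultimately show ?thesis by simp
          qed
        qed
        moreover have "tm_step\<^sup>*\<^sup>* G ?H" by (rule tm_steps_sub_edges) (simp add: M)
        ultimately show False using reduce[of ?H] less.prems(3) contr by (simp add: M)
      qed
      have light: "\<exists>a b c. {#e \<in># edges G. u \<in> e#} = {#{u, a}, {u, b}, {u, c}#} \<and>
          distinct [u, a, b, c] \<and> {a, b, c} \<subseteq> verts G \<and>
          degree G a = 3 \<and> degree G b = 3 \<and> degree G c = 3"
        if u: "u \<in> verts G" and du: "degree G u = 3" for u
      proof -
        obtain e1 e2 e3 where e: "{#e \<in># edges G. u \<in> e#} = {#e1, e2, e3#}"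
          using du size_3E unfolding degree_def by metis
        have other: "\<exists>w. f = {u, w} \<and> w \<noteq> u \<and> w \<in> verts G" if "f \<in># {#e \<in># edges G. u \<in> e#}" for f
        proof -
          have f: "f \<in># edges G" "u \<in> f" using that by auto
          obtain p q where "f = {p, q}" "p \<noteq> q" "p \<in> verts G" "q \<in> verts G"
            using multigraph_edgeE[OF mg f(1)] .
          then show ?thesis using f(2) by auto
        qed
        obtain a where a: "e1 = {u, a}" "a \<noteq> u" "a \<in> verts G" using other[of e1] e by auto
        obtain b where b: "e2 = {u, b}" "b \<noteq> u" "b \<in> verts G" using other[of e2] e by auto
        obtain c where c: "e3 = {u, c}" "c \<noteq> u" "c \<in> verts G" using other[of e3] e by auto
        have split: False if inc: "{#e \<in># edges G. u \<in> e#} = {#{u, x}, {u, y}, {u, z}#}"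
          "x \<noteq> y" "z \<in> {x, y} \<or> 4 \<le> degree G z" for x y z
        proof -
          let ?H = "split_off G u x y"
          have "edges G = {#{u, x}, {u, y}, {u, z}#} + {#e \<in># edges G. u \<notin> e#}"
            unfolding inc(1)[symmetric] by (rule multiset_partition)
          then have "{#{u, x}, {u, y}#} \<subseteq># edges G" and sz: "size (edges G) = 3 + size {#e \<in># edges G. u \<notin> e#}"
            by (metis add_mset_add_single mset_subset_eq_add_left union_assoc union_mset_add_mset_left, 
                metis (no_types, lifting) One_nat_def size_add_mset size_empty size_union numeral_3_eq_3)
          then have "tm_step\<^sup>*\<^sup>* G ?H" using tm_steps_split_off[OF mg _ inc(2)] by blast
          moreover have "three_edge_connected ?H"
            by (rule three_edge_connected_split_off[OF mg c3 nontriv u inc(1,2)]) (use inc in auto)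
          moreover have "card (verts ?H) = card (verts G) - 1" using u by (simp add: split_off_def)
          moreover have "size (edges ?H) < size (edges G)" using sz by (simp add: split_off_def)
          ultimately show False using reduce[of ?H] contr card4 by linarith
        qed
        \<comment> \<open>Three equal neighbours offer no pair to join, so \<open>u\<close> is
          deleted instead.\<close>
        have "\<not> (a = b \<and> b = c)"
        proof
          assume eq: "a = b \<and> b = c"
          let ?H = "\<lparr>verts = verts G - {u}, edges = {#e \<in># edges G. u \<notin> e#}\<rparr>"
          have "e = {u, a}" if "e \<in># edges G" "u \<in> e" for e
          proof -
            have "e \<in># {#e \<in># edges G. u \<in> e#}" using that by simp
            then show ?thesis unfolding \<open>{#e \<in># edges G. u \<in> e#} = {#e1, e2, e3#}\<close> using a b c eq by auto
          qed
          then have "three_edge_connected ?H" by (rule three_edge_connected_delete[OF mg c3 u])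
          moreover have "tm_step\<^sup>*\<^sup>* G ?H" using tm_step_delete_vertex[OF mg u] by blast
          moreover have "card (verts ?H) = card (verts G) - 1" using u by simp
          moreover have "size (edges ?H) \<le> size (edges G)" by (simp add: size_filter_mset_lesseq)
          ultimately show False using reduce[of ?H] contr card4 by linarith
        qed
        \<comment> \<open>If exactly two neighbours coincide, two different ones are joined and the
          third equals one of these. If all differ and one has degree at least 4, the other two are
          joined.\<close>
        then have "distinct [a, b, c]"
          using split[of a c b] split[of a b c] e a b c by (auto simp: add_mset_commute)
        moreover have "degree G a = 3" "degree G b = 3" "degree G c = 3"
          using split[of b c a] split[of a c b] split[of a b c] calculation e a b c deg3
          by (force simp: add_mset_commute)+
        ultimately show ?thesis using e a b c by (intro exI[of _ a] exI[of _ b] exI[of _ c]) auto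
      qed
      \<comment> \<open>A vertex of larger degree would have only neighbours of degree 3, and
        \<open>light\<close> makes all neighbours of those cubic, including the vertex
        itself.\<close>
      have cubic: "degree G v = 3" if v: "v \<in> verts G" for v
      proof -
        have "{#e \<in># edges G. v \<in> e#} \<noteq> {#}"
          using deg3[OF v] unfolding degree_def by (metis not_numeral_le_zero size_empty)
        then obtain e where e: "e \<in># edges G" "v \<in> e" by auto
        obtain p q where "e = {p, q}" "p \<noteq> q" "p \<in> verts G" "q \<in> verts G"
          using multigraph_edgeE[OF mg e(1)] .
        then obtain w where w: "{w, v} \<in># edges G" "w \<in> verts G" using e by (auto simp: insert_commute)
        show ?thesis
        proof (rule ccontr)
          assume n: "degree G v \<noteq> 3"
          then have "degree G w = 3" using heavy_edge[OF w(1)] by simp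
          then obtain a b c where abc: "{#e \<in># edges G. w \<in> e#} = {#{w, a}, {w, b}, {w, c}#}"
            "degree G a = 3" "degree G b = 3" "degree G c = 3" "w \<notin> {a, b, c}" using light[OF w(2)] by auto
          have "{w, v} \<in># {#e \<in># edges G. w \<in> e#}" using w(1) by simp
          then have "v \<in> {a, b, c}" unfolding abc(1) using abc(5) by (auto simp: doubleton_eq_iff)
          then show False using n abc by auto
        qed
      qed
      obtain u where u: "u \<in> verts G" using card4 by fastforce
      obtain v a b where uinc: "{#e \<in># edges G. u \<in> e#} = {#{u, v}, {u, a}, {u, b}#}"
        "distinct [u, v, a, b]" "{v, a, b} \<subseteq> verts G" using light[OF u cubic[OF u]] by blast
      have v: "v \<in> verts G" using uinc by simp
      obtain x y z where vinc: "{#e \<in># edges G. v \<in> e#} = {#{v, x}, {v, y}, {v, z}#}"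
        "distinct [v, x, y, z]" "{x, y, z} \<subseteq> verts G" using light[OF v cubic[OF v]] by blast
      have "{u, v} \<in># {#e \<in># edges G. u \<in> e#}" unfolding uinc by simp
      then have "{v, u} \<in># {#e \<in># edges G. v \<in> e#}" by (simp add: insert_commute)
      then have "u \<in> {x, y, z}" unfolding vinc(1) using uinc(2) by (auto simp: doubleton_eq_iff)
      then obtain c d where cd: "{#e \<in># edges G. v \<in> e#} = {#{v, u}, {v, c}, {v, d}#}"
        "distinct [u, v, c, d]" "{c, d} \<subseteq> verts G"
        using vinc by (auto simp: add_mset_commute)
      show False
      proof (cases "card (verts G) = 4")
        case True
        have Vuvab: "verts G = {u, v, a, b}"
          by (rule card_subset_eq[OF fin, symmetric]) (use True u uinc in auto)
        then have "{c, d} = {a, b}" using cd uinc by auto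
        have mem: "{u, v} \<in># edges G" "{u, a} \<in># edges G" "{u, b} \<in># edges G"
          "{v, c} \<in># edges G" "{v, d} \<in># edges G"
        proof -
          have "{{u, v}, {u, a}, {u, b}} \<subseteq> set_mset {#e \<in># edges G. u \<in> e#}"
            "{{v, c}, {v, d}} \<subseteq> set_mset {#e \<in># edges G. v \<in> e#}"
            unfolding uinc(1) cd(1) by simp_all
          then show "{u, v} \<in># edges G" "{u, a} \<in># edges G" "{u, b} \<in># edges G"
            "{v, c} \<in># edges G" "{v, d} \<in># edges G" by auto
        qed
        have a: "a \<in> verts G" using uinc by simp
        obtain x y z where ainc: "{#e \<in># edges G. a \<in> e#} = {#{a, x}, {a, y}, {a, z}#}"
          "distinct [a, x, y, z]" "{x, y, z} \<subseteq> verts G" using light[OF a cubic[OF a]] by blast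
        \<comment> \<open>Three distinct neighbours in a graph with four vertices are all the other
          vertices.\<close>
        have "b \<in> {x, y, z}" using ainc(2,3) uinc(2) unfolding Vuvab by auto
        then have "{a, b} \<in># {#e \<in># edges G. a \<in> e#}" unfolding ainc(1) by auto
        then have "{a, b} \<in># edges G" by simp
        moreover have "{v, a} \<in># edges G" "{v, b} \<in># edges G"
          using mem(4,5) \<open>{c, d} = {a, b}\<close> by (auto simp: doubleton_eq_iff)
        ultimately have "topological_minor K4 G"
          using K4_minorI[OF mg Vuvab uinc(2)] mem by simp
        then show False using contr by blast
      next
        case False
        \<comment> \<open>There are at least five vertices, so three remain when \<open>u\<close>
          and \<open>v\<close> are smoothed away.\<close>
        define M where "M = {#e \<in># edges G. u \<notin> e \<and> v \<notin> e#}"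
        have ne: "u \<noteq> c" "u \<noteq> d" "u \<noteq> v" using cd by auto
        have E0: "edges G = {#{u, v}, {u, a}, {u, b}#} + {#e \<in># edges G. u \<notin> e#}"
          unfolding uinc(1)[symmetric] by (rule multiset_partition)
        have "{#e \<in># edges G. u \<notin> e#} = {#e \<in># {#e \<in># edges G. u \<notin> e#}. v \<in> e#} + {#e \<in># {#e \<in># edges G. u \<notin> e#}. v \<notin> e#}"
          by (rule multiset_partition)
        also have "{#e \<in># {#e \<in># edges G. u \<notin> e#}. v \<in> e#} = {#e \<in># {#e \<in># edges G. v \<in> e#}. u \<notin> e#}"
          by (simp add: filter_filter_mset conj_commute)
        also have "\<dots> = {#{v, c}, {v, d}#}" unfolding cd(1) using ne by simp
        finally have E: "edges G = {#{u, v}, {u, a}, {u, b}, {v, c}, {v, d}#} + M"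
          using E0 by (simp add: M_def filter_filter_mset add_mset_commute)
        let ?G1 = "split_off G u a b" and ?H = "split_off (split_off G u a b) v c d"
        have "{#{u, a}, {u, b}#} \<subseteq># edges G"
          using uinc(2) by (intro pair_subseteq_mset) (auto simp: E doubleton_eq_iff)
        then have s1: "tm_step\<^sup>*\<^sup>* G ?G1" using uinc(2) by (intro tm_steps_split_off[OF mg]) auto
        \<comment> \<open>Splitting off \<open>u\<close> has also removed \<open>uv\<close>; the
          edges \<open>vc\<close> and \<open>vd\<close> survive because \<open>c\<close> and
          \<open>d\<close> differ from \<open>u\<close>.\<close>
        have "{#{v, c}, {v, d}#} \<subseteq># edges ?G1"
          using cd(2) ne by (intro pair_subseteq_mset) (auto simp: split_off_def E doubleton_eq_iff)
        then have "tm_step\<^sup>*\<^sup>* ?G1 ?H"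
          using cd(2) by (intro tm_steps_split_off[OF tm_steps_multigraph[OF s1 mg]]) auto
        with s1 have "tm_step\<^sup>*\<^sup>* G ?H" by simp
        moreover have "three_edge_connected ?H"
          by (rule three_edge_connected_split_off_twice[OF mg c3 nontriv u v E _ uinc(2) cd(2)])
            (auto simp: M_def)
        moreover have "card (verts ?H) = card (verts G) - 2"
          using u v ne fin by (simp add: split_off_def card_Diff_subset)
        moreover have "size (edges ?H) \<le> size (edges G)"
        proof -
          have "{#e \<in># M. u \<notin> e#} = M" "{#e \<in># M. v \<notin> e#} = M" by (auto simp: M_def filter_mset_eq_conv)
          then show ?thesis using uinc(2) cd(2) by (simp add: split_off_def E)
        qed
        ultimately show False using reduce[of ?H] contr card4 False by linarith
      qed
    qed
  qed
qed

section \<open>Two-edge cuts and loops of loops\<close>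

lemma size_filter_mset_or_le:
  "size {#x \<in># M. P x \<or> Q x#} \<le> size {#x \<in># M. P x#} + size {#x \<in># M. Q x#}"
  by (induction M) auto

lemma between_sym: "between M A B = between M B A"
  unfolding between_def by (simp add: conj_commute)

lemma cut_eq_between:
  assumes "multigraph G" "verts G = A \<union> B" "A \<inter> B = {}"
  shows "cut (edges G) A = between (edges G) A B"
  unfolding between_def
proof (rule filter_mset_cong)
  fix e assume "e \<in># edges G"
  then have "e \<subseteq> A \<union> B" using assms by (auto simp: multigraph_def)
  then show "e \<inter> A \<noteq> {} \<and> e \<inter> - A \<noteq> {} \<longleftrightarrow> e \<inter> A \<noteq> {} \<and> e \<inter> B \<noteq> {}" using assms(3) by blast
qed simp

text \<open>
  A maximal admissible \<open>A'\<close> containing no member of \<open>\<A>\<close> is left through a unique edge, which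
  every member of \<open>\<A>\<close> must use; the outer end of that edge is the hitting vertex.
\<close>

lemma conn_hitting_vertex:
  assumes X: "finite X" "conn M X" "x1 \<in> X" "x2 \<in> X"
    and \<A>: "\<And>A. A \<in> \<A> \<Longrightarrow> A \<subseteq> X \<and> conn M A \<and> x1 \<in> A"
    and \<B>: "\<And>B. B \<in> \<B> \<Longrightarrow> B \<subseteq> X \<and> conn M B \<and> x2 \<in> B"
    and thin: "\<And>A' B'. A' \<union> B' = X \<Longrightarrow> A' \<inter> B' = {} \<Longrightarrow> conn M A' \<Longrightarrow> conn M B' \<Longrightarrow>
      x1 \<in> A' \<Longrightarrow> x2 \<in> B' \<Longrightarrow> size (between M A' B') \<le> 1"
    and sep: "\<And>A' B' A B. A' \<union> B' = X \<Longrightarrow> A' \<inter> B' = {} \<Longrightarrow> conn M A' \<Longrightarrow> conn M B' \<Longrightarrow>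
      x1 \<in> A' \<Longrightarrow> x2 \<in> B' \<Longrightarrow> A \<in> \<A> \<Longrightarrow> B \<in> \<B> \<Longrightarrow> A \<subseteq> A' \<Longrightarrow> B \<subseteq> B' \<Longrightarrow> False"
  shows "\<exists>s\<in>X. (\<forall>A\<in>\<A>. s \<in> A) \<and> (\<forall>B\<in>\<B>. s \<in> B)"
proof -
  define \<M> where "\<M> = {A'. A' \<subseteq> X \<and> (A' = {} \<or> conn M A' \<and> x1 \<in> A') \<and> conn M (X - A') \<and>
    x2 \<in> X - A' \<and> (\<forall>A\<in>\<A>. \<not> A \<subseteq> A')}"
  have "\<M> \<subseteq> Pow X" by (auto simp: \<M>_def)
  then have fin: "finite \<M>" using X(1) by (simp add: finite_subset)
  have "{} \<in> \<M>" using X \<A> by (auto simp: \<M>_def)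
  then obtain A' where A': "A' \<in> \<M>" and max: "\<forall>A\<in>\<M>. A' \<subseteq> A \<longrightarrow> A' = A"
    using finite_has_maximal2[OF fin] by metis
  have A'X: "A' \<subseteq> X" "A' = {} \<or> conn M A' \<and> x1 \<in> A'" "conn M (X - A')" "x2 \<in> X - A'"
    and A'\<A>: "\<And>A. A \<in> \<A> \<Longrightarrow> \<not> A \<subseteq> A'"
    using A' by (auto simp: \<M>_def)
  have "\<exists>b\<in>X - A'. (\<forall>a\<in>A'. \<forall>b'\<in>X - A'. {a, b'} \<in># M \<longrightarrow> b' = b) \<and>
    conn M (insert b A') \<and> x1 \<in> insert b A' \<and> (A' = {} \<longrightarrow> b = x1)"
  proof (cases "A' = {}")
    case True
    then show ?thesis using X by (intro bexI[of _ x1]) auto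
  next
    case False
    then have cA: "conn M A'" "x1 \<in> A'" using A'X by auto
    have "A' \<subset> X" using A'X by auto
    from connD[OF X(2) this False] obtain a b where ab: "a \<in> A'" "b \<in> X" "b \<notin> A'" "{a, b} \<in># M" .
    have uniq: "b' = b" if b': "a' \<in> A'" "b' \<in> X - A'" "{a', b'} \<in># M" for a' b'
    proof (rule ccontr)
      assume "b' \<noteq> b"
      then have "{a', b'} \<noteq> {a, b}" using ab b' by (auto simp: doubleton_eq_iff)
      moreover have "{a', b'} \<in># between M A' (X - A')" "{a, b} \<in># between M A' (X - A')"
        using ab b' by (auto simp: between_def)
      ultimately have "{#{a', b'}, {a, b}#} \<subseteq># between M A' (X - A')" by (intro pair_subseteq_mset)
      then have "2 \<le> size (between M A' (X - A'))" using size_mset_mono by fastforce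
      moreover have "size (between M A' (X - A')) \<le> 1"
        by (rule thin) (use A'X cA in auto)
      ultimately show False by simp
    qed
    have "conn M (insert b A')" using conn_insert[OF cA(1) ab(1,4)] .
    then show ?thesis using ab cA False uniq
      by (intro bexI[of _ b] conjI ballI impI) blast+
  qed
  then obtain b where b: "b \<in> X" "b \<notin> A'" and uniq: "\<And>a b'. a \<in> A' \<Longrightarrow> b' \<in> X - A' \<Longrightarrow> {a, b'} \<in># M \<Longrightarrow> b' = b"
    and bA': "conn M (insert b A')" "x1 \<in> insert b A'" and bx1: "A' = {} \<Longrightarrow> b = x1" by blast
  \<comment> \<open>\<open>A\<close> starts at \<open>x1\<close> inside \<open>A'\<close> without
    being contained in it, so it leaves through the only outer end \<open>b\<close>; for empty
    \<open>A'\<close> the vertex \<open>b\<close> is \<open>x1\<close> itself.\<close>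
  have "b \<in> A" if A: "A \<in> \<A>" for A
  proof (cases "A' = {}")
    case True
    then show ?thesis using bx1 \<A>[OF A] by simp
  next
    case False
    then have "A \<inter> A' \<subset> A" "A \<inter> A' \<noteq> {}" using A'\<A>[OF A] A'X(2) \<A>[OF A] by auto
    with \<A>[OF A] obtain c d where "c \<in> A \<inter> A'" "d \<in> A" "d \<notin> A \<inter> A'" "{c, d} \<in># M" by (metis connD)
    then show ?thesis using uniq[of c d] \<A>[OF A] by auto
  qed
  \<comment> \<open>A member of \<open>\<B>\<close> avoiding \<open>b\<close> cannot enter
    \<open>A'\<close>, hence a partition of \<open>X\<close> into connected parts separates it from
    \<open>insert b A'\<close>. By \<open>sep\<close> the part containing \<open>b\<close> is
    admissible again, against maximality.\<close>
  moreover have "b \<in> B" if B: "B \<in> \<B>" for B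
  proof (rule ccontr)
    assume nb: "b \<notin> B"
    have "B \<inter> A' = {}"
    proof (rule ccontr)
      assume "B \<inter> A' \<noteq> {}"
      moreover have "B \<inter> A' \<subset> B" using \<B>[OF B] A'X(4) by auto
      ultimately obtain c d where "c \<in> B \<inter> A'" "d \<in> B" "d \<notin> B \<inter> A'" "{c, d} \<in># M"
        using \<B>[OF B] by (metis connD)
      then show False using uniq[of c d] \<B>[OF B] nb by auto
    qed
    then have "insert b A' \<inter> B = {}" "insert b A' \<subseteq> X" using nb b A'X by auto
    then obtain A2 B2 where AB: "insert b A' \<subseteq> A2" "B \<subseteq> B2" "A2 \<union> B2 = X" "A2 \<inter> B2 = {}" "conn M A2" "conn M B2"
      using conn_partition[OF X(1,2) bA'(1), of B] \<B>[OF B] by blast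
    have x: "x1 \<in> A2" "x2 \<in> B2" using AB bA' \<B>[OF B] by auto
    have "X - A2 = B2" using AB by auto
    moreover have "\<not> A \<subseteq> A2" if "A \<in> \<A>" for A using sep[OF AB(3-6) x that B _ AB(2)] by blast
    ultimately have "A2 \<in> \<M>" unfolding \<M>_def using AB x by blast
    then show False using max AB(1) b(2) by blast
  qed
  ultimately show ?thesis using b by blast
qed

lemma between_singletonD:
  assumes "between M A B = {#{x, y}#}" "A \<inter> B = {}" "x \<in> A" "y \<in> B" "a \<in> A" "b \<in> B" "{a, b} \<in># M"
  shows "a = x \<and> b = y"
proof -
  have "{a, b} \<in># between M A B" using assms(5-) by (auto simp: between_def)
  then have "{a, b} = {x, y}" using assms(1) by simp
  then show ?thesis using assms by (auto simp: doubleton_eq_iff)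
qed

text \<open>If all connected splits of \<open>X\<close> between \<open>x1\<close> and
  \<open>x2\<close> were thin, some \<open>s\<close> in \<open>X\<close> would lie in every egg
  avoiding \<open>p\<close>, and \<open>s\<close> and \<open>p\<close> together would hit all eggs.
  Avoiding \<open>p\<close> disables the edge \<open>pq\<close>, so such an egg leaves
  \<open>P\<close> only towards \<open>x1\<close> and \<open>Q\<close> only towards
  \<open>x2\<close>; it is governed by its trace on \<open>X\<close>.\<close>

lemma ring_side_splits:
  assumes mg: "multigraph G" and S: "scramble3 G S"
    and V: "verts G = X \<union> P \<union> Q" "X \<inter> P = {}" "X \<inter> Q = {}" "P \<inter> Q = {}"
    and XP: "between (edges G) X P = {#{x1, y1}#}" "x1 \<in> X" "y1 \<in> P"
    and XQ: "between (edges G) X Q = {#{x2, y2}#}" "x2 \<in> X" "y2 \<in> Q"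
    and PQ: "between (edges G) P Q = {#{p, q}#}" "p \<in> P" "q \<in> Q"
    and small: "\<And>E. E \<in> S \<Longrightarrow> \<not> E \<subseteq> X \<and> \<not> E \<subseteq> P \<and> \<not> E \<subseteq> Q"
    and X: "conn (edges G) X"
  shows "\<exists>A B. A \<union> B = X \<and> A \<inter> B = {} \<and> conn (edges G) A \<and> conn (edges G) B \<and> x1 \<in> A \<and> x2 \<in> B \<and>
    2 \<le> size (between (edges G) A B)"
proof (rule ccontr)
  assume contr: "\<not> ?thesis"
  let ?M = "edges G"
  have e1: "a = x1 \<and> b = y1" if "a \<in> X" "b \<in> P" "{a, b} \<in># ?M" for a b
    using between_singletonD[OF XP(1) V(2) XP(2,3)] that by blast
  have e2: "a = x2 \<and> b = y2" if "a \<in> X" "b \<in> Q" "{a, b} \<in># ?M" for a b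
    using between_singletonD[OF XQ(1) V(3) XQ(2,3)] that by blast
  have e3: "a = p \<and> b = q" if "a \<in> P" "b \<in> Q" "{a, b} \<in># ?M" for a b
    using between_singletonD[OF PQ(1) V(4) PQ(2,3)] that by blast
  have egg: "E \<subseteq> X \<union> P \<union> Q" "conn ?M E" if "E \<in> S" for E
    using S that V(1) by (auto simp: scramble3_def)
  have meetP: "x1 \<in> E" if E: "E \<in> S" "p \<notin> E" and meets: "E \<inter> P \<noteq> {}" for E
  proof -
    have "E \<inter> P \<subset> E" using small[OF E(1)] by auto
    from connD[OF egg(2)[OF E(1)] this meets]
    obtain a b where ab: "a \<in> E \<inter> P" "b \<in> E" "b \<notin> E \<inter> P" "{a, b} \<in># ?M" .
    then have "b \<in> X \<or> b \<in> Q" using egg(1)[OF E(1)] by auto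
    then show ?thesis
    proof
      assume "b \<in> X"
      then show ?thesis using e1[of b a] ab by (simp add: insert_commute)
    next
      assume "b \<in> Q"
      then show ?thesis using e3[of a b] ab E(2) by simp
    qed
  qed
  have meetQ: "x2 \<in> E" if E: "E \<in> S" "p \<notin> E" and meets: "E \<inter> Q \<noteq> {}" for E
  proof -
    have "E \<inter> Q \<subset> E" using small[OF E(1)] by auto
    from connD[OF egg(2)[OF E(1)] this meets]
    obtain a b where ab: "a \<in> E \<inter> Q" "b \<in> E" "b \<notin> E \<inter> Q" "{a, b} \<in># ?M" .
    then have "b \<in> X \<or> b \<in> P" using egg(1)[OF E(1)] by auto
    then show ?thesis
    proof
      assume "b \<in> X"
      then show ?thesis using e2[of b a] ab by (simp add: insert_commute)
    next
      assume "b \<in> P"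
      then show ?thesis using e3[of b a] ab E(2) by (simp add: insert_commute)
    qed
  qed
  have trace: "conn ?M (E \<inter> X)" if E: "E \<in> S" "p \<notin> E" for E
  proof (rule connI)
    have "E \<inter> P \<noteq> {} \<or> E \<inter> Q \<noteq> {}" using egg(1)[OF E(1)] small[OF E(1)] by blast
    then show "E \<inter> X \<noteq> {}" using meetP[OF E] meetQ[OF E] XP(2) XQ(2) by blast
    fix A assume A: "A \<subset> E \<inter> X" "A \<noteq> {}"
    show "\<exists>a\<in>A. \<exists>b\<in>E \<inter> X - A. {a, b} \<in># ?M"
    proof (rule ccontr)
      assume n: "\<not> ?thesis"
      \<comment> \<open>The parts of \<open>E\<close> in \<open>P\<close> and in \<open>Q\<close>
        hang on \<open>x1\<close> and \<open>x2\<close>. Each joins \<open>A\<close> exactly when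
        its attachment point is in \<open>A\<close>, so an edge inside \<open>E\<close> leaving
        \<open>A'\<close> must run within \<open>X\<close>.\<close>
      define A' where "A' = A \<union> {v \<in> E \<inter> P. x1 \<in> A} \<union> {v \<in> E \<inter> Q. x2 \<in> A}"
      obtain c where c: "c \<in> E \<inter> X" "c \<notin> A" using A(1) by blast
      then have "c \<notin> A'" using V by (auto simp: A'_def)
      then have "A' \<subset> E" "A' \<noteq> {}" using A c by (auto simp: A'_def)
      from connD[OF egg(2)[OF E(1)] this] obtain a b where ab: "a \<in> A'" "b \<in> E" "b \<notin> A'" "{a, b} \<in># ?M" .
      have ba: "{b, a} \<in># ?M" using ab(4) by (simp add: insert_commute)
      have bpos: "b \<in> X \<or> b \<in> P \<or> b \<in> Q" using ab(2) egg(1)[OF E(1)] by auto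
      consider "a \<in> A" | "a \<in> E \<inter> P" "x1 \<in> A" | "a \<in> E \<inter> Q" "x2 \<in> A" using ab(1) by (auto simp: A'_def)
      then show False
      proof cases
        case 1
        then have "a \<in> X" using A by auto
        then show False using bpos n ab e1[of a b] e2[of a b] 1 by (auto simp: A'_def)
      next
        case 2
        then show False using bpos ab ba e1[of b a] e3[of a b] E(2) by (auto simp: A'_def)
      next
        case 3
        then show False using bpos ab ba e2[of b a] e3[of b a] E(2) by (auto simp: A'_def)
      qed
    qed
  qed
  have fin: "finite X" using mg V(1) by (auto simp: multigraph_def)
  define \<A> where "\<A> = {E \<inter> X | E. E \<in> S \<and> p \<notin> E \<and> x1 \<in> E}"
  define \<B> where "\<B> = {E \<inter> X | E. E \<in> S \<and> p \<notin> E \<and> x2 \<in> E}"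
  have "\<exists>s\<in>X. (\<forall>A\<in>\<A>. s \<in> A) \<and> (\<forall>B\<in>\<B>. s \<in> B)"
  proof (rule conn_hitting_vertex[OF fin X XP(2) XQ(2)])
    show "A \<subseteq> X \<and> conn ?M A \<and> x1 \<in> A" if "A \<in> \<A>" for A using that trace XP(2) by (auto simp: \<A>_def)
    show "B \<subseteq> X \<and> conn ?M B \<and> x2 \<in> B" if "B \<in> \<B>" for B using that trace XQ(2) by (auto simp: \<B>_def)
  next
    fix A B
    assume AB: "A \<union> B = X" "A \<inter> B = {}" "conn ?M A" "conn ?M B" "x1 \<in> A" "x2 \<in> B"
    then show thin: "size (between ?M A B) \<le> 1" using contr by (metis Suc_1 not_less_eq_eq)
    fix A0 B0 assume "A0 \<in> \<A>" "B0 \<in> \<B>" "A0 \<subseteq> A" "B0 \<subseteq> B"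
    then obtain E F where E: "E \<in> S" "p \<notin> E" "E \<inter> X \<subseteq> A" and F: "F \<in> S" "p \<notin> F" "F \<inter> X \<subseteq> B"
      by (auto simp: \<A>_def \<B>_def)
    have "x2 \<notin> E" using E(3) AB XQ(2) by auto
    then have "E \<inter> Q = {}" using meetQ[OF E(1,2)] by auto
    then have E': "E \<subseteq> A \<union> P" using E(3) egg(1)[OF E(1)] by auto
    have "x1 \<notin> F" using F(3) AB XP(2) by auto
    then have "F \<inter> P = {}" using meetP[OF F(1,2)] by auto
    then have "F \<inter> (A \<union> P) = {}" using F(3) egg(1)[OF F(1)] AB(1,2) by blast
    \<comment> \<open>Only edges between \<open>A\<close> and \<open>B\<close> and the edge
      \<open>pq\<close> lead from \<open>A \<union> P\<close> to \<open>B \<union> Q\<close>. With a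
      thin split these are at most 1 + 1, too few to separate two eggs.\<close>
    then have "3 \<le> size (cut ?M (A \<union> P))" using scramble3_cut[OF S E(1) F(1) E'] by blast
    also have "\<dots> \<le> size {#e \<in># ?M. e \<inter> A \<noteq> {} \<and> e \<inter> B \<noteq> {} \<or> e \<inter> P \<noteq> {} \<and> e \<inter> Q \<noteq> {}#}"
      unfolding between_def
    proof (rule size_filter_mset_mono)
      fix e assume e: "e \<in># ?M" "e \<inter> (A \<union> P) \<noteq> {} \<and> e \<inter> - (A \<union> P) \<noteq> {}"
      obtain u v where uv: "e = {u, v}" "u \<in> verts G" "v \<in> verts G" using multigraph_edgeE[OF mg e(1)] by metis
      have "\<exists>a b. e = {a, b} \<and> a \<in> A \<union> P \<and> b \<in> B \<union> Q"
        using e(2) uv V(1) AB(1) by (auto simp: insert_commute)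
      then obtain a b where ab: "e = {a, b}" "a \<in> A \<union> P" "b \<in> B \<union> Q" by blast
      have "{a, b} \<in># ?M" "{b, a} \<in># ?M" using e(1) ab(1) by (auto simp: insert_commute)
      then have "\<not> (a \<in> A \<and> b \<in> Q)" "\<not> (a \<in> P \<and> b \<in> B)"
        using e2[of a b] e1[of b a] AB by auto
      then show "e \<inter> A \<noteq> {} \<and> e \<inter> B \<noteq> {} \<or> e \<inter> P \<noteq> {} \<and> e \<inter> Q \<noteq> {}" using ab by auto
    qed
    also have "\<dots> \<le> size (between ?M A B) + size (between ?M P Q)"
      unfolding between_def by (rule size_filter_mset_or_le)
    finally show False using thin PQ(1) by simp
  qed
  then obtain s where s: "\<And>A. A \<in> \<A> \<Longrightarrow> s \<in> A" "\<And>B. B \<in> \<B> \<Longrightarrow> s \<in> B" by blast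
  obtain E where E: "E \<in> S" "s \<notin> E" "p \<notin> E" using S unfolding scramble3_def by metis
  have "E \<inter> P \<noteq> {} \<or> E \<inter> Q \<noteq> {}" using egg(1)[OF E(1)] small[OF E(1)] by blast
  then have "E \<inter> X \<in> \<A> \<or> E \<inter> X \<in> \<B>"
    using meetP[OF E(1,3)] meetQ[OF E(1,3)] E by (auto simp: \<A>_def \<B>_def)
  then show False using s E(2) by blast
qed

section \<open>Assembling LL6 from the halves of a ring\<close>

lemma LL6_edges_subseteq:
  assumes "2 \<le> count M {1, 2}" "1 \<le> count M {2, 3}" "2 \<le> count M {3, 4}"
    "1 \<le> count M {4, 5}" "2 \<le> count M {5, 6}" "1 \<le> count M {6, 1}"
  shows "edges LL6 \<subseteq># M"
  unfolding subseteq_mset_def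
proof
  fix f
  have c: "count (edges LL6) f = (if f = {1, 2} then 2 else if f = {2, 3} then 1 else if f = {3, 4} then 2
    else if f = {4, 5} then 1 else if f = {5, 6} then 2 else if f = {6, 1} then 1 else 0)"
    by (simp add: LL6_def doubleton_eq_iff)
  show "count (edges LL6) f \<le> count M f" unfolding c using assms by simp
qed

text \<open>Every vertex of LL6 has degree 3, so all six connected sets may be contracted; surplus
  edges between them are dropped.\<close>

lemma LL6_minorI:
  fixes G :: "'v mgraph"
  assumes mg: "multigraph G" and V: "verts G = A1 \<union> A2 \<union> A3 \<union> A4 \<union> A5 \<union> A6"
    and disj: "A1 \<inter> (A2 \<union> A3 \<union> A4 \<union> A5 \<union> A6) = {}" "A2 \<inter> (A3 \<union> A4 \<union> A5 \<union> A6) = {}"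
      "A3 \<inter> (A4 \<union> A5 \<union> A6) = {}" "A4 \<inter> (A5 \<union> A6) = {}" "A5 \<inter> A6 = {}"
    and cn: "conn (edges G) A1" "conn (edges G) A2" "conn (edges G) A3"
      "conn (edges G) A4" "conn (edges G) A5" "conn (edges G) A6"
    and sizes: "2 \<le> size (between (edges G) A1 A2)" "1 \<le> size (between (edges G) A2 A3)"
      "2 \<le> size (between (edges G) A3 A4)" "1 \<le> size (between (edges G) A4 A5)"
      "2 \<le> size (between (edges G) A5 A6)" "1 \<le> size (between (edges G) A6 A1)"
  shows "topological_minor LL6 G"
proof -
  define \<phi> where "\<phi> v = (if v \<in> A1 then 1 else if v \<in> A2 then 2 else if v \<in> A3 then 3
    else if v \<in> A4 then 4 else if v \<in> A5 then 5 else 6 :: nat)" for v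
  let ?I = "image_mset (image \<phi>) (edges G)"
  have val: "v \<in> A1 \<Longrightarrow> \<phi> v = 1" "v \<in> A2 \<Longrightarrow> \<phi> v = 2" "v \<in> A3 \<Longrightarrow> \<phi> v = 3"
    "v \<in> A4 \<Longrightarrow> \<phi> v = 4" "v \<in> A5 \<Longrightarrow> \<phi> v = 5" "v \<in> A6 \<Longrightarrow> \<phi> v = 6" for v
    using disj by (auto simp: \<phi>_def)
  have fib: "{v \<in> verts G. \<phi> v = 1} = A1" "{v \<in> verts G. \<phi> v = 2} = A2" "{v \<in> verts G. \<phi> v = 3} = A3"
    "{v \<in> verts G. \<phi> v = 4} = A4" "{v \<in> verts G. \<phi> v = 5} = A5" "{v \<in> verts G. \<phi> v = 6} = A6"
    unfolding V using val by fastforce+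
  have cnt: "size (between (edges G) A B) \<le> count ?I {i, j}"
    if "\<And>v. v \<in> A \<Longrightarrow> \<phi> v = i" "\<And>v. v \<in> B \<Longrightarrow> \<phi> v = j" "A \<inter> B = {}" for A B i j
  proof -
    have "size (between (edges G) A B) \<le> size {#e \<in># edges G. \<phi> ` e = {i, j}#}"
      unfolding between_def
    proof (rule size_filter_mset_mono)
      fix e assume e: "e \<in># edges G" "e \<inter> A \<noteq> {} \<and> e \<inter> B \<noteq> {}"
      obtain u v where "e = {u, v}" using multigraph_edgeE[OF mg e(1)] by metis
      then show "\<phi> ` e = {i, j}" using e(2) that by auto
    qed
    also have "\<dots> = size {#f \<in># ?I. f = {i, j}#}" by (simp add: filter_mset_image_mset)
    also have "\<dots> = count ?I {i, j}" by (simp only: filter_eq_replicate_mset size_replicate_mset)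
    finally show ?thesis .
  qed
  have counts: "2 \<le> count ?I {1, 2}" "1 \<le> count ?I {2, 3}" "2 \<le> count ?I {3, 4}"
    "1 \<le> count ?I {4, 5}" "2 \<le> count ?I {5, 6}" "1 \<le> count ?I {6, 1}"
  proof -
    show "2 \<le> count ?I {1, 2}"
      by (rule order_trans[OF sizes(1) cnt[OF val(1,2)]]) (use disj in blast)+
    show "1 \<le> count ?I {2, 3}"
      by (rule order_trans[OF sizes(2) cnt[OF val(2,3)]]) (use disj in blast)+
    show "2 \<le> count ?I {3, 4}"
      by (rule order_trans[OF sizes(3) cnt[OF val(3,4)]]) (use disj in blast)+
    show "1 \<le> count ?I {4, 5}"
      by (rule order_trans[OF sizes(4) cnt[OF val(4,5)]]) (use disj in blast)+
    show "2 \<le> count ?I {5, 6}"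
      by (rule order_trans[OF sizes(5) cnt[OF val(5,6)]]) (use disj in blast)+
    show "1 \<le> count ?I {6, 1}"
      by (rule order_trans[OF sizes(6) cnt[OF val(6,1)]]) (use disj in blast)+
  qed
  have ne: "A1 \<noteq> {}" "A2 \<noteq> {}" "A3 \<noteq> {}" "A4 \<noteq> {}" "A5 \<noteq> {}" "A6 \<noteq> {}"
    using cn by (simp_all add: conn_def)
  show ?thesis
  proof (rule topological_minorI[OF mg])
    have "\<phi> ` A1 = {1}" "\<phi> ` A2 = {2}" "\<phi> ` A3 = {3}" "\<phi> ` A4 = {4}" "\<phi> ` A5 = {5}" "\<phi> ` A6 = {6}"
      using val ne by auto
    then show "\<phi> ` verts G = verts LL6" unfolding V image_Un by (auto simp: LL6_def)
    show "edges LL6 \<subseteq># ?I" using counts by (rule LL6_edges_subseteq)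
    show "card e = 2" if "e \<in># edges LL6" for e
      using that multigraph_LL6 by (simp add: multigraph_def)
    fix w assume w: "w \<in> verts LL6"
    then show "conn (edges G) {v \<in> verts G. \<phi> v = w}" using fib cn by (auto simp: LL6_def)
    show "size {#e \<in># edges LL6. w \<in> e#} \<le> 3" using w by (auto simp: LL6_def numeral_eq_Suc)
  qed
qed

lemma ring_LL6:
  assumes mg: "multigraph G" and S: "scramble3 G S"
    and V: "verts G = X \<union> P \<union> Q" "X \<inter> P = {}" "X \<inter> Q = {}" "P \<inter> Q = {}"
    and XP: "between (edges G) X P = {#{x1, y1}#}" "x1 \<in> X" "y1 \<in> P"
    and XQ: "between (edges G) X Q = {#{x2, y2}#}" "x2 \<in> X" "y2 \<in> Q"
    and PQ: "between (edges G) P Q = {#{p, q}#}" "p \<in> P" "q \<in> Q"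
    and small: "\<And>E. E \<in> S \<Longrightarrow> \<not> E \<subseteq> X \<and> \<not> E \<subseteq> P \<and> \<not> E \<subseteq> Q"
    and cn: "conn (edges G) X" "conn (edges G) P" "conn (edges G) Q"
  shows "topological_minor LL6 G"
proof -
  have PX: "between (edges G) P X = {#{y1, x1}#}" and QX: "between (edges G) Q X = {#{y2, x2}#}"
    and QP: "between (edges G) Q P = {#{q, p}#}"
    using XP(1) XQ(1) PQ(1) by (simp_all add: between_sym insert_commute)
  have d: "P \<inter> X = {}" "Q \<inter> X = {}" "Q \<inter> P = {}" using V by auto
  obtain A1 A2 where X12: "A1 \<union> A2 = X" "A1 \<inter> A2 = {}" "conn (edges G) A1" "conn (edges G) A2"
    "x1 \<in> A1" "x2 \<in> A2" "2 \<le> size (between (edges G) A1 A2)"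
    using ring_side_splits[OF mg S V XP XQ PQ small cn(1)] by blast
  have V2: "verts G = Q \<union> X \<union> P" "verts G = P \<union> Q \<union> X" using V(1) by auto
  \<comment> \<open>The ring is rotated: first \<open>Q\<close>, \<open>X\<close>, \<open>P\<close>
    and then \<open>P\<close>, \<open>Q\<close>, \<open>X\<close> take the roles of
    \<open>X\<close>, \<open>P\<close>, \<open>Q\<close>. The halves are numbered cyclically, and
    the ring edges join \<open>A2\<close> to \<open>A3\<close>, \<open>A4\<close> to
    \<open>A5\<close> and \<open>A6\<close> to \<open>A1\<close>.\<close>
  obtain A3 A4 where Q34: "A3 \<union> A4 = Q" "A3 \<inter> A4 = {}" "conn (edges G) A3" "conn (edges G) A4"
    "y2 \<in> A3" "q \<in> A4" "2 \<le> size (between (edges G) A3 A4)"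
    using ring_side_splits[OF mg S V2(1) d(2,3) V(2) QX XQ(3,2) QP PQ(3,2) XP _ cn(3)] small by blast
  obtain A5 A6 where P56: "A5 \<union> A6 = P" "A5 \<inter> A6 = {}" "conn (edges G) A5" "conn (edges G) A6"
    "p \<in> A5" "y1 \<in> A6" "2 \<le> size (between (edges G) A5 A6)"
    using ring_side_splits[OF mg S V2(2) V(4) d(1,2) PQ PX XP(3,2) QX XQ(3,2) _ cn(2)] small by blast
  have single: "1 \<le> size (between (edges G) A B)"
    if "between (edges G) A' B' = {#{x, y}#}" "x \<in> A" "y \<in> B" for A B A' B' x y
  proof -
    have "{x, y} \<in># between (edges G) A' B'" using that(1) by simp
    then have "{x, y} \<in># between (edges G) A B" using that(2,3) by (auto simp: between_def)
    then show ?thesis by (metis One_nat_def Suc_leI nonempty_has_size empty_iff set_mset_empty)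
  qed
  show ?thesis
  proof (rule LL6_minorI[OF mg])
    show "verts G = A1 \<union> A2 \<union> A3 \<union> A4 \<union> A5 \<union> A6"
      unfolding V(1) X12(1)[symmetric] Q34(1)[symmetric] P56(1)[symmetric] by blast
    show "A1 \<inter> (A2 \<union> A3 \<union> A4 \<union> A5 \<union> A6) = {}" "A2 \<inter> (A3 \<union> A4 \<union> A5 \<union> A6) = {}"
      "A3 \<inter> (A4 \<union> A5 \<union> A6) = {}" "A4 \<inter> (A5 \<union> A6) = {}" "A5 \<inter> A6 = {}"
      using V(2-4) X12(2) Q34(2) P56(2) unfolding X12(1)[symmetric] Q34(1)[symmetric] P56(1)[symmetric]
      by (simp_all add: Int_Un_distrib Int_Un_distrib2 Int_commute)
    show "1 \<le> size (between (edges G) A2 A3)" by (rule single[OF XQ(1) X12(6) Q34(5)])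
    show "1 \<le> size (between (edges G) A4 A5)" by (rule single[OF QP Q34(6) P56(5)])
    show "1 \<le> size (between (edges G) A6 A1)" by (rule single[OF PX P56(6) X12(5)])
  qed (fact X12 Q34 P56)+
qed

section \<open>Removing an egg-free set from a scramble\<close>

lemma conn_diff:
  assumes E: "conn M E" "\<not> E \<subseteq> X"
    and nbrs: "\<And>a b. a \<in> X \<Longrightarrow> b \<notin> X \<Longrightarrow> b \<in> E \<Longrightarrow> {a, b} \<in># M \<Longrightarrow> b \<in> N"
    and clique: "\<And>a b. a \<in> N \<Longrightarrow> b \<in> N \<Longrightarrow> a \<noteq> b \<Longrightarrow> {a, b} \<in># M'"
    and rest: "\<And>e. e \<in># M \<Longrightarrow> e \<inter> X = {} \<Longrightarrow> e \<in># M' \<or> \<not> e \<subseteq> E"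
  shows "conn M' (E - X)"
proof (rule connI)
  show "E - X \<noteq> {}" using E(2) by auto
  fix A assume A: "A \<subset> E - X" "A \<noteq> {}"
  define B where "B = E - X - A"
  have AB: "A \<union> B = E - X" "A \<inter> B = {}" "B \<noteq> {}" using A by (auto simp: B_def)
  show "\<exists>a\<in>A. \<exists>b\<in>E - X - A. {a, b} \<in># M'"
  proof (rule ccontr)
    assume n: "\<not> ?thesis"
    then have n1: "{a, b} \<notin># M'" "{b, a} \<notin># M'" if "a \<in> A" "b \<in> B" for a b
      using that by (auto simp: B_def insert_commute)
    \<comment> \<open>Pairwise adjacent vertices of \<open>N\<close> lie on one side of a
      bipartition without edges. The other side \<open>C\<close> has no neighbour in
      \<open>X\<close>, so an edge inside \<open>E\<close> leaving \<open>C\<close> leads to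
      \<open>D\<close> and survives.\<close>
    have "\<exists>C D. C \<union> D = E - X \<and> C \<inter> D = {} \<and> C \<noteq> {} \<and> D \<noteq> {} \<and> C \<inter> N = {} \<and>
      (\<forall>c\<in>C. \<forall>d\<in>D. {c, d} \<notin># M')"
    proof (cases "A \<inter> N = {}")
      case True
      then show ?thesis using AB A(2) n1 by (intro exI[of _ A] exI[of _ B]) simp
    next
      case False
      then obtain a where a: "a \<in> A" "a \<in> N" by blast
      have "B \<inter> N = {}"
      proof (rule ccontr)
        assume "B \<inter> N \<noteq> {}"
        then obtain b where b: "b \<in> B" "b \<in> N" by blast
        then have "a \<noteq> b" using a AB(2) by auto
        then show False using clique[OF a(2) b(2)] n1(1)[OF a(1) b(1)] by blast
      qed
      then show ?thesis using AB A(2) n1 by (intro exI[of _ B] exI[of _ A]) (simp add: Un_commute Int_commute)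
    qed
    then obtain C D where "C \<union> D = E - X \<and> C \<inter> D = {} \<and> C \<noteq> {} \<and> D \<noteq> {} \<and> C \<inter> N = {} \<and>
      (\<forall>c\<in>C. \<forall>d\<in>D. {c, d} \<notin># M')" by (elim exE) (rule that)
    then have CD: "C \<union> D = E - X" "C \<inter> D = {}" "C \<noteq> {}" "C \<inter> N = {}" "D \<noteq> {}"
      and no: "\<And>c d. c \<in> C \<Longrightarrow> d \<in> D \<Longrightarrow> {c, d} \<notin># M'" by simp_all
    have "C \<subset> E" using CD(1,2,5) by auto
    from connD[OF E(1) this CD(3)] obtain c d where cd: "c \<in> C" "d \<in> E" "d \<notin> C" "{c, d} \<in># M" .
    have c: "c \<in> E" "c \<notin> X" using cd(1) CD(1) by auto
    show False
    proof (cases "d \<in> X")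
      case True
      then have "c \<in> N" using nbrs[of d c] c cd(4) by (simp add: insert_commute)
      then show False using cd(1) CD(4) by auto
    next
      case False
      then have "d \<in> D" using cd CD(1) by blast
      moreover have "{c, d} \<in># M'" using rest[OF cd(4)] c cd(2) False by auto
      ultimately show False using no cd(1) by blast
    qed
  qed
qed

text \<open>Common part of deletion and bypass: \<open>N\<close> holds the outside neighbours of
  \<open>X\<close>, either one vertex or two that the new edge joins. A smaller egg avoids two given
  vertices all the more, so only the cuts depend on the operation.\<close>

lemma scramble3_diff:
  assumes S: "scramble3 G S" and X: "\<And>E. E \<in> S \<Longrightarrow> \<not> E \<subseteq> X"
    and V: "verts H = verts G - X"
    and nbrs: "\<And>a b. a \<in> X \<Longrightarrow> b \<in> verts G - X \<Longrightarrow> {a, b} \<in># edges G \<Longrightarrow> b \<in> N"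
    and clique: "\<And>a b. a \<in> N \<Longrightarrow> b \<in> N \<Longrightarrow> a \<noteq> b \<Longrightarrow> {a, b} \<in># edges H"
    and rest: "\<And>e. e \<in># edges G \<Longrightarrow> e \<subseteq> verts G - X \<Longrightarrow> e \<in># edges H"
    and cuts: "\<And>E F P. E \<in> S \<Longrightarrow> F \<in> S \<Longrightarrow> E - X \<subseteq> P \<Longrightarrow> (F - X) \<inter> P = {} \<Longrightarrow> 3 \<le> size (cut (edges H) P)"
  shows "scramble3 H ((\<lambda>E. E - X) ` S)"
  unfolding scramble3_def
proof (intro conjI ballI allI impI)
  fix E' assume "E' \<in> (\<lambda>E. E - X) ` S"
  then obtain E where E: "E \<in> S" "E' = E - X" by blast
  have egg: "E \<subseteq> verts G" "conn (edges G) E" using S E(1) by (auto simp: scramble3_def)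
  show "E' \<subseteq> verts H" using egg(1) by (auto simp: E(2) V)
  show "conn (edges H) E'"
    unfolding E(2)
  proof (rule conn_diff[OF egg(2) X[OF E(1)], of N])
    show "b \<in> N" if "a \<in> X" "b \<notin> X" "b \<in> E" "{a, b} \<in># edges G" for a b
      using nbrs[of a b] that egg(1) by auto
    show "{a, b} \<in># edges H" if "a \<in> N" "b \<in> N" "a \<noteq> b" for a b using clique that .
    show "e \<in># edges H \<or> \<not> e \<subseteq> E" if "e \<in># edges G" "e \<inter> X = {}" for e
      using rest[OF that(1)] that(2) egg(1) by auto
  qed
next
  fix a b
  obtain E where "E \<in> S" "a \<notin> E" "b \<notin> E" using S unfolding scramble3_def by metis
  then show "\<exists>E'\<in>(\<lambda>E. E - X) ` S. a \<notin> E' \<and> b \<notin> E'" by (intro bexI[of _ "E - X"]) auto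
next
  fix P assume "\<exists>E'\<in>(\<lambda>E. E - X) ` S. E' \<subseteq> P" "\<exists>F'\<in>(\<lambda>E. E - X) ` S. F' \<inter> P = {}"
  then show "3 \<le> size (cut (edges H) P)" using cuts by blast
qed

lemma egg_meets_boundary:
  assumes "scramble3 G S" "E \<in> S" "\<not> E \<subseteq> X" "E \<inter> X \<noteq> {}"
  obtains a b where "a \<in> E \<inter> X" "b \<in> E - X" "b \<in> verts G" "{a, b} \<in># edges G"
proof -
  have "E \<subseteq> verts G" "conn (edges G) E" using assms(1,2) by (auto simp: scramble3_def)
  moreover have "E \<inter> X \<subset> E" using assms(3) by auto
  ultimately obtain a b where "a \<in> E \<inter> X" "b \<in> E" "b \<notin> E \<inter> X" "{a, b} \<in># edges G"
    using connD[of "edges G" E "E \<inter> X"] assms(4) by metis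
  then show ?thesis using that[of a b] \<open>E \<subseteq> verts G\<close> by blast
qed

lemma scramble3_delete:
  assumes mg: "multigraph G" and S: "scramble3 G S" and X: "\<And>E. E \<in> S \<Longrightarrow> \<not> E \<subseteq> X"
    and nbr: "\<And>a b. a \<in> X \<Longrightarrow> b \<in> verts G - X \<Longrightarrow> {a, b} \<in># edges G \<Longrightarrow> b = n"
  shows "scramble3 (induced_subgraph G (verts G - X)) ((\<lambda>E. E - X) ` S)"
proof (rule scramble3_diff[OF S X, where N = "{n}"])
  let ?H = "induced_subgraph G (verts G - X)"
  fix E F P assume EF: "E \<in> S" "F \<in> S" "E - X \<subseteq> P" "(F - X) \<inter> P = {}"
  have n: "n \<in> E - X" if "E \<in> S" "E \<inter> X \<noteq> {}" for E
  proof -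
    from egg_meets_boundary[OF S that(1) X[OF that(1)] that(2)] obtain a b
      where "a \<in> E \<inter> X" "b \<in> E - X" "b \<in> verts G" "{a, b} \<in># edges G" .
    then show ?thesis using nbr[of a b] by auto
  qed
  \<comment> \<open>An egg reaching into \<open>X\<close> contains \<open>n\<close>. Moving all of
    \<open>X\<close> to the side of \<open>n\<close> therefore keeps both eggs on their sides, and
    no edge meeting \<open>X\<close> is crossed.\<close>
  define P' where "P' = (if n \<in> P then P \<union> X else P - X)"
  have "E \<subseteq> P'" using EF n[OF EF(1)] by (auto simp: P'_def)
  moreover have "F \<inter> P' = {}" using EF n[OF EF(2)] by (auto simp: P'_def)
  ultimately have "3 \<le> size (cut (edges G) P')" using scramble3_cut[OF S EF(1,2)] by blast
  also have "\<dots> \<le> size {#e \<in># edges G. e \<subseteq> verts G - X \<and> e \<inter> P \<noteq> {} \<and> e \<inter> - P \<noteq> {}#}"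
    unfolding between_def
  proof (rule size_filter_mset_mono)
    fix e assume e: "e \<in># edges G" "e \<inter> P' \<noteq> {} \<and> e \<inter> - P' \<noteq> {}"
    obtain a b where ab: "e = {a, b}" "a \<in> verts G" "b \<in> verts G"
      using multigraph_edgeE[OF mg e(1)] by metis
    have ba: "{a, b} \<in># edges G" "{b, a} \<in># edges G" using e(1) ab(1) by (auto simp: insert_commute)
    have "a \<in> X \<longleftrightarrow> b \<in> X"
    proof (rule ccontr)
      assume "\<not> ?thesis"
      then have "a \<in> X \<and> b \<notin> X \<and> b = n \<or> b \<in> X \<and> a \<notin> X \<and> a = n"
        using nbr[of a b] nbr[of b a] ab ba by blast
      then show False using e(2) ab(1) by (auto simp: P'_def split: if_splits)
    qed
    then show "e \<subseteq> verts G - X \<and> e \<inter> P \<noteq> {} \<and> e \<inter> - P \<noteq> {}"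
      using e(2) ab by (auto simp: P'_def split: if_splits)
  qed
  also have "\<dots> = size (cut (edges ?H) P)"
    by (simp add: between_def induced_subgraph_def filter_filter_mset)
  finally show "3 \<le> size (cut (edges ?H) P)" .
qed (use nbr in \<open>auto simp: induced_subgraph_def\<close>)

text \<open>If \<open>y1\<close> and \<open>y2\<close> are on one side, \<open>X\<close> joins them
  and its boundary edges are uncrossed. If they are separated, the new edge costs 1, and so does the
  boundary of \<open>X\<close> on whichever side \<open>X\<close> is put. When one of the eggs
  misses \<open>X\<close>, one of these placements separates the eggs in \<open>G\<close>. When both
  meet \<open>X\<close>, neither does, and \<open>not_ring\<close> has to supply two edges besides
  the new one.\<close>

lemma scramble3_bypass:
  assumes mg: "multigraph G" and S: "scramble3 G S" and X: "\<And>E. E \<in> S \<Longrightarrow> \<not> E \<subseteq> X" "X \<subseteq> verts G"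
    and bd: "between (edges G) X (verts G - X) = {#{x1, y1}, {x2, y2}#}"
      "x1 \<in> X" "x2 \<in> X" "y1 \<in> verts G - X" "y2 \<in> verts G - X" "y1 \<noteq> y2"
    and not_ring: "\<And>P Q E F. P \<union> Q = verts G - X \<Longrightarrow> P \<inter> Q = {} \<Longrightarrow> y1 \<in> P \<Longrightarrow> y2 \<in> Q \<Longrightarrow>
      E \<in> S \<Longrightarrow> F \<in> S \<Longrightarrow> E \<subseteq> P \<union> X \<Longrightarrow> F \<subseteq> Q \<union> X \<Longrightarrow> 2 \<le> size (between (edges G) P Q)"
  shows "scramble3 \<lparr>verts = verts G - X, edges = add_mset {y1, y2} {#e \<in># edges G. e \<subseteq> verts G - X#}\<rparr>
    ((\<lambda>E. E - X) ` S)" (is "scramble3 ?H _")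
proof (rule scramble3_diff[OF S X(1), where N = "{y1, y2}"])
  let ?M0 = "{#e \<in># edges G. e \<subseteq> verts G - X#}"
  have nbr: "{a, b} = {x1, y1} \<or> {a, b} = {x2, y2}"
    if "a \<in> X" "b \<in> verts G - X" "{a, b} \<in># edges G" for a b
  proof -
    have "{a, b} \<in># between (edges G) X (verts G - X)" using that by (auto simp: between_def)
    then show ?thesis unfolding bd(1) by auto
  qed
  then show "b \<in> {y1, y2}" if "a \<in> X" "b \<in> verts G - X" "{a, b} \<in># edges G" for a b
    using that nbr[of a b] bd by (auto simp: doubleton_eq_iff)
  show "{a, b} \<in># edges ?H" if "a \<in> {y1, y2}" "b \<in> {y1, y2}" "a \<noteq> b" for a b
    using that by (auto simp: insert_commute)
  show "verts ?H = verts G - X" by simp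
  show "e \<in># edges ?H" if "e \<in># edges G" "e \<subseteq> verts G - X" for e using that by simp
  have cut_le: "size (cut (edges G) P) \<le> size (cut {#{x1, y1}, {x2, y2}#} P) + size (cut ?M0 P)"
    if P: "X \<subseteq> P \<or> X \<inter> P = {}" for P
  proof -
    have "size (cut (edges G) P) \<le> size {#e \<in># edges G.
      ((e \<inter> X \<noteq> {} \<and> e \<inter> (verts G - X) \<noteq> {}) \<and> e \<inter> P \<noteq> {} \<and> e \<inter> - P \<noteq> {}) \<or>
      (e \<subseteq> verts G - X \<and> e \<inter> P \<noteq> {} \<and> e \<inter> - P \<noteq> {})#}"
      unfolding between_def
    proof (rule size_filter_mset_mono)
      fix e assume e: "e \<in># edges G" "e \<inter> P \<noteq> {} \<and> e \<inter> - P \<noteq> {}"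
      have "e \<subseteq> verts G" using e(1) mg by (simp add: multigraph_def)
      moreover have "\<not> e \<subseteq> X" using e(2) P by blast
      ultimately show "(e \<inter> X \<noteq> {} \<and> e \<inter> (verts G - X) \<noteq> {}) \<and> e \<inter> P \<noteq> {} \<and> e \<inter> - P \<noteq> {} \<or>
        e \<subseteq> verts G - X \<and> e \<inter> P \<noteq> {} \<and> e \<inter> - P \<noteq> {}" using e(2) by blast
    qed
    also have "\<dots> \<le> size {#e \<in># edges G. (e \<inter> X \<noteq> {} \<and> e \<inter> (verts G - X) \<noteq> {}) \<and> e \<inter> P \<noteq> {} \<and> e \<inter> - P \<noteq> {}#}
      + size {#e \<in># edges G. e \<subseteq> verts G - X \<and> e \<inter> P \<noteq> {} \<and> e \<inter> - P \<noteq> {}#}"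
      by (rule size_filter_mset_or_le)
    also have "\<dots> = size (cut (between (edges G) X (verts G - X)) P) + size (cut ?M0 P)"
      by (simp add: between_def filter_filter_mset)
    finally show ?thesis unfolding bd(1) .
  qed
  have cut_avoid: "cut ?M0 (P \<union> X) = cut ?M0 P" "cut ?M0 (P - X) = cut ?M0 P" for P
    unfolding between_def filter_filter_mset by (rule filter_mset_cong, simp, blast)+
  have H: "size (cut (edges ?H) P) = size (cut {#{y1, y2}#} P) + size (cut ?M0 P)" for P
    by (simp add: between_def)
  have same: "3 \<le> size (cut (edges ?H) P)"
    if EF: "E \<in> S" "F \<in> S" "E - X \<subseteq> P" "(F - X) \<inter> P = {}" and "y1 \<in> P \<longleftrightarrow> y2 \<in> P" for E F P
  proof -
    have y: "y1 \<in> E - X \<or> y2 \<in> E - X" if "E \<in> S" "E \<inter> X \<noteq> {}" for E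
    proof -
      from egg_meets_boundary[OF S that(1) X(1)[OF that(1)] that(2)] obtain a b
        where "a \<in> E \<inter> X" "b \<in> E - X" "b \<in> verts G" "{a, b} \<in># edges G" .
      then show ?thesis using nbr[of a b] bd by (auto simp: doubleton_eq_iff)
    qed
    define P' where "P' = (if y1 \<in> P then P \<union> X else P - X)"
    have "E \<subseteq> P'" using EF y[OF EF(1)] that(5) by (auto simp: P'_def)
    moreover have "F \<inter> P' = {}" using EF y[OF EF(2)] that(5) by (auto simp: P'_def)
    ultimately have "3 \<le> size (cut (edges G) P')" using scramble3_cut[OF S EF(1,2)] by blast
    also have "\<dots> \<le> size (cut {#{x1, y1}, {x2, y2}#} P') + size (cut ?M0 P')"
      by (rule cut_le) (auto simp: P'_def)
    also have "cut ?M0 P' = cut ?M0 P" unfolding P'_def using cut_avoid by simp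
    also have "cut {#{x1, y1}, {x2, y2}#} P' = {#}"
      using bd that(5) by (auto simp: between_def P'_def)
    finally show ?thesis using H[of P] by simp
  qed
  have diff: "3 \<le> size (cut (edges ?H) P)"
    if EF: "E \<in> S" "F \<in> S" "E - X \<subseteq> P" "(F - X) \<inter> P = {}" and y: "y1 \<in> P" "y2 \<notin> P" for E F P
  proof -
    have one: "size (cut (edges ?H) P) = 1 + size (cut ?M0 P)" using H[of P] y by (simp add: between_def)
    consider "E \<inter> X = {}" | "F \<inter> X = {}" | "E \<inter> X \<noteq> {}" "F \<inter> X \<noteq> {}" by blast
    then show ?thesis
    proof cases
      case 1
      then have "E \<subseteq> P - X" "F \<inter> (P - X) = {}" using EF by auto
      then have "3 \<le> size (cut (edges G) (P - X))" using scramble3_cut[OF S EF(1,2)] by blast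
      also have "\<dots> \<le> size (cut {#{x1, y1}, {x2, y2}#} (P - X)) + size (cut ?M0 (P - X))"
        by (rule cut_le) auto
      also have "size (cut {#{x1, y1}, {x2, y2}#} (P - X)) \<le> 1"
        using bd y by (auto simp: between_def)
      finally show ?thesis unfolding one cut_avoid by simp
    next
      case 2
      then have "E \<subseteq> P \<union> X" "F \<inter> (P \<union> X) = {}" using EF by auto
      then have "3 \<le> size (cut (edges G) (P \<union> X))" using scramble3_cut[OF S EF(1,2)] by blast
      also have "\<dots> \<le> size (cut {#{x1, y1}, {x2, y2}#} (P \<union> X)) + size (cut ?M0 (P \<union> X))"
        by (rule cut_le) auto
      also have "size (cut {#{x1, y1}, {x2, y2}#} (P \<union> X)) \<le> 1"
        using bd y by (auto simp: between_def)
      finally show ?thesis unfolding one cut_avoid by simp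
    next
      case 3
      have egg: "E \<subseteq> verts G" "F \<subseteq> verts G" using S EF(1,2) by (auto simp: scramble3_def)
      let ?P = "(verts G - X) \<inter> P" and ?Q = "(verts G - X) - P"
      have "2 \<le> size (between (edges G) ?P ?Q)"
      proof (rule not_ring[OF _ _ _ _ EF(1,2)])
        show "E \<subseteq> ?P \<union> X" "F \<subseteq> ?Q \<union> X" using egg EF by auto
      qed (use bd y in auto)
      also have "between (edges G) ?P ?Q = cut ?M0 P"
        unfolding between_def filter_filter_mset
      proof (rule filter_mset_cong)
        fix e assume e: "e \<in># edges G"
        obtain a b where ab: "e = {a, b}" "a \<in> verts G" "b \<in> verts G"
          using multigraph_edgeE[OF mg e] by metis
        then show "e \<inter> ?P \<noteq> {} \<and> e \<inter> ?Q \<noteq> {} \<longleftrightarrow> e \<subseteq> verts G - X \<and> e \<inter> P \<noteq> {} \<and> e \<inter> - P \<noteq> {}"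
          by auto
      qed simp
      finally show ?thesis unfolding one by simp
    qed
  qed
  fix E F P assume EF: "E \<in> S" "F \<in> S" "E - X \<subseteq> P" "(F - X) \<inter> P = {}"
  consider "y1 \<in> P \<longleftrightarrow> y2 \<in> P" | "y1 \<in> P" "y2 \<notin> P" | "y1 \<in> - P" "y2 \<notin> - P" by auto
  then show "3 \<le> size (cut (edges ?H) P)"
  proof cases
    case 1
    then show ?thesis using same[OF EF] by blast
  next
    case 2
    then show ?thesis using diff[OF EF] by blast
  next
    case 3
    \<comment> \<open>Complementing \<open>P\<close> exchanges the roles of the two eggs and brings
      \<open>y1\<close> inside.\<close>
    have "F - X \<subseteq> - P" "(E - X) \<inter> - P = {}" using EF by auto
    then have "3 \<le> size (cut (edges ?H) (- P))" using diff[OF EF(2,1)] 3 by blast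
    then show ?thesis by (simp add: between_sym)
  qed
qed

text \<open>Two boundary edges are few enough to contract \<open>X\<close> to one vertex, which then
  has degree 2 and can be smoothed.\<close>

lemma tm_steps_bypass:
  assumes mg: "multigraph G" and X: "X \<subseteq> verts G" "conn (edges G) X"
    and bd: "between (edges G) X (verts G - X) = {#{x1, y1}, {x2, y2}#}"
      "x1 \<in> X" "x2 \<in> X" "y1 \<in> verts G - X" "y2 \<in> verts G - X" "y1 \<noteq> y2"
  shows "tm_step\<^sup>*\<^sup>* G
    \<lparr>verts = verts G - X, edges = add_mset {y1, y2} {#e \<in># edges G. e \<subseteq> verts G - X#}\<rparr>"
proof -
  let ?M0 = "{#e \<in># edges G. e \<subseteq> verts G - X#}"
  define \<phi> where "\<phi> v = (if v \<in> X then x1 else v)" for v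
  define W where "W = insert x1 (verts G - X)"
  define N where "N = {#{x1, y1}, {x1, y2}#} + ?M0"
  have \<phi>X: "\<phi> x1 = x1" "\<phi> x2 = x1" "\<phi> y1 = y1" "\<phi> y2 = y2" using bd by (auto simp: \<phi>_def)
  have card: "card (\<phi> ` e) = 2 \<longleftrightarrow> (e \<inter> X \<noteq> {} \<and> e \<inter> (verts G - X) \<noteq> {}) \<or> e \<subseteq> verts G - X"
    if e: "e \<in># edges G" for e
  proof -
    obtain a b where "e = {a, b}" "a \<noteq> b" "a \<in> verts G" "b \<in> verts G" using multigraph_edgeE[OF mg e] .
    then show ?thesis using bd(2) by (cases "a \<in> X"; cases "b \<in> X") (auto simp: \<phi>_def card_insert_if)
  qed
  have "{#e \<in># edges G. card (\<phi> ` e) = 2#} =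
    {#e \<in># edges G. (e \<inter> X \<noteq> {} \<and> e \<inter> (verts G - X) \<noteq> {}) \<or> e \<subseteq> verts G - X#}"
    by (rule filter_mset_cong) (use card in auto)
  also have "\<dots> = between (edges G) X (verts G - X) + ?M0"
    unfolding between_def by (rule filter_mset_disj) blast
  finally have "image_mset (image \<phi>) {#e \<in># edges G. card (\<phi> ` e) = 2#} =
      {#{x1, y1}, {x1, y2}#} + image_mset (image \<phi>) ?M0"
    unfolding bd(1) using \<phi>X by simp
  also have "image_mset (image \<phi>) ?M0 = image_mset (\<lambda>e. e) ?M0"
  proof (rule image_mset_cong)
    fix e assume "e \<in># ?M0"
    then have "\<phi> v = v" if "v \<in> e" for v using that by (auto simp: \<phi>_def)
    then show "\<phi> ` e = e" by force
  qed
  finally have N: "image_mset (image \<phi>) {#e \<in># edges G. card (\<phi> ` e) = 2#} = N" by (simp add: N_def)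
  have W: "\<phi> ` verts G = W" using bd(2) X(1) by (auto simp: \<phi>_def W_def)
  have fib: "{v \<in> verts G. \<phi> v = w} = (if w = x1 then X else {w})" if "w \<in> W" for w
    using that bd(2) X(1) by (auto simp: \<phi>_def W_def)
  have "\<exists>\<sigma>. (\<forall>w\<in>W. \<sigma> w \<in> verts G \<and> \<phi> (\<sigma> w) = w) \<and>
    tm_step\<^sup>*\<^sup>* G \<lparr>verts = \<sigma> ` W, edges = image_mset (image \<sigma>) N\<rparr>"
  proof (rule cubic_quotient[OF mg W N])
    fix w assume w: "w \<in> W"
    show "conn (edges G) {v \<in> verts G. \<phi> v = w}" using fib[OF w] X(2) by simp
    assume "2 \<le> card {v \<in> verts G. \<phi> v = w}"
    then have "w = x1" using fib[OF w] by (auto split: if_splits)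
    then have "{#e \<in># ?M0. w \<in> e#} = {#}" using bd(2) by auto
    then have "{#e \<in># N. w \<in> e#} = {#{x1, y1}, {x1, y2}#}" using \<open>w = x1\<close> by (simp add: N_def)
    then show "size {#e \<in># N. w \<in> e#} \<le> 3" by simp
  qed
  then obtain \<sigma> where \<sigma>: "\<And>w. w \<in> W \<Longrightarrow> \<sigma> w \<in> verts G \<and> \<phi> (\<sigma> w) = w"
    and steps: "tm_step\<^sup>*\<^sup>* G \<lparr>verts = \<sigma> ` W, edges = image_mset (image \<sigma>) N\<rparr>" by blast
  \<comment> \<open>The surviving representative of \<open>X\<close> is some vertex of
    \<open>X\<close>, not necessarily \<open>x1\<close>.\<close>
  define z where "z = \<sigma> x1"
  have z: "z \<in> X" using \<sigma>[of x1] bd by (auto simp: z_def W_def \<phi>_def split: if_splits)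
  have \<sigma>id: "\<sigma> w = w" if "w \<in> verts G - X" for w
    using \<sigma>[of w] that bd(2) by (auto simp: W_def \<phi>_def split: if_splits)
  have "image_mset (image \<sigma>) ?M0 = image_mset (\<lambda>e. e) ?M0"
  proof (rule image_mset_cong)
    fix e assume "e \<in># ?M0"
    then have "\<sigma> v = v" if "v \<in> e" for v using that \<sigma>id by auto
    then show "\<sigma> ` e = e" by force
  qed
  then have eH: "image_mset (image \<sigma>) N = {#{z, y1}, {z, y2}#} + ?M0"
    using \<sigma>id bd by (simp add: N_def z_def)
  have vH: "\<sigma> ` W = insert z (verts G - X)" using \<sigma>id by (auto simp: W_def z_def)
  let ?H = "\<lparr>verts = insert z (verts G - X), edges = {#{z, y1}, {z, y2}#} + ?M0\<rparr>"
  have steps': "tm_step\<^sup>*\<^sup>* G ?H" using steps unfolding eH vH .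
  have "{#{z, y1}, {z, y2}#} \<subseteq># edges ?H" by simp
  then have "tm_step\<^sup>*\<^sup>* ?H (split_off ?H z y1 y2)"
    by (rule tm_steps_split_off[OF tm_steps_multigraph[OF steps' mg] _ bd(6)])
  moreover have "{#e \<in># ?M0. z \<notin> e#} = ?M0" using z by (auto simp: filter_mset_eq_conv)
  then have "split_off ?H z y1 y2 = \<lparr>verts = verts G - X, edges = add_mset {y1, y2} ?M0\<rparr>"
    using z by (auto simp: split_off_def)
  ultimately show ?thesis using steps' by simp
qed

section \<open>Induction over egg-free sets with a small boundary\<close>

theorem scramble3_minor:
  assumes "multigraph G" "scramble3 G S"
  shows "topological_minor K4 G \<or> topological_minor P33 G \<or> topological_minor C3221 G \<or>
    topological_minor LL6 G"
  using assms
proof (induction "card (verts G)" arbitrary: G S rule: less_induct)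
  case less
  note mg = less.prems(1) and S = less.prems(2)
  let ?M = "edges G"
  have fin: "finite (verts G)" using mg by (simp add: multigraph_def)
  have egg: "E \<subseteq> verts G" "E \<noteq> {}" if "E \<in> S" for E using S that by (auto simp: scramble3_def conn_def)
  have reduce: ?case if steps: "tm_step\<^sup>*\<^sup>* G H" and "scramble3 H S'" "verts H \<subset> verts G" for H S'
  proof -
    have "card (verts H) < card (verts G)" using that(3) fin by (rule psubset_card_mono[rotated])
    then show ?thesis
      using less.hyps[of H S'] that tm_steps_multigraph[OF steps mg] topological_minor_steps[OF steps] by blast
  qed
  show ?case
  proof (rule ccontr)
    assume contr: "\<not> ?case"
    have two: "\<exists>a b a' b'. a \<in> X \<and> a' \<in> X \<and> b \<in> verts G - X \<and> b' \<in> verts G - X \<and> b \<noteq> b' \<and>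
        {a, b} \<in># ?M \<and> {a', b'} \<in># ?M"
      if X: "X \<subseteq> verts G" "X \<noteq> {}" "\<And>E. E \<in> S \<Longrightarrow> \<not> E \<subseteq> X" for X
    proof (rule ccontr)
      assume n: "\<not> ?thesis"
      have "\<exists>n. \<forall>a b. a \<in> X \<longrightarrow> b \<in> verts G - X \<longrightarrow> {a, b} \<in># ?M \<longrightarrow> b = n"
      proof (cases "\<exists>a b. a \<in> X \<and> b \<in> verts G - X \<and> {a, b} \<in># ?M")
        case True
        then obtain a n where "a \<in> X" "n \<in> verts G - X" "{a, n} \<in># ?M" by blast
        then show ?thesis using n by (intro exI[of _ n]) blast
      qed blast
      then obtain n where nbr: "\<And>a b. a \<in> X \<Longrightarrow> b \<in> verts G - X \<Longrightarrow> {a, b} \<in># ?M \<Longrightarrow> b = n" by blast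
      have "scramble3 (induced_subgraph G (verts G - X)) ((\<lambda>E. E - X) ` S)"
        by (rule scramble3_delete[OF mg S X(3), where n = n]) (assumption, rule nbr)
      then show False
        using reduce[OF tm_steps_induced[OF mg X(1)]] X(1,2) contr by (auto simp: induced_subgraph_def)
    qed
    \<comment> \<open>Every nonempty part of \<open>X\<close> is egg-free too and has at least two
      boundary edges by \<open>two\<close>. Hence \<open>X\<close> has exactly two, ending in
      distinct outside vertices, and 2 + 2 > 2 makes it connected.\<close>
    have small: "\<exists>x1 y1 x2 y2. between ?M X (verts G - X) = {#{x1, y1}, {x2, y2}#} \<and> x1 \<in> X \<and> x2 \<in> X \<and>
        y1 \<in> verts G - X \<and> y2 \<in> verts G - X \<and> y1 \<noteq> y2 \<and> conn ?M X"
      if X: "X \<subseteq> verts G" "X \<noteq> {}" "\<And>E. E \<in> S \<Longrightarrow> \<not> E \<subseteq> X" and c: "size (cut ?M X) \<le> 2" for X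
    proof -
      have ge2: "\<exists>a b a' b'. a \<in> Y \<and> a' \<in> Y \<and> b \<in> verts G - Y \<and> b' \<in> verts G - Y \<and> b \<noteq> b' \<and>
        {#{a, b}, {a', b'}#} \<subseteq># cut ?M Y" if Y: "Y \<subseteq> X" "Y \<noteq> {}" for Y
      proof -
        have "\<not> E \<subseteq> Y" if "E \<in> S" for E using X(3)[OF that] Y by blast
        then obtain a b a' b' where ab: "a \<in> Y" "a' \<in> Y" "b \<in> verts G - Y" "b' \<in> verts G - Y" "b \<noteq> b'"
          "{a, b} \<in># ?M" "{a', b'} \<in># ?M" using two[of Y] X(1) Y by blast
        have "{a, b} \<noteq> {a', b'}" using ab by (auto simp: doubleton_eq_iff)
        then have "{#{a, b}, {a', b'}#} \<subseteq># cut ?M Y"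
          using ab by (intro pair_subseteq_mset) (auto simp: between_def)
        then show ?thesis using ab by blast
      qed
      have sz2: "2 \<le> size (cut ?M Y)" if Y: "Y \<subseteq> X" "Y \<noteq> {}" for Y
      proof -
        obtain e f where "{#e, f#} \<subseteq># cut ?M Y" using ge2[OF Y] by blast
        from size_mset_mono[OF this] show ?thesis by simp
      qed
      have "conn ?M X"
      proof (rule conn_if_cuts[OF mg X(2)])
        fix A assume "A \<subset> X" "A \<noteq> {}"
        then show "size (cut ?M X) < size (cut ?M A) + size (cut ?M (X - A))"
          using sz2[of A] sz2[of "X - A"] c by force
      qed
      moreover obtain x1 y1 x2 y2 where xy: "x1 \<in> X" "x2 \<in> X" "y1 \<in> verts G - X" "y2 \<in> verts G - X" "y1 \<noteq> y2"
        and sub: "{#{x1, y1}, {x2, y2}#} \<subseteq># cut ?M X" using ge2[of X] X(2) by blast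
      obtain K where K: "cut ?M X = {#{x1, y1}, {x2, y2}#} + K" using sub by (metis subset_mset.le_iff_add)
      have "K = {#}" using c unfolding K by simp
      moreover have "cut ?M X = between ?M X (verts G - X)"
        by (rule cut_eq_between[OF mg]) (use X(1) in auto)
      ultimately show ?thesis using xy K
        by (intro exI[of _ x1] exI[of _ y1] exI[of _ x2] exI[of _ y2]) auto
    qed
    have "three_edge_connected G"
      unfolding three_edge_connected_def
    proof (intro allI impI, rule ccontr)
      fix X0 assume X0: "X0 \<subset> verts G" "X0 \<noteq> {}" and "\<not> 3 \<le> size (cut ?M X0)"
      then have c0: "size (cut ?M X0) \<le> 2" by simp
      \<comment> \<open>A cut with at most two edges cannot have eggs on both sides, so one side is
        egg-free.\<close>
      have "\<exists>X. X \<subseteq> verts G \<and> X \<noteq> {} \<and> (\<forall>E\<in>S. \<not> E \<subseteq> X) \<and> size (cut ?M X) \<le> 2"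
      proof (cases "\<exists>E\<in>S. E \<subseteq> X0")
        case False
        then show ?thesis using X0 c0 by blast
      next
        case True
        then obtain E where E: "E \<in> S" "E \<subseteq> X0" by blast
        have "\<not> F \<subseteq> verts G - X0" if "F \<in> S" for F
          using scramble3_cut[OF S E(1) that E(2)] c0 by fastforce
        moreover have "cut ?M (verts G - X0) = cut ?M X0" using cut_complement[OF mg] X0 by blast
        ultimately show ?thesis using X0 c0 by (intro exI[of _ "verts G - X0"]) auto
      qed
      then obtain X where X: "X \<subseteq> verts G" "X \<noteq> {}" "\<And>E. E \<in> S \<Longrightarrow> \<not> E \<subseteq> X" "size (cut ?M X) \<le> 2" by blast
      obtain x1 y1 x2 y2 where bd: "between ?M X (verts G - X) = {#{x1, y1}, {x2, y2}#}" "x1 \<in> X" "x2 \<in> X"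
        "y1 \<in> verts G - X" "y2 \<in> verts G - X" "y1 \<noteq> y2" and cX: "conn ?M X"
        using small[OF X] by blast
      let ?H = "\<lparr>verts = verts G - X, edges = add_mset {y1, y2} {#e \<in># edges G. e \<subseteq> verts G - X#}\<rparr>"
      have "scramble3 ?H ((\<lambda>E. E - X) ` S)"
      proof (rule scramble3_bypass[OF mg S X(3,1) bd], assumption, rule ccontr)
        fix P Q E F
        assume PQ: "P \<union> Q = verts G - X" "P \<inter> Q = {}" "y1 \<in> P" "y2 \<in> Q"
          and EF: "E \<in> S" "F \<in> S" "E \<subseteq> P \<union> X" "F \<subseteq> Q \<union> X" and "\<not> 2 \<le> size (between ?M P Q)"
        then have thin: "size (between ?M P Q) \<le> 1" by simp
        have V: "verts G = X \<union> P \<union> Q" "X \<inter> P = {}" "X \<inter> Q = {}" using PQ X(1) by auto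
        have XY: "between ?M X Y = {#e \<in># {#{x1, y1}, {x2, y2}#}. e \<inter> Y \<noteq> {}#}" if "Y \<subseteq> verts G - X" for Y
          unfolding bd(1)[symmetric] between_def filter_filter_mset
          by (rule filter_mset_cong) (use that in auto)
        have "x1 \<notin> P" "x2 \<notin> P" "y2 \<notin> P" "x1 \<notin> Q" "x2 \<notin> Q" "y1 \<notin> Q" "P \<subseteq> verts G - X" "Q \<subseteq> verts G - X"
          using V(2,3) bd(2,3) PQ by auto
        then have XP: "between ?M X P = {#{x1, y1}#}" and XQ: "between ?M X Q = {#{x2, y2}#}"
          using XY[of P] XY[of Q] PQ(3,4) by simp_all
        have cutP: "size (cut ?M P) \<le> 2" if "A \<union> B \<union> P = verts G" "P \<inter> A = {}" "P \<inter> B = {}"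
          "size (between ?M P A) \<le> 1" "size (between ?M P B) \<le> 1" for A B P
        proof -
          have "size (cut ?M P) \<le> size {#e \<in># ?M. e \<inter> P \<noteq> {} \<and> e \<inter> A \<noteq> {} \<or> e \<inter> P \<noteq> {} \<and> e \<inter> B \<noteq> {}#}"
            unfolding between_def
          proof (rule size_filter_mset_mono)
            fix e assume e: "e \<in># ?M" "e \<inter> P \<noteq> {} \<and> e \<inter> - P \<noteq> {}"
            have "e \<subseteq> A \<union> B \<union> P" using e(1) mg that(1) by (simp add: multigraph_def)
            then show "e \<inter> P \<noteq> {} \<and> e \<inter> A \<noteq> {} \<or> e \<inter> P \<noteq> {} \<and> e \<inter> B \<noteq> {}" using e(2) by blast
          qed
          also have "\<dots> \<le> size (between ?M P A) + size (between ?M P B)"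
            unfolding between_def by (rule size_filter_mset_or_le)
          finally show ?thesis using that(4,5) by simp
        qed
        have cP: "size (cut ?M P) \<le> 2"
          by (rule cutP[of X Q]) (use V PQ thin XP in \<open>auto simp: between_sym\<close>)
        have cQ: "size (cut ?M Q) \<le> 2"
          by (rule cutP[of X P]) (use V PQ thin XQ in \<open>auto simp: between_sym\<close>)
        \<comment> \<open>\<open>P\<close> has one edge to \<open>X\<close> and at most one to
          \<open>Q\<close>, and \<open>F\<close> avoids it; an egg inside \<open>P\<close> would be
          separated from \<open>F\<close> too cheaply. Likewise for \<open>Q\<close> and
          \<open>E\<close>.\<close>
        have noP: "\<not> E' \<subseteq> P" if "E' \<in> S" for E'
          using scramble3_cut[OF S that EF(2), of P] EF(4) V PQ(2) cP by fastforce
        have noQ: "\<not> E' \<subseteq> Q" if "E' \<in> S" for E'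
          using scramble3_cut[OF S that EF(1), of Q] EF(3) V PQ(2) cQ by fastforce
        have PV: "P \<subseteq> verts G" "P \<noteq> {}" and QV: "Q \<subseteq> verts G" "Q \<noteq> {}" using V PQ by auto
        have connP: "conn ?M P" using small[OF PV noP cP] by blast
        have connQ: "conn ?M Q" using small[OF QV noQ cQ] by blast
        \<comment> \<open>\<open>P\<close> has two different outside neighbours, and only
          \<open>x1\<close> among them can be in \<open>X\<close>. So an edge runs from
          \<open>P\<close> to \<open>Q\<close>, closing the ring.\<close>
        obtain a b a' b' where ab: "a \<in> P" "a' \<in> P" "b \<in> verts G - P" "b' \<in> verts G - P" "b \<noteq> b'"
          "{a, b} \<in># ?M" "{a', b'} \<in># ?M" using two[OF PV noP] by blast
        have "b = x1" if "a \<in> P" "b \<in> X" "{a, b} \<in># ?M" for a b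
          using between_singletonD[OF XP V(2) bd(2) PQ(3) that(2,1)] that(3) by (simp add: insert_commute)
        then have "\<not> (b \<in> X \<and> b' \<in> X)" using ab by metis
        then have "b \<in> Q \<or> b' \<in> Q" using ab(3,4) V(1) by blast
        then obtain p q where pq: "p \<in> P" "q \<in> Q" "{p, q} \<in># ?M" using ab by blast
        then have "{p, q} \<in># between ?M P Q" by (auto simp: between_def)
        then obtain K where "between ?M P Q = add_mset {p, q} K" by (metis multi_member_split)
        then have "between ?M P Q = {#{p, q}#}" using thin by simp
        then have "topological_minor LL6 G"
          using ring_LL6[OF mg S V PQ(2) XP bd(2) PQ(3) XQ bd(3) PQ(4) _ pq(1,2) _ cX connP connQ] X(3) noP noQ by blast
        then show False using contr by blast
      qed
      moreover have "tm_step\<^sup>*\<^sup>* G ?H" by (rule tm_steps_bypass[OF mg X(1) cX bd])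
      ultimately show False using reduce[of ?H] X(1,2) contr by auto
    qed
    moreover have "3 \<le> card (verts G)"
    proof (rule ccontr)
      assume "\<not> ?thesis"
      then obtain a b where "verts G \<subseteq> {a, b}" using subset_pair_if_card_le_2[OF fin] by force
      moreover obtain E where "E \<in> S" "a \<notin> E" "b \<notin> E" using S unfolding scramble3_def by metis
      ultimately show False using egg[of E] by blast
    qed
    ultimately show False using three_edge_connected_minor[OF mg] contr by blast
  qed
qed

theorem theorem1p1:
  fixes G :: "'v mgraph"
  assumes "multigraph G"
  shows "scramble_number G \<le> 2 \<longleftrightarrow>
    \<not> topological_minor K4 G \<and> \<not> topological_minor P33 G \<and>
    \<not> topological_minor C3221 G \<and> \<not> topological_minor LL6 G"
proof -
  have "(\<exists>S. scramble3 G S) \<longleftrightarrow> topological_minor K4 G \<or> topological_minor P33 G \<or>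
    topological_minor C3221 G \<or> topological_minor LL6 G"
    using scramble3_minor[OF assms] scramble3_topological_minor[OF _ assms]
      scramble3_K4 scramble3_P33 scramble3_C3221 scramble3_LL6 by blast
  then show ?thesis unfolding scramble_number_le_2_iff[OF assms] by blast
qed

end
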